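(* Let $T$ be $\mathrm{NTP}_2$. Suppose $A$ is a left extension base for invariance, i.e. (a) for every tuple $a$, $tp(a/A)$ has a global extension fixed by every automorphism in $AutfL(\mathfrak{C}/A)$, and (b) whenever $tp(X/YA)$ has a global $AutfL(\mathfrak{C}/A)$-invariant extension and $D\supseteq X$, there is $D'\equiv_{XA}D$ such that $tp(D'/YA)$ has a global $AutfL(\mathfrak{C}/A)$-invariant extension. Then forking equals dividing over $A$, and moreover $A$ is an extension base for strict invariance: for every $a$, $tp(a/A)$ is strictly invariant over $A$.
   Context: $AutfL(\mathfrak{C}/A)$ is the group generated by automorphisms fixing pointwise some small model containing $A$. $tp(a/Bb)$ is strictly invariant over $B$ if it has a global $AutfL(\mathfrak{C}/B)$-invariant extension $q$ such that for any $C\supseteq B$ and $c\models q|_C$, $tp(C/Bc)$ does not fork over $B$. *)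

theory Defs
  imports Main
begin

unbundle cardinal_syntax

section \<open>First-order logic\<close>

text \<open>
  Quantified variables are de Bruijn indices (\<open>Bnd\<close>); free variables (\<open>Fre\<close>) are labelled by an
  arbitrary type \<open>'v\<close>.  A formula in variables labelled by \<open>'i\<close> with parameters from a structure
  with universe \<open>'a\<close> has labels in \<open>'i + 'a\<close>: \<open>Inl i\<close> is the variable \<open>x\<^sub>i\<close>, and \<open>Inr b\<close> is the
  parameter \<open>b\<close>.
\<close>

datatype (dead 'f, frees_tm: 'v) tm =
    Bnd nat
  | Fre 'v
  | App 'f "('f, 'v) tm list"
  for map: map_tm

datatype (dead 'f, dead 'r, frees: 'v) fm =
    Eq "('f, 'v) tm" "('f, 'v) tm"
  | Rel 'r "('f, 'v) tm list"
  | Neg "('f, 'r, 'v) fm"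
  | Conj "('f, 'r, 'v) fm" "('f, 'r, 'v) fm"
  | Ex "('f, 'r, 'v) fm"
  for map: map_fm

text \<open>
  A structure carries its signature: the sets \<open>fsyms\<close>, \<open>rsyms\<close> of symbols with their arities.
  Its universe is the whole type \<open>'a\<close>.  Interpretations at other symbols or arities are junk and
  are excluded by well-formedness.
\<close>

record ('f, 'r, 'a) struct =
  fsyms :: "('f \<times> nat) set"
  rsyms :: "('r \<times> nat) set"
  fint :: "'f \<Rightarrow> 'a list \<Rightarrow> 'a"
  rint :: "'r \<Rightarrow> 'a list \<Rightarrow> bool"

fun wf_tm :: "('f, 'r, 'a) struct \<Rightarrow> nat \<Rightarrow> ('f, 'v) tm \<Rightarrow> bool" where
  "wf_tm M n (Bnd m) \<longleftrightarrow> m < n"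
| "wf_tm M n (Fre x) \<longleftrightarrow> True"
| "wf_tm M n (App f ts) \<longleftrightarrow> (f, length ts) \<in> fsyms M \<and> (\<forall>t \<in> set ts. wf_tm M n t)"

text \<open>\<open>n\<close> is the number of enclosing quantifiers.\<close>

fun wf_fm :: "('f, 'r, 'a) struct \<Rightarrow> nat \<Rightarrow> ('f, 'r, 'v) fm \<Rightarrow> bool" where
  "wf_fm M n (Eq s t) \<longleftrightarrow> wf_tm M n s \<and> wf_tm M n t"
| "wf_fm M n (Rel r ts) \<longleftrightarrow> (r, length ts) \<in> rsyms M \<and> (\<forall>t \<in> set ts. wf_tm M n t)"
| "wf_fm M n (Neg \<phi>) \<longleftrightarrow> wf_fm M n \<phi>"
| "wf_fm M n (Conj \<phi> \<psi>) \<longleftrightarrow> wf_fm M n \<phi> \<and> wf_fm M n \<psi>"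
| "wf_fm M n (Ex \<phi>) \<longleftrightarrow> wf_fm M (Suc n) \<phi>"

definition formulas :: "('f, 'r, 'a) struct \<Rightarrow> 'v set \<Rightarrow> ('f, 'r, 'v) fm set" where
  "formulas M V = {\<phi>. wf_fm M 0 \<phi> \<and> frees \<phi> \<subseteq> V}"

fun val :: "('f, 'r, 'a) struct \<Rightarrow> ('v \<Rightarrow> 'a) \<Rightarrow> 'a list \<Rightarrow> ('f, 'v) tm \<Rightarrow> 'a" where
  "val M v e (Bnd m) = e ! m"
| "val M v e (Fre x) = v x"
| "val M v e (App f ts) = fint M f (map (val M v e) ts)"

text \<open>Satisfaction in the substructure with universe \<open>D\<close>: quantifiers range over \<open>D\<close>.\<close>

fun sat :: "('f, 'r, 'a) struct \<Rightarrow> 'a set \<Rightarrow> ('v \<Rightarrow> 'a) \<Rightarrow> 'a list \<Rightarrow> ('f, 'r, 'v) fm \<Rightarrow> bool" where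
  "sat M D v e (Eq s t) \<longleftrightarrow> val M v e s = val M v e t"
| "sat M D v e (Rel r ts) \<longleftrightarrow> rint M r (map (val M v e) ts)"
| "sat M D v e (Neg \<phi>) \<longleftrightarrow> \<not> sat M D v e \<phi>"
| "sat M D v e (Conj \<phi> \<psi>) \<longleftrightarrow> sat M D v e \<phi> \<and> sat M D v e \<psi>"
| "sat M D v e (Ex \<phi>) \<longleftrightarrow> (\<exists>x \<in> D. sat M D v (x # e) \<phi>)"

definition elem_substructure :: "('f, 'r, 'a) struct \<Rightarrow> 'a set \<Rightarrow> bool" where
  "elem_substructure M N \<longleftrightarrow>
     N \<noteq> {} \<and>
     (\<forall>(f, n) \<in> fsyms M. \<forall>xs. length xs = n \<longrightarrow> set xs \<subseteq> N \<longrightarrow> fint M f xs \<in> N) \<and>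
     (\<forall>\<phi> \<in> formulas M N. sat M N id [] \<phi> \<longleftrightarrow> sat M UNIV id [] \<phi>)"

definition Aut :: "('f, 'r, 'a) struct \<Rightarrow> ('a \<Rightarrow> 'a) set" where
  "Aut M = {\<sigma>. bij \<sigma> \<and>
     (\<forall>(f, n) \<in> fsyms M. \<forall>xs. length xs = n \<longrightarrow> \<sigma> (fint M f xs) = fint M f (map \<sigma> xs)) \<and>
     (\<forall>(r, n) \<in> rsyms M. \<forall>xs. length xs = n \<longrightarrow> (rint M r xs \<longleftrightarrow> rint M r (map \<sigma> xs)))}"


section \<open>Types\<close>

text \<open>\<open>I <+> B\<close> labels the variables \<open>(x\<^sub>i)\<close> for \<open>i \<in> I\<close> and the parameters from \<open>B\<close>.\<close>

definition holds :: "('f, 'r, 'a) struct \<Rightarrow> ('i \<Rightarrow> 'a) \<Rightarrow> ('f, 'r, 'i + 'a) fm \<Rightarrow> bool" where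
  "holds M c \<phi> \<longleftrightarrow> sat M UNIV (case_sum c id) [] \<phi>"

definition realizes :: "('f, 'r, 'a) struct \<Rightarrow> ('i \<Rightarrow> 'a) \<Rightarrow> ('f, 'r, 'i + 'a) fm set \<Rightarrow> bool" where
  "realizes M c p \<longleftrightarrow> (\<forall>\<phi> \<in> p. holds M c \<phi>)"

definition consistent :: "('f, 'r, 'a) struct \<Rightarrow> ('f, 'r, 'i + 'a) fm set \<Rightarrow> bool" where
  "consistent M p \<longleftrightarrow> (\<forall>F. finite F \<longrightarrow> F \<subseteq> p \<longrightarrow> (\<exists>c. realizes M c F))"

definition complete_type ::
    "('f, 'r, 'a) struct \<Rightarrow> 'i set \<Rightarrow> 'a set \<Rightarrow> ('f, 'r, 'i + 'a) fm set \<Rightarrow> bool" where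
  "complete_type M I B p \<longleftrightarrow>
     p \<subseteq> formulas M (I <+> B) \<and> consistent M p \<and>
     (\<forall>\<phi> \<in> formulas M (I <+> B). \<phi> \<in> p \<or> Neg \<phi> \<in> p)"

text \<open>
  \<open>tp M a I B\<close> is the type of the tuple \<open>(a\<^sub>i)\<close>, \<open>i \<in> I\<close>, over \<open>B\<close>.  A set \<open>X\<close> is enumerated by
  itself, so its type is \<open>tp M id X B\<close>.
\<close>

definition tp ::
    "('f, 'r, 'a) struct \<Rightarrow> ('i \<Rightarrow> 'a) \<Rightarrow> 'i set \<Rightarrow> 'a set \<Rightarrow> ('f, 'r, 'i + 'a) fm set" where
  "tp M a I B = {\<phi> \<in> formulas M (I <+> B). holds M a \<phi>}"

definition restrict_type ::
    "('f, 'r, 'a) struct \<Rightarrow> 'i set \<Rightarrow> ('f, 'r, 'i + 'a) fm set \<Rightarrow> 'a set \<Rightarrow> ('f, 'r, 'i + 'a) fm set"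
  where "restrict_type M I q C = q \<inter> formulas M (I <+> C)"

text \<open>
  \<open>inst f \<phi>\<close> replaces every parameter label \<open>y\<close> of \<open>\<phi>\<close> by \<open>f y\<close>.  It serves both to substitute a
  tuple \<open>b\<close> for \<open>y\<close> in \<open>\<phi>(x,y)\<close>, and to apply an automorphism to a formula with parameters.
\<close>

definition inst :: "('j \<Rightarrow> 'a) \<Rightarrow> ('f, 'r, 'i + 'j) fm \<Rightarrow> ('f, 'r, 'i + 'a) fm" where
  "inst f = map_fm (map_sum id f)"


section \<open>The monster model\<close>

definition small :: "'k rel \<Rightarrow> 'a set \<Rightarrow> bool" where
  "small \<kappa> X \<longleftrightarrow> |X| <o \<kappa>"

definition saturated :: "'k rel \<Rightarrow> ('f, 'r, 'a) struct \<Rightarrow> bool" where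
  "saturated \<kappa> M \<longleftrightarrow>
     (\<forall>B p. small \<kappa> B \<longrightarrow> complete_type M (UNIV :: unit set) B p \<longrightarrow> (\<exists>c. realizes M c p))"

definition partial_elementary :: "('f, 'r, 'a) struct \<Rightarrow> 'a set \<Rightarrow> ('a \<Rightarrow> 'a) \<Rightarrow> bool" where
  "partial_elementary M B f \<longleftrightarrow>
     (\<forall>\<phi> \<in> formulas M B. sat M UNIV id [] \<phi> \<longleftrightarrow> sat M UNIV f [] \<phi>)"

definition strongly_homogeneous :: "'k rel \<Rightarrow> ('f, 'r, 'a) struct \<Rightarrow> bool" where
  "strongly_homogeneous \<kappa> M \<longleftrightarrow>
     (\<forall>B f. small \<kappa> B \<longrightarrow> partial_elementary M B f \<longrightarrow> (\<exists>\<sigma> \<in> Aut M. \<forall>b \<in> B. \<sigma> b = f b))"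

text \<open>
  \<open>M\<close> is a monster model of the complete theory \<open>T\<close> of \<open>M\<close>; \<open>small\<close> means of cardinality less
  than \<open>\<kappa>\<close>.  The first four conditions say that \<open>\<kappa>\<close> is a cardinal greater than \<open>|T|\<close>, where
  \<open>|T|\<close> is the number of formulas of the language.
\<close>

definition monster_model :: "'k rel \<Rightarrow> ('f, 'r, 'a) struct \<Rightarrow> bool" where
  "monster_model \<kappa> M \<longleftrightarrow>
     Card_order \<kappa> \<and> natLeq <o \<kappa> \<and> small \<kappa> (fsyms M) \<and> small \<kappa> (rsyms M) \<and>
     saturated \<kappa> M \<and> strongly_homogeneous \<kappa> M"


section \<open>Lascar strong automorphisms and invariance\<close>

inductive_set AutfL :: "'k rel \<Rightarrow> ('f, 'r, 'a) struct \<Rightarrow> 'a set \<Rightarrow> ('a \<Rightarrow> 'a) set"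
  for \<kappa> M A where
  generator: "\<lbrakk>\<sigma> \<in> Aut M; elem_substructure M N; small \<kappa> N; A \<subseteq> N; \<forall>x \<in> N. \<sigma> x = x\<rbrakk>
     \<Longrightarrow> \<sigma> \<in> AutfL \<kappa> M A"
| identity: "id \<in> AutfL \<kappa> M A"
| composition: "\<lbrakk>\<sigma> \<in> AutfL \<kappa> M A; \<tau> \<in> AutfL \<kappa> M A\<rbrakk> \<Longrightarrow> \<sigma> \<circ> \<tau> \<in> AutfL \<kappa> M A"
| inverse: "\<sigma> \<in> AutfL \<kappa> M A \<Longrightarrow> inv \<sigma> \<in> AutfL \<kappa> M A"

definition AutfL_invariant ::
    "'k rel \<Rightarrow> ('f, 'r, 'a) struct \<Rightarrow> 'a set \<Rightarrow> ('f, 'r, 'i + 'a) fm set \<Rightarrow> bool" where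
  "AutfL_invariant \<kappa> M A q \<longleftrightarrow> (\<forall>\<sigma> \<in> AutfL \<kappa> M A. inst \<sigma> ` q = q)"

definition global_invariant_extension ::
    "'k rel \<Rightarrow> ('f, 'r, 'a) struct \<Rightarrow> 'i set \<Rightarrow> ('f, 'r, 'i + 'a) fm set \<Rightarrow> 'a set
      \<Rightarrow> ('f, 'r, 'i + 'a) fm set \<Rightarrow> bool" where
  "global_invariant_extension \<kappa> M I p A q \<longleftrightarrow>
     complete_type M I UNIV q \<and> p \<subseteq> q \<and> AutfL_invariant \<kappa> M A q"

text \<open>
  Small tuples are families indexed by small subsets \<open>I\<close> of the type \<open>'k\<close> on which \<open>\<kappa>\<close> lives;
  every small index set is in bijection with one of these.  In the second clause \<open>D\<close> is enumerated
  by itself and \<open>D'\<close> is the image of \<open>D\<close> under \<open>d'\<close>, which fixes \<open>X\<close> by the equality of types.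
\<close>

definition left_extension_base :: "'k rel \<Rightarrow> ('f, 'r, 'a) struct \<Rightarrow> 'a set \<Rightarrow> bool" where
  "left_extension_base \<kappa> M A \<longleftrightarrow>
     (\<forall>(a :: 'k \<Rightarrow> 'a) I. small \<kappa> I \<longrightarrow>
        (\<exists>q. global_invariant_extension \<kappa> M I (tp M a I A) A q)) \<and>
     (\<forall>X Y D. small \<kappa> X \<longrightarrow> small \<kappa> Y \<longrightarrow> small \<kappa> D \<longrightarrow> X \<subseteq> D \<longrightarrow>
        (\<exists>q. global_invariant_extension \<kappa> M X (tp M id X (Y \<union> A)) A q) \<longrightarrow>
        (\<exists>d' :: 'a \<Rightarrow> 'a.
           tp M d' D (X \<union> A) = tp M id D (X \<union> A) \<and>
           (\<exists>q. global_invariant_extension \<kappa> M D (tp M d' D (Y \<union> A)) A q)))"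


section \<open>NTP2, dividing and forking\<close>

text \<open>
  Inconsistency is counted on indices, so that repetitions in the family count.
\<close>

definition k_inconsistent ::
    "('f, 'r, 'a) struct \<Rightarrow> nat \<Rightarrow> (nat \<Rightarrow> ('f, 'r, 'i + 'a) fm) \<Rightarrow> bool" where
  "k_inconsistent M k \<Phi> \<longleftrightarrow> (\<forall>J. finite J \<longrightarrow> card J = k \<longrightarrow> \<not> consistent M (\<Phi> ` J))"

text \<open>
  The complete theory of the monster model \<open>M\<close> is NTP2.  In \<open>\<phi>(x,y)\<close>, \<open>x\<close> is labelled by \<open>Inl\<close>
  and \<open>y\<close> by \<open>Inr\<close>; both are finite tuples since only finitely many labels occur.
\<close>

definition TP2_formula :: "('f, 'r, 'a) struct \<Rightarrow> ('f, 'r, nat + nat) fm \<Rightarrow> bool" where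
  "TP2_formula M \<phi> \<longleftrightarrow>
     (\<exists>k (a :: nat \<Rightarrow> nat \<Rightarrow> nat \<Rightarrow> 'a).
        (\<forall>i. k_inconsistent M k (\<lambda>j. inst (a i j) \<phi>)) \<and>
        (\<forall>\<eta> :: nat \<Rightarrow> nat. consistent M (range (\<lambda>i. inst (a i (\<eta> i)) \<phi>))))"

definition NTP2 :: "('f, 'r, 'a) struct \<Rightarrow> bool" where
  "NTP2 M \<longleftrightarrow> \<not> (\<exists>\<phi> \<in> formulas M UNIV. TP2_formula M \<phi>)"

definition params :: "('f, 'r, 'i + 'a) fm \<Rightarrow> 'a set" where
  "params \<phi> = {b. Inr b \<in> frees \<phi>}"

text \<open>
  The parameter tuple \<open>b\<close> of \<open>\<phi>(x,b)\<close> is \<open>params \<phi>\<close>, enumerated by itself.  Thus \<open>b\<^sub>i\<close> is the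
  restriction of \<open>f i\<close> to \<open>params \<phi>\<close>, and \<open>inst (f i) \<phi>\<close> is \<open>\<phi>(x,b\<^sub>i)\<close>.
\<close>

definition divides :: "('f, 'r, 'a) struct \<Rightarrow> 'a set \<Rightarrow> ('f, 'r, 'i + 'a) fm \<Rightarrow> bool" where
  "divides M A \<phi> \<longleftrightarrow>
     (\<exists>k (f :: nat \<Rightarrow> 'a \<Rightarrow> 'a).
        (\<forall>i. tp M (f i) (params \<phi>) A = tp M id (params \<phi>) A) \<and>
        k_inconsistent M k (\<lambda>i. inst (f i) \<phi>))"

text \<open>\<open>I\<close> is the tuple of variables of \<open>\<phi>\<close>, shared by the dividing formulas.\<close>

definition forks ::
    "('f, 'r, 'a) struct \<Rightarrow> 'i set \<Rightarrow> 'a set \<Rightarrow> ('f, 'r, 'i + 'a) fm \<Rightarrow> bool" where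
  "forks M I A \<phi> \<longleftrightarrow>
     (\<exists>S \<subseteq> formulas M (I <+> UNIV). finite S \<and> (\<forall>\<psi> \<in> S. divides M A \<psi>) \<and>
        (\<forall>c. holds M c \<phi> \<longrightarrow> (\<exists>\<psi> \<in> S. holds M c \<psi>)))"

text \<open>
  For sets of formulas closed under conjunction, in particular complete types, which are the only
  ones it is used for.
\<close>

definition type_forks ::
    "('f, 'r, 'a) struct \<Rightarrow> 'i set \<Rightarrow> 'a set \<Rightarrow> ('f, 'r, 'i + 'a) fm set \<Rightarrow> bool" where
  "type_forks M I A p \<longleftrightarrow> (\<exists>\<phi> \<in> p. forks M I A \<phi>)"

definition forking_eq_dividing :: "('f, 'r, 'a) struct \<Rightarrow> 'a set \<Rightarrow> bool" where
  "forking_eq_dividing M A \<longleftrightarrow>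
     (\<forall>(I :: nat set) \<phi>. finite I \<longrightarrow> \<phi> \<in> formulas M (I <+> UNIV) \<longrightarrow>
        (forks M I A \<phi> \<longleftrightarrow> divides M A \<phi>))"

definition strictly_invariant ::
    "'k rel \<Rightarrow> ('f, 'r, 'a) struct \<Rightarrow> 'i set \<Rightarrow> ('f, 'r, 'i + 'a) fm set \<Rightarrow> 'a set \<Rightarrow> bool" where
  "strictly_invariant \<kappa> M I p B \<longleftrightarrow>
     (\<exists>q. global_invariant_extension \<kappa> M I p B q \<and>
        (\<forall>C c. small \<kappa> C \<longrightarrow> B \<subseteq> C \<longrightarrow> realizes M c (restrict_type M I q C) \<longrightarrow>
           \<not> type_forks M C B (tp M id C (B \<union> c ` I))))"

definition strict_invariance_extension_base ::
    "'k rel \<Rightarrow> ('f, 'r, 'a) struct \<Rightarrow> 'a set \<Rightarrow> bool" where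
  "strict_invariance_extension_base \<kappa> M A \<longleftrightarrow>
     (\<forall>(a :: 'k \<Rightarrow> 'a) I. small \<kappa> I \<longrightarrow> strictly_invariant \<kappa> M I (tp M a I A) A)"

end

theory Submission
  imports Defs "HOL-Library.Infinite_Set"
begin

text \<open>
  Suppose \<open>\<psi>(x,b)\<close> divides over \<open>A\<close>.  A Lascar invariant global type of a dividing sequence can be
  thinned out so that all entries have the same global type \<open>q\<close>; independent copies of the sequence
  then form an array whose paths are Morley sequences of \<open>q\<close> over a small model, hence conjugate, so
  NTP2 makes \<open>\<psi>\<close> inconsistent along every Morley sequence of \<open>q\<close>.  As \<open>b\<close> may be replaced by any longer
  finite tuple, these Morley sequences supply the configurations of the broom lemma: a set covered by
  finitely many formulas dividing over \<open>A\<close> has finitely many conjugates with empty intersection.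
  By compactness every type over \<open>A\<close> is therefore strictly invariant.  For a strictly invariant \<open>q\<close>, all
  dividing formulas are inconsistent along Morley sequences (Kim's lemma); if \<open>\<phi>\<close> implies a finite
  disjunction of dividing formulas, then along a Morley sequence of all the parameters the pigeonhole
  principle makes \<open>\<phi>\<close> divide.
\<close>

section \<open>Formulas and satisfaction\<close>

text \<open>Two obstacles shape the argument. A type that witnesses dividing is produced for one
  formula at a time, while the pigeonhole step needs a single type serving every formula of a
  disjunction; strictly invariant types are introduced to provide it. Their definition speaks of
  nonforking, however, and only dividing can be controlled directly. The broom lemma breaks this
  circle: it turns forking into a statement about finitely many conjugates, and an invariant type of
  the tuple of the corresponding conjugates of \<open>a\<close> can be realized over any small set,
  where one of the conjugates has to avoid the forking formulas.

  As \<open>A\<close> need not be a model, Morley sequences are built over a small model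
  \<open>N\<close> containing \<open>A\<close>: automorphisms fixing \<open>N\<close> are Lascar
  strong, so they preserve the invariant type, which gives uniqueness. Tuples with the type of a set
  \<open>P\<close> over \<open>A\<close> are mostly represented by automorphisms over
  \<open>A\<close>, restricted to \<open>P\<close>, so that conjugating a whole configuration is
  composition of functions.\<close>

lemma val_map: "val M v e (map_tm f t) = val M (v \<circ> f) e t"
  by (induction t) (simp_all add: comp_def cong: map_cong)

lemma sat_map: "sat M D v e (map_fm f \<phi>) \<longleftrightarrow> sat M D (v \<circ> f) e \<phi>"
  by (induction \<phi> arbitrary: e) (simp_all add: val_map comp_def)

lemma val_cong: "(\<And>x. x \<in> frees_tm t \<Longrightarrow> v x = w x) \<Longrightarrow> val M v e t = val M w e t"
proof (induction t)
  case (App f ts)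
  then have "map (val M v e) ts = map (val M w e) ts" by auto
  then show ?case by (simp only: val.simps)
qed auto

lemma sat_cong: "(\<And>x. x \<in> frees \<phi> \<Longrightarrow> v x = w x) \<Longrightarrow> sat M D v e \<phi> \<longleftrightarrow> sat M D w e \<phi>"
proof (induction \<phi> arbitrary: e)
  case (Eq s t)
  then have "val M v e s = val M w e s" "val M v e t = val M w e t"
    by (auto intro!: val_cong)
  then show ?case by simp
next
  case (Rel r ts)
  then have "map (val M v e) ts = map (val M w e) ts" by (auto intro!: val_cong)
  then show ?case by (simp only: sat.simps)
next
  case (Neg \<phi>)
  then show ?case by simp
next
  case (Conj \<phi> \<psi>)
  have "sat M D v e \<phi> \<longleftrightarrow> sat M D w e \<phi>" "sat M D v e \<psi> \<longleftrightarrow> sat M D w e \<psi>"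
    using Conj by auto
  then show ?case by simp
next
  case (Ex \<phi>)
  then show ?case by simp
qed

lemma wf_map_tm: "wf_tm M n (map_tm f t) \<longleftrightarrow> wf_tm M n t"
  by (induction t) auto

lemma wf_map_fm: "wf_fm M n (map_fm f \<phi>) \<longleftrightarrow> wf_fm M n \<phi>"
  by (induction \<phi> arbitrary: n) (auto simp: wf_map_tm)

lemma finite_frees_tm: "finite (frees_tm t)"
  by (induction t) auto

lemma finite_frees: "finite (frees \<phi>)"
  by (induction \<phi>) (auto simp: finite_frees_tm)

lemma formulas_map: "\<phi> \<in> formulas M V \<Longrightarrow> f ` V \<subseteq> W \<Longrightarrow> map_fm f \<phi> \<in> formulas M W"
  unfolding formulas_def by (auto simp: wf_map_fm fm.set_map)

lemma formulas_map': "\<phi> \<in> formulas M V \<Longrightarrow> f ` frees \<phi> \<subseteq> W \<Longrightarrow> map_fm f \<phi> \<in> formulas M W"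
  unfolding formulas_def by (auto simp: wf_map_fm fm.set_map)

lemma formulas_mono: "\<phi> \<in> formulas M V \<Longrightarrow> V \<subseteq> W \<Longrightarrow> \<phi> \<in> formulas M W"
  unfolding formulas_def by auto

lemma formulas_frees: "\<phi> \<in> formulas M V \<Longrightarrow> W \<supseteq> frees \<phi> \<Longrightarrow> \<phi> \<in> formulas M W"
  unfolding formulas_def by auto

lemma frees_formulas: "\<phi> \<in> formulas M V \<Longrightarrow> frees \<phi> \<subseteq> V"
  unfolding formulas_def by auto

lemma Neg_formulas [simp]: "Neg \<phi> \<in> formulas M V \<longleftrightarrow> \<phi> \<in> formulas M V"
  unfolding formulas_def by auto

lemma Conj_formulas [simp]: "Conj \<phi> \<psi> \<in> formulas M V \<longleftrightarrow> \<phi> \<in> formulas M V \<and> \<psi> \<in> formulas M V"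
  unfolding formulas_def by auto

section \<open>Derived connectives and quantification over a free label\<close>

definition Imp :: "('f, 'r, 'v) fm \<Rightarrow> ('f, 'r, 'v) fm \<Rightarrow> ('f, 'r, 'v) fm" where
  "Imp \<phi> \<psi> = Neg (Conj \<phi> (Neg \<psi>))"

lemma Imp_formulas [simp]: "Imp \<phi> \<psi> \<in> formulas M V \<longleftrightarrow> \<phi> \<in> formulas M V \<and> \<psi> \<in> formulas M V"
  unfolding Imp_def by simp

lemma sat_Imp [simp]: "sat M D v e (Imp \<phi> \<psi>) \<longleftrightarrow> (sat M D v e \<phi> \<longrightarrow> sat M D v e \<psi>)"
  unfolding Imp_def by simp

lemma map_Imp [simp]: "map_fm f (Imp \<phi> \<psi>) = Imp (map_fm f \<phi>) (map_fm f \<psi>)"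
  unfolding Imp_def by simp

text \<open>The empty conjunction is a sentence without symbols or free labels, so it belongs to
  \<open>formulas M V\<close> for every signature and every \<open>V\<close>.\<close>

fun conjs :: "('f, 'r, 'v) fm list \<Rightarrow> ('f, 'r, 'v) fm" where
  "conjs [] = Ex (Eq (Bnd 0) (Bnd 0))"
| "conjs (\<phi> # \<phi>s) = Conj \<phi> (conjs \<phi>s)"

lemma sat_conjs [simp]: "sat M UNIV v e (conjs \<phi>s) \<longleftrightarrow> (\<forall>\<phi> \<in> set \<phi>s. sat M UNIV v e \<phi>)"
  by (induction \<phi>s) auto

lemma conjs_formulas [simp]: "conjs \<phi>s \<in> formulas M V \<longleftrightarrow> set \<phi>s \<subseteq> formulas M V"
  by (induction \<phi>s) (auto simp: formulas_def)

text \<open>The label \<open>v\<close> becomes the outermost index; \<open>n\<close> is the number of enclosing quantifiers.\<close>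

primrec abs_tm :: "nat \<Rightarrow> 'v \<Rightarrow> ('f, 'v) tm \<Rightarrow> ('f, 'v) tm" where
  "abs_tm n v (Bnd m) = Bnd m"
| "abs_tm n v (Fre x) = (if x = v then Bnd n else Fre x)"
| "abs_tm n v (App f ts) = App f (map (abs_tm n v) ts)"

primrec abs_fm :: "nat \<Rightarrow> 'v \<Rightarrow> ('f, 'r, 'v) fm \<Rightarrow> ('f, 'r, 'v) fm" where
  "abs_fm n v (Eq s t) = Eq (abs_tm n v s) (abs_tm n v t)"
| "abs_fm n v (Rel r ts) = Rel r (map (abs_tm n v) ts)"
| "abs_fm n v (Neg \<phi>) = Neg (abs_fm n v \<phi>)"
| "abs_fm n v (Conj \<phi> \<psi>) = Conj (abs_fm n v \<phi>) (abs_fm n v \<psi>)"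
| "abs_fm n v (Ex \<phi>) = Ex (abs_fm (Suc n) v \<phi>)"

definition exq :: "'v \<Rightarrow> ('f, 'r, 'v) fm \<Rightarrow> ('f, 'r, 'v) fm" where
  "exq v \<phi> = Ex (abs_fm 0 v \<phi>)"

lemma val_abs:
  assumes u: "\<And>y. u y = (if y = v then x else w y)"
  shows "wf_tm M (length e) t \<Longrightarrow> val M w (e @ [x]) (abs_tm (length e) v t) = val M u e t"
proof (induction t)
  case (App f ts)
  then have "map (val M w (e @ [x]) \<circ> abs_tm (length e) v) ts = map (val M u e) ts"
    by auto
  then show ?case by (simp only: val.simps abs_tm.simps map_map)
qed (auto simp: nth_append u)

text \<open>The abstracted label becomes the outermost index, so its value stands last in the
  environment. Quantifiers met on the way down push values onto the front of \<open>e\<close> and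
  leave the last position in place; well-formedness keeps the existing indices below
  \<open>length e\<close>.\<close>

lemma sat_abs:
  assumes u: "\<And>y. u y = (if y = v then x else w y)"
  shows "wf_fm M (length e) \<phi> \<Longrightarrow> sat M D w (e @ [x]) (abs_fm (length e) v \<phi>) \<longleftrightarrow> sat M D u e \<phi>"
proof (induction \<phi> arbitrary: e)
  case (Eq s t)
  then show ?case by (simp add: val_abs[OF u])
next
  case (Rel r ts)
  then have "map (val M w (e @ [x]) \<circ> abs_tm (length e) v) ts = map (val M u e) ts"
    by (auto simp: val_abs[OF u])
  then show ?case by (simp only: sat.simps abs_fm.simps map_map)
next
  case (Ex \<phi>)
  have "sat M D w ((y # e) @ [x]) (abs_fm (length (y # e)) v \<phi>) \<longleftrightarrow> sat M D u (y # e) \<phi>"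
    for y using Ex.prems by (intro Ex.IH) simp
  then show ?case by simp
qed auto

lemma wf_abs_tm: "wf_tm M n t \<Longrightarrow> wf_tm M (Suc n) (abs_tm n v t)"
  by (induction t) auto

lemma wf_abs_fm: "wf_fm M n \<phi> \<Longrightarrow> wf_fm M (Suc n) (abs_fm n v \<phi>)"
  by (induction \<phi> arbitrary: n) (auto simp: wf_abs_tm)

lemma frees_abs_tm: "frees_tm (abs_tm n v t) = frees_tm t - {v}"
  by (induction t) auto

lemma frees_abs_fm: "frees (abs_fm n v \<phi>) = frees \<phi> - {v}"
  by (induction \<phi> arbitrary: n) (auto simp: frees_abs_tm)

lemma sat_exq:
  "wf_fm M 0 \<phi> \<Longrightarrow> sat M UNIV w [] (exq v \<phi>) \<longleftrightarrow> (\<exists>x. sat M UNIV (w(v := x)) [] \<phi>)"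
  unfolding exq_def using sat_abs[of "w(v := _)" v _ w M "[]" \<phi> UNIV] by simp

lemma frees_exq: "frees (exq v \<phi>) = frees \<phi> - {v}"
  unfolding exq_def by (simp add: frees_abs_fm)

lemma exq_wf: "wf_fm M 0 \<phi> \<Longrightarrow> wf_fm M 0 (exq v \<phi>)"
  unfolding exq_def using wf_abs_fm by auto

text \<open>The claims form one induction since \<open>sat_exq\<close> applies to the inner formula
  only when that formula is well-formed.\<close>

lemma exqs:
  assumes "wf_fm M 0 \<phi>"
  shows "wf_fm M 0 (foldr exq vs \<phi>)" "frees (foldr exq vs \<phi>) = frees \<phi> - set vs"
    "sat M UNIV w [] (foldr exq vs \<phi>) \<longleftrightarrow>
      (\<exists>u. (\<forall>x. x \<notin> set vs \<longrightarrow> u x = w x) \<and> sat M UNIV u [] \<phi>)"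
proof (induction vs arbitrary: w)
  case Nil
  { case 1 then show ?case using assms by simp }
  { case 2 then show ?case by simp }
  { case 3 show ?case
      by (simp, metis ext) }
next
  case (Cons v vs)
  { case 1 then show ?case using Cons by (simp add: exq_wf) }
  { case 2 then show ?case using Cons by (auto simp: frees_exq) }
  { case 3
    have "(\<exists>y u. (\<forall>x. x \<notin> set vs \<longrightarrow> u x = (w(v := y)) x) \<and> sat M UNIV u [] \<phi>) \<longleftrightarrow>
      (\<exists>u. (\<forall>x. x \<notin> set (v # vs) \<longrightarrow> u x = w x) \<and> sat M UNIV u [] \<phi>)" (is "?L \<longleftrightarrow> ?R")
    proof
      assume ?R
      then obtain u where u: "\<forall>x. x \<notin> set (v # vs) \<longrightarrow> u x = w x" "sat M UNIV u [] \<phi>" by blast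
      have "\<forall>x. x \<notin> set vs \<longrightarrow> u x = (w(v := u v)) x" using u(1) by auto
      then show ?L using u(2) by blast
    next
      assume ?L
      then obtain y u where u: "\<forall>x. x \<notin> set vs \<longrightarrow> u x = (w(v := y)) x" "sat M UNIV u [] \<phi>" by blast
      have "\<forall>x. x \<notin> set (v # vs) \<longrightarrow> u x = w x" using u(1) by auto
      then show ?R using u(2) by blast
    qed
    then show ?case using Cons by (simp add: sat_exq) }
qed

section \<open>Automorphisms\<close>

lemma Aut_bij: "\<sigma> \<in> Aut M \<Longrightarrow> bij \<sigma>"
  unfolding Aut_def by simp

lemma Aut_inv_f [simp]: "\<sigma> \<in> Aut M \<Longrightarrow> inv \<sigma> (\<sigma> x) = x"
  by (simp add: Aut_bij bij_is_inj)

lemma Aut_f_inv [simp]: "\<sigma> \<in> Aut M \<Longrightarrow> \<sigma> (inv \<sigma> x) = x"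
  by (meson Aut_bij bij_inv_eq_iff)

lemma Aut_comp_inv: "\<sigma> \<in> Aut M \<Longrightarrow> \<sigma> \<circ> inv \<sigma> = id" "\<sigma> \<in> Aut M \<Longrightarrow> inv \<sigma> \<circ> \<sigma> = id"
  by auto

lemma Aut_fint: "\<sigma> \<in> Aut M \<Longrightarrow> (f, length xs) \<in> fsyms M \<Longrightarrow> \<sigma> (fint M f xs) = fint M f (map \<sigma> xs)"
  unfolding Aut_def by fastforce

lemma Aut_rint:
  assumes "\<sigma> \<in> Aut M" "(r, length xs) \<in> rsyms M"
  shows "rint M r (map \<sigma> xs) \<longleftrightarrow> rint M r xs"
proof -
  have "\<forall>(r, n) \<in> rsyms M. \<forall>xs. length xs = n \<longrightarrow> (rint M r xs \<longleftrightarrow> rint M r (map \<sigma> xs))"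
    using assms(1) unfolding Aut_def by blast
  then have "\<forall>ys. length ys = length xs \<longrightarrow> (rint M r ys \<longleftrightarrow> rint M r (map \<sigma> ys))"
    using assms(2) by blast
  then show ?thesis by blast
qed

lemma AutI:
  assumes "bij \<sigma>"
    and "\<And>f xs. (f, length xs) \<in> fsyms M \<Longrightarrow> \<sigma> (fint M f xs) = fint M f (map \<sigma> xs)"
    and "\<And>r xs. (r, length xs) \<in> rsyms M \<Longrightarrow> rint M r (map \<sigma> xs) \<longleftrightarrow> rint M r xs"
  shows "\<sigma> \<in> Aut M"
  unfolding Aut_def using assms by blast

lemma val_aut:
  assumes "\<sigma> \<in> Aut M" and u: "\<And>x. u x = \<sigma> (v x)"
  shows "wf_tm M (length e) t \<Longrightarrow> val M u (map \<sigma> e) t = \<sigma> (val M v e t)"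
proof (induction t)
  case (App f ts)
  have "map (val M u (map \<sigma> e)) ts = map \<sigma> (map (val M v e) ts)" using App by simp
  moreover have "\<sigma> (fint M f xs) = fint M f (map \<sigma> xs)" if "length xs = length ts" for xs
    using App.prems that by (intro Aut_fint[OF assms(1)]) simp
  ultimately show ?case by (simp del: map_map)
qed (auto simp: u)

text \<open>The quantifier range is a general \<open>D\<close>, with its image on the other side,
  because the result is needed for elementary submodels as well as for the whole universe.\<close>

lemma sat_aut_gen:
  assumes \<sigma>: "\<sigma> \<in> Aut M" and u: "\<And>x. u x = \<sigma> (v x)"
  shows "wf_fm M (length e) \<phi> \<Longrightarrow> sat M (\<sigma> ` D) u (map \<sigma> e) \<phi> \<longleftrightarrow> sat M D v e \<phi>"
proof (induction \<phi> arbitrary: e)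
  case (Eq s t)
  then show ?case using inj_eq[OF bij_is_inj[OF Aut_bij[OF \<sigma>]]] by (simp add: val_aut[OF \<sigma> u])
next
  case (Rel r ts)
  have "map (val M u (map \<sigma> e)) ts = map \<sigma> (map (val M v e) ts)"
    using Rel by (auto simp: val_aut[OF \<sigma> u])
  moreover have "rint M r (map \<sigma> xs) \<longleftrightarrow> rint M r xs" if "length xs = length ts" for xs
    using Rel.prems that by (intro Aut_rint[OF \<sigma>]) simp
  ultimately show ?case by (simp del: map_map)
next
  case (Ex \<phi>)
  have "sat M (\<sigma> ` D) u (map \<sigma> (y # e)) \<phi> \<longleftrightarrow> sat M D v (y # e) \<phi>" for y
    using Ex.prems by (intro Ex.IH) simp
  then show ?case by simp
qed auto

lemma sat_aut:
  assumes "\<sigma> \<in> Aut M" "wf_fm M (length e) \<phi>"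
  shows "sat M (\<sigma> ` D) (\<sigma> \<circ> v) (map \<sigma> e) \<phi> \<longleftrightarrow> sat M D v e \<phi>"
  using assms by (intro sat_aut_gen) simp_all

lemma sat_aut_UNIV:
  assumes "\<sigma> \<in> Aut M" "wf_fm M 0 \<phi>"
  shows "sat M UNIV (\<sigma> \<circ> v) [] \<phi> \<longleftrightarrow> sat M UNIV v [] \<phi>"
proof -
  have "\<sigma> ` UNIV = UNIV" using Aut_bij[OF assms(1)] by (simp add: bij_is_surj)
  then show ?thesis using sat_aut[of \<sigma> M "[]" \<phi> UNIV v] assms by simp
qed

lemma Aut_id: "id \<in> Aut M"
  unfolding Aut_def by auto

lemma Aut_comp: "\<sigma> \<in> Aut M \<Longrightarrow> \<tau> \<in> Aut M \<Longrightarrow> \<sigma> \<circ> \<tau> \<in> Aut M"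
proof (rule AutI)
  assume \<sigma>: "\<sigma> \<in> Aut M" and \<tau>: "\<tau> \<in> Aut M"
  show "bij (\<sigma> \<circ> \<tau>)" using \<sigma> \<tau> by (simp add: bij_comp Aut_bij)
  show "(\<sigma> \<circ> \<tau>) (fint M f xs) = fint M f (map (\<sigma> \<circ> \<tau>) xs)" if "(f, length xs) \<in> fsyms M" for f xs
    using Aut_fint[OF \<tau> that] Aut_fint[OF \<sigma>, of f "map \<tau> xs"] that
    by (metis comp_apply length_map map_map)
  show "rint M r (map (\<sigma> \<circ> \<tau>) xs) \<longleftrightarrow> rint M r xs" if "(r, length xs) \<in> rsyms M" for r xs
    using Aut_rint[OF \<tau> that] Aut_rint[OF \<sigma>, of r "map \<tau> xs"] that
    by (metis length_map map_map)
qed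

lemma Aut_inv:
  assumes "\<sigma> \<in> Aut M"
  shows "inv \<sigma> \<in> Aut M"
proof -
  have m: "map \<sigma> (map (inv \<sigma>) xs) = xs" for xs
    using assms by (induction xs) auto
  show ?thesis
  proof (rule AutI)
    show "bij (inv \<sigma>)" using Aut_bij[OF assms] by (rule bij_imp_bij_inv)
    show "inv \<sigma> (fint M f xs) = fint M f (map (inv \<sigma>) xs)" if "(f, length xs) \<in> fsyms M" for f xs
      using Aut_fint[OF assms, of f "map (inv \<sigma>) xs"] that m assms by (metis Aut_inv_f length_map)
    show "rint M r (map (inv \<sigma>) xs) \<longleftrightarrow> rint M r xs" if "(r, length xs) \<in> rsyms M" for r xs
      using Aut_rint[OF assms, of r "map (inv \<sigma>) xs"] that m by simp
  qed
qed

lemma elem_substructure_image: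
  assumes \<sigma>: "\<sigma> \<in> Aut M" and N: "elem_substructure M N"
  shows "elem_substructure M (\<sigma> ` N)"
  unfolding elem_substructure_def
proof (intro conjI ballI)
  show "\<sigma> ` N \<noteq> {}" using N unfolding elem_substructure_def by auto
next
  fix p assume p: "p \<in> fsyms M"
  obtain f n where fn: "p = (f, n)" by force
  have "fint M f xs \<in> \<sigma> ` N" if xs: "length xs = n" "set xs \<subseteq> \<sigma> ` N" for xs
  proof -
    have "set (map (inv \<sigma>) xs) \<subseteq> N" using xs(2) \<sigma> by auto
    then have "fint M f (map (inv \<sigma>) xs) \<in> N"
      using N p fn xs(1) unfolding elem_substructure_def by auto
    moreover have "inv \<sigma> (fint M f xs) = fint M f (map (inv \<sigma>) xs)"
      using Aut_fint[OF Aut_inv[OF \<sigma>]] p fn xs(1) by blast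
    ultimately show ?thesis using \<sigma> by (metis Aut_f_inv imageI)
  qed
  then show "case p of (f, n) \<Rightarrow> \<forall>xs. length xs = n \<longrightarrow> set xs \<subseteq> \<sigma> ` N \<longrightarrow> fint M f xs \<in> \<sigma> ` N"
    using fn by simp
next
  fix \<phi> assume \<phi>: "\<phi> \<in> formulas M (\<sigma> ` N)"
  let ?\<phi> = "map_fm (inv \<sigma>) \<phi>"
  have "?\<phi> \<in> formulas M N" using \<phi> by (rule formulas_map) (use \<sigma> in auto)
  then have w: "wf_fm M 0 ?\<phi>" and "sat M N id [] ?\<phi> \<longleftrightarrow> sat M UNIV id [] ?\<phi>"
    using N unfolding elem_substructure_def formulas_def by auto
  moreover have eq: "map_fm \<sigma> ?\<phi> = \<phi>"
    using \<sigma> by (simp add: fm.map_comp Aut_comp_inv fm.map_id)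
  have "sat M (\<sigma> ` N) id [] \<phi> \<longleftrightarrow> sat M (\<sigma> ` N) \<sigma> [] ?\<phi>"
    by (subst eq[symmetric]) (simp add: sat_map)
  moreover have "sat M UNIV id [] \<phi> \<longleftrightarrow> sat M UNIV \<sigma> [] ?\<phi>"
    by (subst eq[symmetric]) (simp add: sat_map)
  ultimately show "sat M (\<sigma> ` N) id [] \<phi> \<longleftrightarrow> sat M UNIV id [] \<phi>"
    using sat_aut[OF \<sigma>, of "[]" ?\<phi> N id] sat_aut_UNIV[OF \<sigma>, of ?\<phi> id] by simp
qed

section \<open>Instantiating parameters, and the action of automorphisms on formulas\<close>

lemma inst_formulas:
  "\<phi> \<in> formulas M (I <+> B) \<Longrightarrow> f ` B \<subseteq> C \<Longrightarrow> inst f \<phi> \<in> formulas M (I <+> C)"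
  unfolding inst_def by (erule formulas_map) auto

lemma holds_map: "holds M c (map_fm f \<phi>) \<longleftrightarrow> sat M UNIV (case_sum c id \<circ> f) [] \<phi>"
  unfolding holds_def by (simp add: sat_map)

lemma holds_inst: "holds M c (inst f \<phi>) \<longleftrightarrow> sat M UNIV (case_sum c f) [] \<phi>"
proof -
  have "case_sum c id \<circ> map_sum id f = case_sum c f" by (auto split: sum.splits simp: fun_eq_iff)
  then show ?thesis unfolding inst_def holds_map by simp
qed

lemma holds_Neg [simp]: "holds M c (Neg \<phi>) \<longleftrightarrow> \<not> holds M c \<phi>"
  unfolding holds_def by simp

lemma holds_Conj [simp]: "holds M c (Conj \<phi> \<psi>) \<longleftrightarrow> holds M c \<phi> \<and> holds M c \<psi>"
  unfolding holds_def by simp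

lemma holds_Imp [simp]: "holds M c (Imp \<phi> \<psi>) \<longleftrightarrow> (holds M c \<phi> \<longrightarrow> holds M c \<psi>)"
  unfolding holds_def by simp

lemma holds_conjs [simp]: "holds M c (conjs \<phi>s) \<longleftrightarrow> (\<forall>\<phi> \<in> set \<phi>s. holds M c \<phi>)"
  unfolding holds_def by simp

lemma holds_cong:
  "\<phi> \<in> formulas M (I <+> B) \<Longrightarrow> (\<And>i. i \<in> I \<Longrightarrow> c i = d i) \<Longrightarrow> holds M c \<phi> \<longleftrightarrow> holds M d \<phi>"
  unfolding holds_def by (rule sat_cong) (auto dest!: frees_formulas)

lemma inst_cong: "(\<And>b. b \<in> params \<phi> \<Longrightarrow> f b = g b) \<Longrightarrow> inst f \<phi> = inst g \<phi>"
  unfolding inst_def params_def by (rule fm.map_cong) (auto simp: map_sum_def split: sum.splits)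

lemma inst_id: "(\<And>b. b \<in> params \<phi> \<Longrightarrow> f b = b) \<Longrightarrow> inst f \<phi> = \<phi>"
  using inst_cong[of \<phi> f id] by (simp add: inst_def sum.map_id0 fm.map_id)

lemma inst_comp: "inst f (inst g \<phi>) = inst (f \<circ> g) \<phi>"
  unfolding inst_def by (simp add: fm.map_comp map_sum.comp)

lemma inst_simps [simp]: "inst f (Neg \<phi>) = Neg (inst f \<phi>)" "inst f (Imp \<phi> \<psi>) = Imp (inst f \<phi>) (inst f \<psi>)"
  unfolding inst_def by simp_all

lemma params_formulas: "\<phi> \<in> formulas M (I <+> B) \<Longrightarrow> params \<phi> \<subseteq> B"
  unfolding params_def by (auto dest: frees_formulas)

lemma formulas_params: "\<phi> \<in> formulas M (I <+> B) \<Longrightarrow> params \<phi> \<subseteq> C \<Longrightarrow> \<phi> \<in> formulas M (I <+> C)"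
  unfolding params_def formulas_def by fastforce

lemma finite_params: "finite (params \<phi>)"
proof -
  have "params \<phi> = Inr -` frees \<phi>" unfolding params_def by auto
  then show ?thesis by (simp add: finite_frees finite_vimageI)
qed

lemma holds_aut:
  assumes "\<sigma> \<in> Aut M" "\<phi> \<in> formulas M V"
  shows "holds M (\<sigma> \<circ> c) (inst \<sigma> \<phi>) \<longleftrightarrow> holds M c \<phi>"
proof -
  have "case_sum (\<sigma> \<circ> c) \<sigma> = \<sigma> \<circ> case_sum c id" by (auto split: sum.splits simp: fun_eq_iff)
  then show ?thesis
    unfolding holds_inst using sat_aut_UNIV[OF assms(1), of \<phi> "case_sum c id"] assms(2)
    by (simp add: holds_def formulas_def)
qed

section \<open>Types\<close>

lemma consistent_finite: "finite F \<Longrightarrow> consistent M F \<longleftrightarrow> (\<exists>c. realizes M c F)"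
  unfolding consistent_def realizes_def by blast

lemma consistent_mono: "consistent M q \<Longrightarrow> p \<subseteq> q \<Longrightarrow> consistent M p"
  unfolding consistent_def by blast

text \<open>Zorn's lemma applies because consistency is a finitary condition and so passes to unions
  of chains. At a maximal set, a formula and its negation cannot both be refuted by finite parts, as
  the union of the two parts is realized.\<close>

lemma Lindenbaum:
  assumes p: "p \<subseteq> formulas M (I <+> B)" "consistent M p"
  obtains q where "p \<subseteq> q" "complete_type M I B q"
proof -
  let ?A = "{q. p \<subseteq> q \<and> q \<subseteq> formulas M (I <+> B) \<and> consistent M q}"
  have "\<exists>q\<in>?A. \<forall>r\<in>?A. q \<subseteq> r \<longrightarrow> r = q"
  proof (rule subset_Zorn_nonempty)
    show "?A \<noteq> {}" using p by blast
    fix C assume C: "C \<noteq> {}" "subset.chain ?A C"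
    have "consistent M (\<Union>C)"
      unfolding consistent_def
    proof (intro allI impI)
      fix F assume F: "finite F" "F \<subseteq> \<Union>C"
      have "\<exists>r\<in>C. F \<subseteq> r"
      proof -
        obtain r where "r \<in> C" "F \<subseteq> r"
          using finite_subset_Union_chain[OF F C(1), of ?A] C by blast
        then show ?thesis by blast
      qed
      then obtain r where "r \<in> C" "F \<subseteq> r" by blast
      moreover have "r \<in> ?A" using C(2) \<open>r \<in> C\<close> unfolding subset.chain_def by blast
      ultimately show "\<exists>c. realizes M c F" using F(1) unfolding consistent_def by blast
    qed
    moreover have mem: "p \<subseteq> r" "r \<subseteq> formulas M (I <+> B)" if "r \<in> C" for r
    proof -
      have "r \<in> ?A" using C(2) that unfolding subset.chain_def by (rule_tac subsetD) simp_all
      then show "p \<subseteq> r" "r \<subseteq> formulas M (I <+> B)" by simp_all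
    qed
    moreover have "p \<subseteq> \<Union>C"
    proof -
      obtain r where "r \<in> C" using C(1) by blast
      then show ?thesis using mem(1)[of r] by blast
    qed
    moreover have "\<Union>C \<subseteq> formulas M (I <+> B)" using mem(2) by (rule Union_least)
    ultimately show "\<Union>C \<in> ?A" by simp
  qed
  then obtain q where q: "q \<in> ?A" and max': "\<forall>r\<in>?A. q \<subseteq> r \<longrightarrow> r = q" by (rule bexE)
  have max: "r = q" if "r \<in> ?A" "q \<subseteq> r" for r
    using bspec[OF max' that(1)] that(2) by simp
  have "\<phi> \<in> q \<or> Neg \<phi> \<in> q" if \<phi>: "\<phi> \<in> formulas M (I <+> B)" for \<phi>
  proof (rule ccontr)
    assume n: "\<not> (\<phi> \<in> q \<or> Neg \<phi> \<in> q)"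
    have *: "\<exists>F. finite F \<and> F \<subseteq> q \<and> (\<forall>c. realizes M c F \<longrightarrow> \<not> holds M c \<chi>)"
      if "\<chi> \<in> formulas M (I <+> B)" "\<chi> \<notin> q" for \<chi>
    proof -
      have "\<not> consistent M (insert \<chi> q)"
      proof
        assume "consistent M (insert \<chi> q)"
        then have "insert \<chi> q = q" using q that(1) by (intro max) auto
        then show False using that(2) by blast
      qed
      then obtain F where F: "finite F" "F \<subseteq> insert \<chi> q" "\<not> (\<exists>c. realizes M c F)"
        unfolding consistent_def by blast
      have "realizes M c (F - {\<chi>}) \<Longrightarrow> \<not> holds M c \<chi>" for c
        using F(3) unfolding realizes_def by blast
      then show ?thesis using F(1,2) by (intro exI[of _ "F - {\<chi>}"]) auto
    qed
    obtain F where F: "finite F" "F \<subseteq> q" "\<forall>c. realizes M c F \<longrightarrow> \<not> holds M c \<phi>"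
      using *[of \<phi>] \<phi> n by blast
    obtain F' where F': "finite F'" "F' \<subseteq> q" "\<forall>c. realizes M c F' \<longrightarrow> \<not> holds M c (Neg \<phi>)"
      using *[of "Neg \<phi>"] \<phi> n by auto
    have "consistent M q" using q by simp
    then obtain c where "realizes M c (F \<union> F')"
      using finite_UnI[OF F(1) F'(1)] Un_least[OF F(2) F'(2)] unfolding consistent_def by meson
    then have "realizes M c F" "realizes M c F'" unfolding realizes_def by auto
    then show False using F(3) F'(3) by auto
  qed
  then have "complete_type M I B q" unfolding complete_type_def using q by simp
  then show ?thesis using q by (intro that) simp_all
qed

lemma complete_type_formulas: "complete_type M I B p \<Longrightarrow> \<phi> \<in> p \<Longrightarrow> \<phi> \<in> formulas M (I <+> B)"
  unfolding complete_type_def by blast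

lemma complete_type_finite:
  "complete_type M I B p \<Longrightarrow> finite F \<Longrightarrow> F \<subseteq> p \<Longrightarrow> \<exists>c. realizes M c F"
  unfolding complete_type_def consistent_def by blast

lemma complete_type_imp:
  assumes p: "complete_type M I B p" and F: "finite F" "F \<subseteq> p"
    and \<phi>: "\<phi> \<in> formulas M (I <+> B)" and imp: "\<And>c. realizes M c F \<Longrightarrow> holds M c \<phi>"
  shows "\<phi> \<in> p"
proof (rule ccontr)
  assume "\<phi> \<notin> p"
  then have "Neg \<phi> \<in> p" using p \<phi> unfolding complete_type_def by blast
  then obtain c where "realizes M c (insert (Neg \<phi>) F)"
    using complete_type_finite[OF p, of "insert (Neg \<phi>) F"] F by auto
  then show False using imp[of c] unfolding realizes_def by auto
qed

lemma complete_type_Neg: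
  assumes p: "complete_type M I B p" and \<phi>: "\<phi> \<in> formulas M (I <+> B)"
  shows "Neg \<phi> \<in> p \<longleftrightarrow> \<phi> \<notin> p"
proof
  assume "Neg \<phi> \<in> p"
  show "\<phi> \<notin> p"
  proof
    assume "\<phi> \<in> p"
    then obtain c where "realizes M c {\<phi>, Neg \<phi>}"
      using complete_type_finite[OF p, of "{\<phi>, Neg \<phi>}"] \<open>Neg \<phi> \<in> p\<close> by auto
    then show False unfolding realizes_def by auto
  qed
next
  show "\<phi> \<notin> p \<Longrightarrow> Neg \<phi> \<in> p" using p \<phi> unfolding complete_type_def by blast
qed

lemma complete_type_mp:
  assumes p: "complete_type M I B p" and "Imp \<phi> \<psi> \<in> p" "\<phi> \<in> p"
  shows "\<psi> \<in> p"
proof (rule complete_type_imp[OF p, of "{Imp \<phi> \<psi>, \<phi>}"])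
  show "\<psi> \<in> formulas M (I <+> B)" using complete_type_formulas[OF p assms(2)] by simp
qed (use assms in \<open>auto simp: realizes_def\<close>)

lemma complete_type_conjs:
  assumes p: "complete_type M I B p" and "set \<phi>s \<subseteq> p"
  shows "conjs \<phi>s \<in> p"
  by (rule complete_type_imp[OF p, of "set \<phi>s"])
    (use assms in \<open>auto simp: realizes_def dest: complete_type_formulas[OF p]\<close>)

text \<open>For a complete \<open>q\<close> this is realization of its restriction to
  \<open>D\<close>, as \<open>models_restrict\<close> shows. The equivalence in the body makes the
  types of two realizations agree at once, without passing to negations.\<close>

definition models ::
    "('f, 'r, 'a) struct \<Rightarrow> ('f, 'r, 'i + 'a) fm set \<Rightarrow> ('i \<Rightarrow> 'a) \<Rightarrow> 'i set \<Rightarrow> 'a set \<Rightarrow> bool" where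
  "models M q c I D \<longleftrightarrow> (\<forall>\<phi> \<in> formulas M (I <+> D). holds M c \<phi> \<longleftrightarrow> \<phi> \<in> q)"

lemma modelsD: "models M q c I D \<Longrightarrow> \<phi> \<in> formulas M (I <+> D) \<Longrightarrow> holds M c \<phi> \<longleftrightarrow> \<phi> \<in> q"
  unfolding models_def by blast

lemma formulas_Plus_mono: "\<phi> \<in> formulas M (I <+> B) \<Longrightarrow> I \<subseteq> J \<Longrightarrow> B \<subseteq> C \<Longrightarrow> \<phi> \<in> formulas M (J <+> C)"
  by (rule formulas_mono) auto

lemma models_mono: "models M q c I D \<Longrightarrow> J \<subseteq> I \<Longrightarrow> C \<subseteq> D \<Longrightarrow> models M q c J C"
  unfolding models_def using formulas_Plus_mono by blast

lemma models_cong: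
  assumes "\<And>i. i \<in> I \<Longrightarrow> c i = d i"
  shows "models M q c I D \<longleftrightarrow> models M q d I D"
  unfolding models_def using holds_cong[of _ M I D c d] assms by simp

lemma models_restrict:
  assumes q: "complete_type M I UNIV q"
  shows "realizes M c (restrict_type M I q D) \<longleftrightarrow> models M q c I D"
proof
  assume r: "realizes M c (restrict_type M I q D)"
  have *: "\<phi> \<in> q \<Longrightarrow> \<phi> \<in> formulas M (I <+> D) \<Longrightarrow> holds M c \<phi>" for \<phi>
    using r unfolding realizes_def restrict_type_def by blast
  have "holds M c \<phi> \<longleftrightarrow> \<phi> \<in> q" if "\<phi> \<in> formulas M (I <+> D)" for \<phi>
    using *[of \<phi>] *[of "Neg \<phi>"] complete_type_Neg[OF q, of \<phi>] that
      formulas_Plus_mono[of \<phi> M I D I UNIV] by auto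
  then show "models M q c I D" unfolding models_def by blast
next
  assume "models M q c I D"
  then show "realizes M c (restrict_type M I q D)"
    unfolding models_def realizes_def restrict_type_def by blast
qed

lemma complete_restrict:
  assumes q: "complete_type M I UNIV q"
  shows "complete_type M I D (restrict_type M I q D)"
  unfolding complete_type_def restrict_type_def
proof (intro conjI ballI)
  show "consistent M (q \<inter> formulas M (I <+> D))"
    using q unfolding complete_type_def by (blast intro: consistent_mono)
  show "\<phi> \<in> q \<inter> formulas M (I <+> D) \<or> Neg \<phi> \<in> q \<inter> formulas M (I <+> D)"
    if "\<phi> \<in> formulas M (I <+> D)" for \<phi>
    using that complete_type_Neg[OF q, of \<phi>] formulas_Plus_mono[of \<phi> M I D I UNIV] by auto
qed simp

lemma tp_eq_iff: "tp M a I B = tp M b I B \<longleftrightarrow>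
    (\<forall>\<phi> \<in> formulas M (I <+> B). holds M a \<phi> \<longleftrightarrow> holds M b \<phi>)"
  unfolding tp_def by blast

lemma tp_subset_models:
  assumes q: "complete_type M I UNIV q" and "tp M a I B \<subseteq> q"
  shows "models M q a I B"
  unfolding models_def
proof
  fix \<phi> assume \<phi>: "\<phi> \<in> formulas M (I <+> B)"
  have *: "\<chi> \<in> formulas M (I <+> B) \<Longrightarrow> holds M a \<chi> \<Longrightarrow> \<chi> \<in> q" for \<chi>
    using assms(2) unfolding tp_def by blast
  show "holds M a \<phi> \<longleftrightarrow> \<phi> \<in> q"
    using *[of \<phi>] *[of "Neg \<phi>"] \<phi> complete_type_Neg[OF q, of \<phi>] formulas_Plus_mono[of \<phi> M I B I UNIV]
    by auto
qed

lemma models_tp_subset: "models M q a I B \<Longrightarrow> tp M a I B \<subseteq> q"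
  unfolding models_def tp_def by blast

lemma models_tp_eq: "models M q a I B \<Longrightarrow> models M q b I B \<Longrightarrow> tp M a I B = tp M b I B"
  unfolding models_def tp_eq_iff by blast

lemma tp_eq_models: "tp M a I B = tp M b I B \<Longrightarrow> models M q a I B \<Longrightarrow> models M q b I B"
  unfolding models_def tp_eq_iff by blast

lemma tp_aut:
  assumes "\<sigma> \<in> Aut M" "\<And>b. b \<in> B \<Longrightarrow> \<sigma> b = b"
  shows "tp M (\<sigma> \<circ> a) I B = tp M a I B"
  unfolding tp_eq_iff
proof
  fix \<phi> assume \<phi>: "\<phi> \<in> formulas M (I <+> B)"
  have "inst \<sigma> \<phi> = \<phi>" using params_formulas[OF \<phi>] assms(2) by (intro inst_id) auto
  then show "holds M (\<sigma> \<circ> a) \<phi> \<longleftrightarrow> holds M a \<phi>" using holds_aut[OF assms(1) \<phi>, of a] by simp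
qed

section \<open>Small sets\<close>

lemma finite_ordLeq_infinite:
  assumes "finite X" "infinite U"
  shows "|X| \<le>o |U|"
  using assms ordLeq_total[OF card_of_Well_order card_of_Well_order, of X U] card_of_ordLeq_finite
  by blast

locale monster =
  fixes \<kappa> :: "'k rel" and M :: "('f, 'r, 'a) struct"
  assumes monster: "monster_model \<kappa> M"
begin

lemma Cinf: "Card_order \<kappa>" "natLeq <o \<kappa>" "infinite (Field \<kappa>)"
proof -
  show *: "Card_order \<kappa>" "natLeq <o \<kappa>" using monster unfolding monster_model_def by auto
  show "infinite (Field \<kappa>)"
    using * by (metis card_of_Field_ordIso cinfinite_def cinfinite_mono natLeq_cinfinite ordLess_imp_ordLeq)
qed

lemma small_mono: "small \<kappa> X \<Longrightarrow> |Y| \<le>o |X| \<Longrightarrow> small \<kappa> Y"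
  unfolding small_def by (rule ordLeq_ordLess_trans)

lemma small_subset: "small \<kappa> X \<Longrightarrow> Y \<subseteq> X \<Longrightarrow> small \<kappa> Y"
  using small_mono card_of_mono1 by blast

lemma small_image: "small \<kappa> X \<Longrightarrow> small \<kappa> (f ` X)"
  using small_mono card_of_image by blast

lemma small_Plus: "small \<kappa> X \<Longrightarrow> small \<kappa> Y \<Longrightarrow> small \<kappa> (X <+> Y)"
  unfolding small_def using card_of_Plus_ordLess_infinite_Field[OF Cinf(3,1)] by blast

lemma small_Un: "small \<kappa> X \<Longrightarrow> small \<kappa> Y \<Longrightarrow> small \<kappa> (X \<union> Y)"
  unfolding small_def using card_of_Un_ordLess_infinite_Field[OF Cinf(3,1)] by blast

lemma small_nat: "small \<kappa> (UNIV :: nat set)"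
  unfolding small_def using Cinf(2) card_of_nat ordIso_ordLess_trans by blast

lemma small_finite: "finite X \<Longrightarrow> small \<kappa> X"
  by (rule small_mono[OF small_nat]) (simp add: finite_ordLeq_infinite)

lemma small_nat_Times:
  assumes "finite P"
  shows "small \<kappa> ((UNIV :: nat set) \<times> P)"
proof (rule small_mono[OF small_nat])
  show "|(UNIV :: nat set) \<times> P| \<le>o |UNIV :: nat set|"
    using assms by (intro card_of_Sigma_ordLeq_infinite)
      (auto simp: finite_ordLeq_infinite card_of_mono1)
qed

lemma small_finite_Times:
  assumes "finite J" "small \<kappa> I"
  shows "small \<kappa> (J \<times> I)"
proof (cases "finite I")
  case True then show ?thesis using assms by (simp add: small_finite)
next
  case False
  have "|J \<times> I| \<le>o |I|" using False assms
    by (intro card_of_Sigma_ordLeq_infinite) (auto simp: finite_ordLeq_infinite card_of_mono1)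
  then show ?thesis using small_mono assms(2) by blast
qed

lemma small_UN_nat:
  assumes "\<And>n::nat. finite (X n)"
  shows "small \<kappa> (\<Union>n. X n)"
proof (rule small_mono[OF small_nat])
  show "|\<Union>n. X n| \<le>o |UNIV :: nat set|"
    using assms by (intro card_of_UNION_ordLeq_infinite)
      (auto simp: finite_ordLeq_infinite card_of_mono1)
qed

section \<open>Realizing types in small tuples\<close>

text \<open>Saturation is assumed for types in one variable. It extends to small tuples by realizing
  one coordinate at a time: a maximal partial realization, taken by Zorn's lemma, must be defined on
  all of \<open>I\<close>.\<close>

lemma realize_complete:
  fixes I :: "'i set"
  assumes p: "complete_type M I B p" and I: "small \<kappa> I" and B: "small \<kappa> B"
  obtains c where "realizes M c p"
proof -
  \<comment> \<open>Partial assignments are relations \<open>R\<close>, ordered by inclusion; the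
    existence of a total \<open>c\<close> agreeing with \<open>R\<close> makes \<open>R\<close>
    single-valued.\<close>
  define agr where "agr c R \<longleftrightarrow> (\<forall>(j, x) \<in> R. c j = x)" for c :: "'i \<Rightarrow> 'a" and R
  define good where "good R \<longleftrightarrow> R \<subseteq> I \<times> UNIV \<and> (\<exists>c. agr c R) \<and>
    (\<forall>\<phi> \<in> p. frees \<phi> \<subseteq> Domain R <+> B \<longrightarrow> (\<forall>c. agr c R \<longrightarrow> holds M c \<phi>))" for R
  have "\<exists>R\<in>{R. good R}. \<forall>S\<in>{R. good R}. R \<subseteq> S \<longrightarrow> S = R"
  proof (rule subset_Zorn_nonempty)
    have "good {}"
      unfolding good_def
    proof (intro conjI ballI impI allI)
      fix \<phi> c assume \<phi>: "\<phi> \<in> p" "frees \<phi> \<subseteq> Domain {} <+> B"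
      obtain c' where "holds M c' \<phi>"
        using complete_type_finite[OF p, of "{\<phi>}"] \<phi>(1) unfolding realizes_def by auto
      moreover have "\<phi> \<in> formulas M ({} <+> B)"
        using formulas_frees[OF complete_type_formulas[OF p \<phi>(1)]] \<phi>(2) by auto
      ultimately show "holds M c \<phi>" using holds_cong[of \<phi> M "{}" B c c'] by simp
    qed (auto simp: agr_def)
    then show "{R. good R} \<noteq> {}" by blast
    fix C assume C: "C \<noteq> {}" "subset.chain {R. good R} C"
    have g: "good R" if "R \<in> C" for R using C(2) that unfolding subset.chain_def by blast
    have fin: "\<exists>R\<in>C. F \<subseteq> R" if F: "finite F" "F \<subseteq> \<Union>C" for F
      using finite_subset_Union_chain[OF F C(1), of "{R. good R}"] C by blast
    have sv: "x = y" if xy: "(j, x) \<in> \<Union>C" "(j, y) \<in> \<Union>C" for j x y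
    proof -
      have "finite {(j, x), (j, y)}" "{(j, x), (j, y)} \<subseteq> \<Union>C" using xy by simp_all
      then obtain R where R: "R \<in> C" "{(j, x), (j, y)} \<subseteq> R" using fin by meson
      then obtain c where "agr c R" using g unfolding good_def by blast
      then have "c j = x" "c j = y" using R(2) unfolding agr_def by auto
      then show ?thesis by simp
    qed
    have "good (\<Union>C)"
      unfolding good_def
    proof (intro conjI ballI impI allI)
      show "\<Union>C \<subseteq> I \<times> UNIV" using g unfolding good_def by blast
      have "agr (\<lambda>j. THE x. (j, x) \<in> \<Union>C) (\<Union>C)"
        unfolding agr_def
      proof (clarify)
        fix j x R assume "(j, x) \<in> R" "R \<in> C"
        then have "(j, x) \<in> \<Union>C" by blast
        then show "(THE x. (j, x) \<in> \<Union>C) = x" using sv by (intro the_equality) blast+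
      qed
      then show "\<exists>c. agr c (\<Union>C)" by blast
      fix \<phi> c assume \<phi>: "\<phi> \<in> p" "frees \<phi> \<subseteq> Domain (\<Union>C) <+> B" and c: "agr c (\<Union>C)"
      define J where "J = {j. Inl j \<in> frees \<phi>}"
      have "finite J" "J \<subseteq> Domain (\<Union>C)"
      proof -
        have "J = Inl -` frees \<phi>" unfolding J_def by auto
        then show "finite J" by (simp add: finite_frees finite_vimageI)
        show "J \<subseteq> Domain (\<Union>C)" using \<phi>(2) unfolding J_def by blast
      qed
      then have "finite ((\<lambda>j. (j, c j)) ` J)" by blast
      moreover have "(\<lambda>j. (j, c j)) ` J \<subseteq> \<Union>C"
      proof (rule image_subsetI)
        fix j assume "j \<in> J"
        then obtain x where x: "(j, x) \<in> \<Union>C" using \<open>J \<subseteq> Domain (\<Union>C)\<close> by blast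
        then have "c j = x" using c unfolding agr_def by fastforce
        then show "(j, c j) \<in> \<Union>C" using x by simp
      qed
      ultimately obtain R where R: "R \<in> C" "(\<lambda>j. (j, c j)) ` J \<subseteq> R" using fin by meson
      then have "frees \<phi> \<subseteq> Domain R <+> B" using \<phi>(2) unfolding J_def by (force simp: Domain_iff)
      moreover have "agr c R" using c R(1) unfolding agr_def by (meson UnionI)
      ultimately show "holds M c \<phi>" using g[OF R(1)] \<phi>(1) unfolding good_def by blast
    qed
    then show "\<Union>C \<in> {R. good R}" by blast
  qed
  then obtain R where R: "good R" and max: "\<And>S. good S \<Longrightarrow> R \<subseteq> S \<Longrightarrow> S = R" by blast
  obtain c0 where c0: "agr c0 R" using R unfolding good_def by blast
  define J where "J = Domain R"
  have JI: "J \<subseteq> I" using R unfolding good_def J_def by auto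
  have h0: "holds M c0 \<phi>" if "\<phi> \<in> p" "frees \<phi> \<subseteq> J <+> B" for \<phi>
    using R that c0 unfolding good_def J_def by blast
  have IJ: "I \<subseteq> J"
  proof (rule ccontr)
    assume "\<not> I \<subseteq> J"
    then obtain i where i: "i \<in> I" and iJ: "i \<notin> J" by blast
    define B' where "B' = B \<union> c0 ` J"
    \<comment> \<open>Values of coordinates already chosen are turned back into variables, so that
      \<open>p\<close>, whose parameters lie in \<open>B\<close>, decides the formulas about the new
      coordinate.\<close>
    define lf where "lf = case_sum (\<lambda>_::unit. Inl i)
      (\<lambda>b. if b \<in> B then Inr b else (Inl (inv_into J c0 b) :: 'i + 'a))"
    have lf: "lf ` (UNIV <+> B') \<subseteq> insert i J <+> B"
      unfolding lf_def B'_def using inv_into_into[of _ c0 J] by auto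
    have val: "((case_sum c0 id)(Inl i := x)) (lf v) = case_sum (\<lambda>_. x) id v"
      if "v \<in> UNIV <+> B'" for v x
    proof (cases v)
      case (Inl u)
      then show ?thesis unfolding lf_def by simp
    next
      case (Inr b)
      show ?thesis
      proof (cases "b \<in> B")
        case True
        then show ?thesis unfolding lf_def Inr by simp
      next
        case False
        then have "b \<in> c0 ` J" using that unfolding Inr B'_def by auto
        then have "inv_into J c0 b \<in> J" "c0 (inv_into J c0 b) = b"
          by (auto intro: inv_into_into f_inv_into_f)
        then show ?thesis using iJ False unfolding lf_def Inr by auto
      qed
    qed
    define p' where "p' = {\<chi> \<in> formulas M (UNIV <+> B'). map_fm lf \<chi> \<in> p}"
    have lift: "map_fm lf \<chi> \<in> formulas M (insert i J <+> B)"
      "map_fm lf \<chi> \<in> formulas M (I <+> B)" if "\<chi> \<in> formulas M (UNIV <+> B')" for \<chi>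
    proof -
      show "map_fm lf \<chi> \<in> formulas M (insert i J <+> B)" using formulas_map[OF that lf] .
      then show "map_fm lf \<chi> \<in> formulas M (I <+> B)"
        by (rule formulas_Plus_mono) (use i JI in auto)
    qed
    have lift_val: "sat M UNIV ((case_sum c0 id)(Inl i := x)) [] (map_fm lf \<chi>) \<longleftrightarrow> holds M (\<lambda>_. x) \<chi>"
      if "\<chi> \<in> formulas M (UNIV <+> B')" for \<chi> x
      unfolding sat_map holds_def
    proof (rule sat_cong)
      fix v assume "v \<in> frees \<chi>"
      then have "v \<in> UNIV <+> B'" using frees_formulas[OF that] by blast
      then show "((case_sum c0 id)(Inl i := x) \<circ> lf) v = case_sum (\<lambda>_. x) id v"
        unfolding comp_apply by (rule val)
    qed
    \<comment> \<open>By completeness \<open>p\<close> contains the existential quantification of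
      \<open>\<Phi>\<close> over coordinate \<open>i\<close>, and \<open>c0\<close> satisfies it
      since only coordinates in \<open>J\<close> remain.\<close>
    have ex: "\<exists>x. sat M UNIV ((case_sum c0 id)(Inl i := x)) [] \<Phi>"
      if \<Phi>: "\<Phi> \<in> p" "\<Phi> \<in> formulas M (insert i J <+> B)" for \<Phi>
    proof -
      have wf: "wf_fm M 0 \<Phi>" using \<Phi> unfolding formulas_def by blast
      have "exq (Inl i) \<Phi> \<in> formulas M (J <+> B)"
        using \<Phi>(2) unfolding formulas_def by (auto simp: exq_wf frees_exq)
      moreover have "exq (Inl i) \<Phi> \<in> p"
      proof (rule complete_type_imp[OF p, of "{\<Phi>}"])
        show "exq (Inl i) \<Phi> \<in> formulas M (I <+> B)"
          using calculation by (rule formulas_Plus_mono) (use JI in auto)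
        fix c assume "realizes M c {\<Phi>}"
        then have "sat M UNIV ((case_sum c id)(Inl i := c i)) [] \<Phi>"
          unfolding realizes_def holds_def by (simp add: fun_upd_idem)
        then show "holds M c (exq (Inl i) \<Phi>)" unfolding holds_def sat_exq[OF wf] by blast
      qed (use \<Phi> in auto)
      ultimately have "holds M c0 (exq (Inl i) \<Phi>)" using h0 frees_formulas by blast
      then show ?thesis unfolding holds_def sat_exq[OF wf] .
    qed
    have "complete_type M (UNIV :: unit set) B' p'"
      unfolding complete_type_def
    proof (intro conjI ballI)
      show "p' \<subseteq> formulas M (UNIV <+> B')" unfolding p'_def by blast
      fix \<chi> :: "('f, 'r, unit + 'a) fm" assume \<chi>: "\<chi> \<in> formulas M (UNIV <+> B')"
      show "\<chi> \<in> p' \<or> Neg \<chi> \<in> p'"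
        using lift(2)[OF \<chi>] \<chi> complete_type_Neg[OF p, of "map_fm lf \<chi>"] unfolding p'_def by auto
    next
      show "consistent M p'"
        unfolding consistent_def
      proof (intro allI impI)
        fix F assume F: "finite F" "F \<subseteq> p'"
        obtain \<phi>s where \<phi>s: "set \<phi>s = map_fm lf ` F"
          using finite_list[OF finite_imageI[OF F(1)]] by metis
        have "conjs \<phi>s \<in> p"
          using F(2) unfolding p'_def by (intro complete_type_conjs[OF p]) (auto simp: \<phi>s)
        moreover have "conjs \<phi>s \<in> formulas M (insert i J <+> B)"
          using F(2) lift(1) unfolding p'_def by (auto simp: \<phi>s)
        ultimately obtain x where "sat M UNIV ((case_sum c0 id)(Inl i := x)) [] (conjs \<phi>s)"
          using ex by blast
        then have "realizes M (\<lambda>_. x) F"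
          using F(2) lift_val unfolding realizes_def p'_def by (auto simp: \<phi>s)
        then show "\<exists>c. realizes M c F" by blast
      qed
    qed
    moreover have "small \<kappa> B'"
      unfolding B'_def using B I JI by (intro small_Un small_image) (auto intro: small_subset)
    moreover have "saturated \<kappa> M" using monster unfolding monster_model_def by simp
    ultimately obtain c' where c': "realizes M c' p'" unfolding saturated_def by meson
    define x where "x = c' ()"
    have "c' = (\<lambda>_. x)" unfolding x_def by auto
    then have x: "realizes M (\<lambda>_. x) p'" using c' by metis
    have "good (insert (i, x) R)"
      unfolding good_def
    proof (intro conjI ballI impI allI)
      show "insert (i, x) R \<subseteq> I \<times> UNIV" using R i unfolding good_def by auto
      show "\<exists>c. agr c (insert (i, x) R)"
        by (rule exI[of _ "c0(i := x)"]) (use c0 iJ in \<open>auto simp: agr_def J_def\<close>)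
      fix \<phi> c assume \<phi>: "\<phi> \<in> p" "frees \<phi> \<subseteq> Domain (insert (i, x) R) <+> B"
        and c: "agr c (insert (i, x) R)"
      have f\<phi>: "\<phi> \<in> formulas M (insert i J <+> B)"
        using formulas_frees[OF complete_type_formulas[OF p \<phi>(1)] \<phi>(2)] unfolding J_def by simp
      define m where "m = case_sum (\<lambda>j. if j = i then Inl () else Inr (c0 j)) (Inr :: 'a \<Rightarrow> unit + 'a)"
      define \<chi> where "\<chi> = map_fm m \<phi>"
      have \<chi>: "\<chi> \<in> formulas M (UNIV <+> B')"
        unfolding \<chi>_def by (rule formulas_map[OF f\<phi>]) (auto simp: m_def B'_def)
      have mval: "case_sum (\<lambda>_. y) id (m v) = ((case_sum c0 id)(Inl i := y)) v"
        if "v \<in> insert i J <+> B" for v y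
        using that iJ unfolding m_def by (auto split: if_splits)
      have \<chi>val: "holds M (\<lambda>_. y) \<chi> \<longleftrightarrow> sat M UNIV ((case_sum c0 id)(Inl i := y)) [] \<phi>" for y
        unfolding \<chi>_def holds_map
      proof (rule sat_cong)
        fix v assume "v \<in> frees \<phi>"
        then have "v \<in> insert i J <+> B" using frees_formulas[OF f\<phi>] by blast
        then show "(case_sum (\<lambda>_. y) id \<circ> m) v = ((case_sum c0 id)(Inl i := y)) v"
          unfolding comp_apply by (rule mval)
      qed
      \<comment> \<open>Translating \<open>\<phi>\<close> by \<open>m\<close> and then by
        \<open>lf\<close> need not give \<open>\<phi>\<close> back, since several coordinates may
        share a value and a value may lie in \<open>B\<close>. If \<open>p\<close> refuted the
        result, then by \<open>ex\<close> some \<open>y\<close> would satisfy \<open>\<phi>\<close>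
        and falsify the translation, although both have the same truth value at every
        \<open>y\<close>.\<close>
      have "\<chi> \<in> p'"
      proof (rule ccontr)
        assume "\<chi> \<notin> p'"
        then have "Neg (map_fm lf \<chi>) \<in> p"
          using \<chi> lift(2)[OF \<chi>] complete_type_Neg[OF p, of "map_fm lf \<chi>"] unfolding p'_def by auto
        then have "conjs [\<phi>, Neg (map_fm lf \<chi>)] \<in> p"
          using \<phi>(1) by (intro complete_type_conjs[OF p]) auto
        moreover have "conjs [\<phi>, Neg (map_fm lf \<chi>)] \<in> formulas M (insert i J <+> B)"
          using f\<phi> lift(1)[OF \<chi>] by (auto simp del: conjs.simps)
        ultimately obtain y where "sat M UNIV ((case_sum c0 id)(Inl i := y)) [] (conjs [\<phi>, Neg (map_fm lf \<chi>)])"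
          using ex by blast
        then show False using lift_val[OF \<chi>, of y] \<chi>val[of y] by (auto simp del: conjs.simps)
      qed
      then have "sat M UNIV ((case_sum c0 id)(Inl i := x)) [] \<phi>"
        using x \<chi>val[of x] unfolding realizes_def by blast
      moreover have "holds M c \<phi> \<longleftrightarrow> sat M UNIV ((case_sum c0 id)(Inl i := x)) [] \<phi>"
        unfolding holds_def
      proof (rule sat_cong)
        fix v assume "v \<in> frees \<phi>"
        then have "v \<in> insert i J <+> B" using frees_formulas[OF f\<phi>] by blast
        then show "case_sum c id v = ((case_sum c0 id)(Inl i := x)) v"
          using c c0 iJ unfolding agr_def J_def by fastforce
      qed
      ultimately show "holds M c \<phi>" by blast
    qed
    then have "insert (i, x) R = R" using max by blast
    then show False using iJ unfolding J_def by blast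
  qed
  have "realizes M c0 p"
    unfolding realizes_def using h0 complete_type_formulas[OF p] frees_formulas IJ by blast
  then show ?thesis using that by blast
qed

lemma realize_small:
  assumes "p \<subseteq> formulas M (I <+> B)" "consistent M p" "small \<kappa> I" "small \<kappa> B"
  obtains c where "realizes M c p"
proof -
  obtain q where q: "p \<subseteq> q" "complete_type M I B q" using Lindenbaum[OF assms(1,2)] .
  obtain c where "realizes M c q" using realize_complete[OF q(2) assms(3,4)] .
  then show ?thesis using that q(1) unfolding realizes_def by blast
qed

lemma models_exists:
  assumes "complete_type M I UNIV q" "small \<kappa> I" "small \<kappa> D"
  obtains c where "models M q c I D"
  using realize_complete[OF complete_restrict[OF assms(1)] assms(2,3)] models_restrict[OF assms(1)]
  by blast

text \<open>\<open>strongly_homogeneous\<close> speaks of maps on sets, whereas the tuple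
  \<open>a\<close> may repeat values or meet \<open>B\<close>. The equations between entries belong
  to the type, so \<open>b\<close> repeats in the same way and the map \<open>f\<close> on
  \<open>S\<close> takes each \<open>a i\<close> to \<open>b i\<close>.\<close>

lemma homogeneous:
  assumes I: "small \<kappa> I" and B: "small \<kappa> B" and eq: "tp M a I B = tp M b I B"
  obtains \<sigma> where "\<sigma> \<in> Aut M" "\<And>x. x \<in> B \<Longrightarrow> \<sigma> x = x" "\<And>i. i \<in> I \<Longrightarrow> \<sigma> (a i) = b i"
proof -
  define S where "S = B \<union> a ` I"
  define f where "f x = (if x \<in> B then x else b (inv_into I a x))" for x
  have sS: "small \<kappa> S" unfolding S_def by (intro small_Un small_image I B)
  define lf where "lf x = (if x \<in> B then Inr x else Inl (inv_into I a x))" for x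
  have lf: "lf ` S \<subseteq> I <+> B" unfolding lf_def S_def using inv_into_into[of _ a I] by auto
  have h: "holds M a \<phi> \<longleftrightarrow> holds M b \<phi>" if "\<phi> \<in> formulas M (I <+> B)" for \<phi>
    using eq that unfolding tp_eq_iff by blast
  have "partial_elementary M S f"
    unfolding partial_elementary_def
  proof
    fix \<phi> assume \<phi>: "\<phi> \<in> formulas M S"
    have "sat M UNIV id [] \<phi> \<longleftrightarrow> holds M a (map_fm lf \<phi>)"
      unfolding holds_map
      by (rule sat_cong) (use frees_formulas[OF \<phi>] in \<open>auto simp: lf_def S_def f_inv_into_f\<close>)
    also have "\<dots> \<longleftrightarrow> holds M b (map_fm lf \<phi>)" using h formulas_map[OF \<phi> lf] by blast
    also have "\<dots> \<longleftrightarrow> sat M UNIV f [] \<phi>"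
      unfolding holds_map
      by (rule sat_cong) (auto simp: lf_def f_def)
    finally show "sat M UNIV id [] \<phi> \<longleftrightarrow> sat M UNIV f [] \<phi>" .
  qed
  then obtain \<sigma> where \<sigma>: "\<sigma> \<in> Aut M" "\<forall>x\<in>S. \<sigma> x = f x"
    using monster sS unfolding monster_model_def strongly_homogeneous_def by blast
  have "\<sigma> (a i) = b i" if i: "i \<in> I" for i
  proof (cases "a i \<in> B")
    case True
    have "Eq (Fre (Inl i)) (Fre (Inr (a i))) \<in> formulas M (I <+> B)"
      using i True unfolding formulas_def by auto
    from h[OF this] have "b i = a i" by (simp add: holds_def)
    then show ?thesis using \<sigma>(2) True unfolding f_def S_def by auto
  next
    case False
    define j where "j = inv_into I a (a i)"
    have j: "j \<in> I" "a j = a i" unfolding j_def using i by (auto intro: inv_into_into f_inv_into_f)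
    have "Eq (Fre (Inl i)) (Fre (Inl j)) \<in> formulas M (I <+> B)"
      using i j unfolding formulas_def by auto
    from h[OF this] have "b i = b j" using j by (simp add: holds_def)
    then show ?thesis using \<sigma>(2) False i unfolding f_def S_def j_def by auto
  qed
  moreover have "\<sigma> x = x" if "x \<in> B" for x using \<sigma>(2) that unfolding S_def f_def by auto
  ultimately show ?thesis using that \<sigma>(1) by blast
qed

end

section \<open>Small elementary submodels\<close>

lemma image_le: "|X| \<le>o |U| \<Longrightarrow> |f ` X| \<le>o |U|"
  using card_of_image ordLeq_transitive by blast

lemma Un_le: "infinite U \<Longrightarrow> |X| \<le>o |U| \<Longrightarrow> |Y| \<le>o |U| \<Longrightarrow> |X \<union> Y| \<le>o |U|"
  by (rule ordLeq_transitive[OF card_of_Un_Plus_ordLeq])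
    (rule card_of_Plus_ordLeq_infinite_Field[of "|U|", unfolded Field_card_of], simp_all add: card_of_card_order_on)

lemma Times_le: "infinite U \<Longrightarrow> |X| \<le>o |U| \<Longrightarrow> |Y| \<le>o |U| \<Longrightarrow> |X \<times> Y| \<le>o |U|"
  by (rule card_of_Sigma_ordLeq_infinite) auto

lemma UN_nat_le:
  assumes "infinite U" "\<And>n::nat. |X n| \<le>o |U|"
  shows "|\<Union>n. X n| \<le>o |U|"
  by (rule card_of_UNION_ordLeq_infinite) (use assms in \<open>auto simp: infinite_iff_card_of_nat\<close>)

lemma lists_le:
  assumes U: "infinite U" and X: "|X| \<le>o |U|"
  shows "|lists X| \<le>o |U|"
proof -
  define L where "L n = {xs \<in> lists X. length xs = n}" for n
  have "|L n| \<le>o |U|" for n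
  proof (induction n)
    case 0
    have "L 0 = {[]}" unfolding L_def by auto
    then show ?case using U by (simp add: finite_ordLeq_infinite)
  next
    case (Suc n)
    have "L (Suc n) = (\<lambda>(x, xs). x # xs) ` (X \<times> L n)"
      unfolding L_def by (auto simp: length_Suc_conv image_iff)
    then show ?case using image_le[OF Times_le[OF U X Suc]] by simp
  qed
  moreover have "lists X = (\<Union>n. L n)" unfolding L_def by auto
  ultimately show ?thesis using UN_nat_le[OF U, of L] by simp
qed

text \<open>Stages of nesting depth, made for counting. Arities are ignored: the stages together
  contain all well-formed terms over \<open>X\<close>, and a bound for lists bounds each
  stage.\<close>

fun terms :: "('f, 'r, 'a) struct \<Rightarrow> 'v set \<Rightarrow> nat \<Rightarrow> ('f, 'v) tm set" where
  "terms M X 0 = {}"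
| "terms M X (Suc n) = range Bnd \<union> Fre ` X \<union>
     (\<lambda>(f, ts). App f ts) ` (fst ` fsyms M \<times> lists (terms M X n))"

lemma terms_mono: "n \<le> m \<Longrightarrow> terms M X n \<subseteq> terms M X m"
proof -
  have "terms M X n \<subseteq> terms M X (Suc n)" for n
  proof (induction n)
    case (Suc n)
    have "lists (terms M X n) \<subseteq> lists (terms M X (Suc n))" using lists_mono[OF Suc] .
    then show ?case by (simp only: terms.simps) blast
  qed simp
  then show "n \<le> m \<Longrightarrow> terms M X n \<subseteq> terms M X m" by (rule lift_Suc_mono_le)
qed

lemma wf_terms: "wf_tm M k t \<Longrightarrow> frees_tm t \<subseteq> X \<Longrightarrow> \<exists>n. t \<in> terms M X n"
proof (induction t)
  case (Bnd m)
  show ?case by (rule exI[of _ "Suc 0"]) simp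
next
  case (Fre x)
  then show ?case by (intro exI[of _ "Suc 0"]) simp
next
  case (App f ts)
  have "\<forall>t\<in>set ts. \<exists>n. t \<in> terms M X n" using App by auto
  then obtain d where d: "\<forall>t\<in>set ts. t \<in> terms M X (d t)" by metis
  define n where "n = Max (d ` set ts)"
  have "t \<in> terms M X n" if "t \<in> set ts" for t
  proof -
    have "d t \<le> n" unfolding n_def using that by simp
    then show ?thesis using d that terms_mono[of "d t" n M X] by blast
  qed
  then have "ts \<in> lists (terms M X n)" by auto
  moreover have "f \<in> fst ` fsyms M" using App.prems by force
  ultimately have "App f ts \<in> terms M X (Suc n)" by (auto simp: image_iff)
  then show ?case by blast
qed

lemma terms_le:
  assumes U: "infinite U" and X: "|X| \<le>o |U|" and F: "|fsyms M| \<le>o |U|"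
  shows "|terms M X n| \<le>o |U|"
proof (induction n)
  case 0
  then show ?case using U by (simp add: finite_ordLeq_infinite)
next
  case (Suc n)
  have "|range Bnd :: ('f, 'v) tm set| \<le>o |U|"
    by (rule image_le) (use U in \<open>simp only: infinite_iff_card_of_nat\<close>)
  then show ?case
    unfolding terms.simps using U X F Suc by (intro Un_le Times_le lists_le image_le[of "X"] image_le[of "_ \<times> _"] image_le[of "fsyms M"])
qed

fun forms :: "'r set \<Rightarrow> ('f, 'v) tm set \<Rightarrow> nat \<Rightarrow> ('f, 'r, 'v) fm set" where
  "forms R T 0 = {}"
| "forms R T (Suc n) = (\<lambda>(s, t). Eq s t) ` (T \<times> T) \<union> (\<lambda>(r, ts). Rel r ts) ` (R \<times> lists T) \<union>
     Neg ` forms R T n \<union> (\<lambda>(\<phi>, \<psi>). Conj \<phi> \<psi>) ` (forms R T n \<times> forms R T n) \<union> Ex ` forms R T n"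

lemma forms_mono: "n \<le> m \<Longrightarrow> forms R T n \<subseteq> forms R T m"
proof -
  have "forms R T n \<subseteq> forms R T (Suc n)" for n
  proof (induction n)
    case (Suc n)
    then show ?case by (subst (1 2) forms.simps) blast
  qed simp
  then show "n \<le> m \<Longrightarrow> forms R T n \<subseteq> forms R T m" by (rule lift_Suc_mono_le)
qed

lemma wf_forms:
  assumes T: "\<And>k t. wf_tm M k t \<Longrightarrow> frees_tm t \<subseteq> X \<Longrightarrow> t \<in> T"
  shows "wf_fm M k \<phi> \<Longrightarrow> frees \<phi> \<subseteq> X \<Longrightarrow> \<exists>n. \<phi> \<in> forms (fst ` rsyms M) T n"
proof (induction \<phi> arbitrary: k)
  case (Eq s t)
  then have "s \<in> T" "t \<in> T" using T by auto
  then have "(s, t) \<in> T \<times> T" by simp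
  then show ?case by (intro exI[of _ "Suc 0"]) (auto simp: image_iff)
next
  case (Rel r ts)
  have "t \<in> T" if "t \<in> set ts" for t using Rel.prems that by (intro T[of k]) auto
  then have "ts \<in> lists T" by auto
  moreover have "r \<in> fst ` rsyms M" using Rel.prems by force
  ultimately show ?case by (intro exI[of _ "Suc 0"]) (auto simp: image_iff)
next
  case (Neg \<phi>)
  then have "\<exists>n. \<phi> \<in> forms (fst ` rsyms M) T n" by simp
  then obtain n where "\<phi> \<in> forms (fst ` rsyms M) T n" ..
  then show ?case by (intro exI[of _ "Suc n"]) simp
next
  case (Conj \<phi> \<psi>)
  have "\<exists>n. \<phi> \<in> forms (fst ` rsyms M) T n" by (rule Conj.IH(1)) (use Conj.prems in auto)
  moreover have "\<exists>n. \<psi> \<in> forms (fst ` rsyms M) T n" by (rule Conj.IH(2)) (use Conj.prems in auto)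
  ultimately obtain n m where n: "\<phi> \<in> forms (fst ` rsyms M) T n" and m: "\<psi> \<in> forms (fst ` rsyms M) T m"
    by blast
  have "\<phi> \<in> forms (fst ` rsyms M) T (max n m)" "\<psi> \<in> forms (fst ` rsyms M) T (max n m)"
    by (rule subsetD[OF forms_mono n], simp, rule subsetD[OF forms_mono m], simp)
  then show ?case by (intro exI[of _ "Suc (max n m)"]) (auto simp: image_iff)
next
  case (Ex \<phi>)
  have "\<exists>n. \<phi> \<in> forms (fst ` rsyms M) T n" by (rule Ex.IH) (use Ex.prems in auto)
  then obtain n where "\<phi> \<in> forms (fst ` rsyms M) T n" ..
  then show ?case by (intro exI[of _ "Suc n"]) simp
qed

lemma forms_le:
  assumes U: "infinite U" and R: "|R| \<le>o |U|" and T: "|T| \<le>o |U|"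
  shows "|forms R T n| \<le>o |U|"
proof (induction n)
  case 0
  then show ?case using U by (simp add: finite_ordLeq_infinite)
next
  case (Suc n)
  then show ?case
    unfolding forms.simps using U R T by (intro Un_le image_le Times_le lists_le)
qed

text \<open>Formulas with unbound indices are counted too, because the witness closure of
  \<open>small_submodel\<close> has to treat subformulas standing under quantifiers.\<close>

lemma card_formulas_le:
  assumes U: "infinite U" and X: "|X| \<le>o |U|" and F: "|fsyms M| \<le>o |U|" and R: "|rsyms M| \<le>o |U|"
  shows "|{\<phi>. (\<exists>n. wf_fm M n \<phi>) \<and> frees \<phi> \<subseteq> X}| \<le>o |U|" (is "|?S| \<le>o _")
proof -
  define T where "T = (\<Union>n. terms M X n)"
  have T: "|T| \<le>o |U|" unfolding T_def by (intro UN_nat_le U terms_le X F)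
  have "?S \<subseteq> (\<Union>n. forms (fst ` rsyms M) T n)"
  proof
    fix \<phi> assume "\<phi> \<in> ?S"
    then obtain n where "wf_fm M n \<phi>" "frees \<phi> \<subseteq> X" by blast
    moreover have "t \<in> T" if "wf_tm M k t" "frees_tm t \<subseteq> X" for k t
      using wf_terms[OF that] unfolding T_def by blast
    ultimately have "\<exists>n. \<phi> \<in> forms (fst ` rsyms M) T n" by (rule wf_forms[rotated])
    then show "\<phi> \<in> (\<Union>n. forms (fst ` rsyms M) T n)" by blast
  qed
  moreover have "|\<Union>n. forms (fst ` rsyms M) T n| \<le>o |U|"
    by (intro UN_nat_le U forms_le image_le R T)
  ultimately show ?thesis using card_of_mono1 ordLeq_transitive by blast
qed

text \<open>Downward Loewenheim-Skolem. Each \<open>stp\<close> adds witnesses for the formulas with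
  labels and environment in the current set; the union of the iterates passes the Tarski-Vaught
  test. The small set \<open>U\<close> bounds all stages at once.\<close>

lemma (in monster) small_submodel:
  assumes A: "small \<kappa> A"
  obtains N where "elem_substructure M N" "small \<kappa> N" "A \<subseteq> N"
proof -
  define U where "U = A <+> (fsyms M <+> (rsyms M <+> (UNIV :: nat set)))"
  have sU: "small \<kappa> U"
    unfolding U_def using A small_nat monster
    by (intro small_Plus) (auto simp: monster_model_def)
  have U: "infinite U" unfolding U_def by simp
  have le: "|A| \<le>o |U|" "|fsyms M| \<le>o |U|" "|rsyms M| \<le>o |U|"
    unfolding U_def
    by (meson card_of_Plus1 card_of_Plus2 ordLeq_transitive)+
  define W where "W X = {\<phi> :: ('f, 'r, 'a) fm. (\<exists>n. wf_fm M n \<phi>) \<and> frees \<phi> \<subseteq> X}" for X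
  define stp where "stp X = X \<union> (\<lambda>(\<phi>, e). SOME x. sat M UNIV id (x # e) \<phi>) ` (W X \<times> lists X)" for X
  define S where "S n = (stp ^^ n) A" for n
  define N where "N = (\<Union>n. S n)"
  have SS: "S (Suc n) = stp (S n)" for n unfolding S_def by simp
  have Sle: "|S n| \<le>o |U|" for n
  proof (induction n)
    case 0 then show ?case unfolding S_def using le by simp
  next
    case (Suc n)
    show ?case unfolding SS stp_def W_def
      by (intro Un_le U Suc image_le Times_le card_formulas_le le lists_le)
  qed
  have Smono: "S n \<subseteq> S m" if "n \<le> m" for n m
    using that by (rule lift_Suc_mono_le[rotated]) (auto simp: SS stp_def)
  have fin: "\<exists>n. F \<subseteq> S n" if "finite F" "F \<subseteq> N" for F
    using that
  proof (induction F rule: finite_induct)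
    case (insert x F)
    then obtain n m where "x \<in> S n" "F \<subseteq> S m" unfolding N_def by auto
    then have "insert x F \<subseteq> S (max n m)" using Smono[of n "max n m"] Smono[of m "max n m"] by auto
    then show ?case by blast
  qed simp
  have wit: "\<exists>x\<in>N. sat M UNIV id (x # e) \<phi>"
    if \<phi>: "wf_fm M k \<phi>" "frees \<phi> \<subseteq> N" and e: "set e \<subseteq> N" and ex: "sat M UNIV id (x # e) \<phi>" for k \<phi> e x
  proof -
    obtain n where n: "frees \<phi> \<union> set e \<subseteq> S n"
      using fin[of "frees \<phi> \<union> set e"] \<phi> e by (auto simp: finite_frees)
    define y where "y = (SOME x. sat M UNIV id (x # e) \<phi>)"
    have "\<phi> \<in> W (S n)" "e \<in> lists (S n)" using n \<phi> unfolding W_def by auto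
    then have "y \<in> S (Suc n)" unfolding SS stp_def y_def by force
    moreover have "sat M UNIV id (y # e) \<phi>" unfolding y_def using ex by (rule someI)
    ultimately show ?thesis unfolding N_def by blast
  qed
  have "elem_substructure M N"
    unfolding elem_substructure_def
  proof (intro conjI ballI)
    have "\<exists>x\<in>N. sat M UNIV id [x] (Eq (Bnd 0) (Bnd 0))"
      by (rule wit[of "Suc 0" _ "[]" undefined]) auto
    then show "N \<noteq> {}" by blast
  next
    fix p assume p: "p \<in> fsyms M"
    obtain f n where fn: "p = (f, n)" by force
    have "fint M f xs \<in> N" if xs: "length xs = n" "set xs \<subseteq> N" for xs
    proof -
      have vx: "map (val M id e) (map Fre xs) = xs" for e by (induction xs) auto
      \<comment> \<open>Closure under functions needs no separate stage: the only witness of this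
        equation is the value of \<open>f\<close> at \<open>xs\<close>.\<close>
      have "\<exists>x\<in>N. sat M UNIV id [x] (Eq (Bnd 0) (App f (map Fre xs)))"
      proof (rule wit)
        show "wf_fm M (Suc 0) (Eq (Bnd 0) (App f (map Fre xs)))" using p fn xs by auto
        show "frees (Eq (Bnd 0) (App f (map Fre xs))) \<subseteq> N" using xs(2) by auto
        show "sat M UNIV id [fint M f xs] (Eq (Bnd 0) (App f (map Fre xs)))"
          using vx by (simp del: map_map)
      qed simp
      then show ?thesis using vx by (auto simp del: map_map)
    qed
    then show "case p of (f, n) \<Rightarrow> \<forall>xs. length xs = n \<longrightarrow> set xs \<subseteq> N \<longrightarrow> fint M f xs \<in> N"
      using fn by simp
  next
    have tv: "wf_fm M (length e) \<phi> \<Longrightarrow> frees \<phi> \<subseteq> N \<Longrightarrow> set e \<subseteq> N \<Longrightarrow>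
      sat M N id e \<phi> \<longleftrightarrow> sat M UNIV id e \<phi>" for \<phi> e
    proof (induction \<phi> arbitrary: e)
      case (Ex \<phi>)
      have IH: "sat M N id (x # e) \<phi> \<longleftrightarrow> sat M UNIV id (x # e) \<phi>" if "x \<in> N" for x
        using Ex.prems that by (intro Ex.IH) auto
      have "(\<exists>x. sat M UNIV id (x # e) \<phi>) \<longleftrightarrow> (\<exists>x\<in>N. sat M UNIV id (x # e) \<phi>)"
        using wit[of "Suc (length e)" \<phi> e] Ex.prems by auto
      then show ?case unfolding sat.simps using IH by blast
    qed auto
    fix \<phi> assume "\<phi> \<in> formulas M N"
    then show "sat M N id [] \<phi> \<longleftrightarrow> sat M UNIV id [] \<phi>"
      unfolding formulas_def using tv[of "[]" \<phi>] by simp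
  qed
  moreover have "small \<kappa> N"
    using small_mono[OF sU UN_nat_le[OF U Sle]] unfolding N_def .
  moreover have "A \<subseteq> N" unfolding N_def S_def by (metis UN_upper UNIV_I funpow_0)
  ultimately show ?thesis using that by blast
qed

section \<open>Reindexing and conjugating types\<close>

lemma holds_reindex: "holds M c (map_fm (map_sum f id) \<phi>) \<longleftrightarrow> holds M (c \<circ> f) \<phi>"
proof -
  have "case_sum c id \<circ> map_sum f id = case_sum (c \<circ> f) id"
    by (auto split: sum.splits simp: fun_eq_iff)
  then show ?thesis unfolding holds_map by (simp add: holds_def)
qed

text \<open>The type of \<open>c \<circ> f\<close> when \<open>c\<close> realizes \<open>q\<close>.
  It serves both to pass to a subtuple and to change the index type.\<close>

definition reindex :: "('f, 'r, 'a) struct \<Rightarrow> ('i \<Rightarrow> 'j) \<Rightarrow> 'i set \<Rightarrow> ('f, 'r, 'j + 'a) fm set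
    \<Rightarrow> ('f, 'r, 'i + 'a) fm set" where
  "reindex M f I q = {\<phi> \<in> formulas M (I <+> UNIV). map_fm (map_sum f id) \<phi> \<in> q}"

lemma reindex_formulas:
  "\<phi> \<in> formulas M (I <+> B) \<Longrightarrow> f ` I \<subseteq> J \<Longrightarrow> map_fm (map_sum f id) \<phi> \<in> formulas M (J <+> B)"
  by (erule formulas_map) auto

lemma complete_reindex:
  fixes M :: "('f, 'r, 'a) struct" and I :: "'i set"
  assumes q: "complete_type M J UNIV q" and f: "f ` I \<subseteq> J"
  shows "complete_type M I UNIV (reindex M f I q)"
  unfolding complete_type_def
proof (intro conjI ballI)
  show "reindex M f I q \<subseteq> formulas M (I <+> UNIV)" unfolding reindex_def by blast
  fix \<phi> :: "('f, 'r, 'i + 'a) fm" assume \<phi>: "\<phi> \<in> formulas M (I <+> UNIV)"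
  show "\<phi> \<in> reindex M f I q \<or> Neg \<phi> \<in> reindex M f I q"
    using reindex_formulas[OF \<phi> f] \<phi> complete_type_Neg[OF q, of "map_fm (map_sum f id) \<phi>"]
    unfolding reindex_def by auto
next
  show "consistent M (reindex M f I q)"
    unfolding consistent_def
  proof (intro allI impI)
    fix F assume F: "finite F" "F \<subseteq> reindex M f I q"
    have "map_fm (map_sum f id) ` F \<subseteq> q" using F(2) unfolding reindex_def by auto
    then obtain c where "realizes M c (map_fm (map_sum f id) ` F)"
      using complete_type_finite[OF q, of "map_fm (map_sum f id) ` F"] F(1) by blast
    then have "realizes M (c \<circ> f) F" unfolding realizes_def by (simp add: holds_reindex)
    then show "\<exists>c. realizes M c F" by blast
  qed
qed

lemma models_reindex:
  assumes "models M q c J D" "f ` I \<subseteq> J"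
  shows "models M (reindex M f I q) (c \<circ> f) I D"
  unfolding models_def
proof
  fix \<phi> assume \<phi>: "\<phi> \<in> formulas M (I <+> D)"
  have "\<phi> \<in> formulas M (I <+> UNIV)" using \<phi> by (rule formulas_Plus_mono) auto
  then show "holds M (c \<circ> f) \<phi> \<longleftrightarrow> \<phi> \<in> reindex M f I q"
    using modelsD[OF assms(1) reindex_formulas[OF \<phi> assms(2)]] unfolding reindex_def
    by (simp add: holds_reindex)
qed

lemma inst_id': "inst id \<phi> = \<phi>"
  by (rule inst_id) simp

lemma inst_inv:
  assumes "\<sigma> \<in> Aut M"
  shows "inst (inv \<sigma>) (inst \<sigma> \<phi>) = \<phi>" "inst \<sigma> (inst (inv \<sigma>) \<phi>) = \<phi>"
  unfolding inst_comp Aut_comp_inv[OF assms] by (rule inst_id')+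

lemma in_inst_image:
  assumes "\<sigma> \<in> Aut M"
  shows "\<phi> \<in> inst \<sigma> ` q \<longleftrightarrow> inst (inv \<sigma>) \<phi> \<in> q"
proof
  assume "\<phi> \<in> inst \<sigma> ` q"
  then show "inst (inv \<sigma>) \<phi> \<in> q" by (elim imageE) (simp add: inst_inv(1)[OF assms])
next
  assume "inst (inv \<sigma>) \<phi> \<in> q"
  then have "inst \<sigma> (inst (inv \<sigma>) \<phi>) \<in> inst \<sigma> ` q" by (rule imageI)
  then show "\<phi> \<in> inst \<sigma> ` q" unfolding inst_inv(2)[OF assms] .
qed

lemma complete_inst:
  fixes M :: "('f, 'r, 'a) struct" and I :: "'i set"
  assumes \<sigma>: "\<sigma> \<in> Aut M" and q: "complete_type M I UNIV q"
  shows "complete_type M I UNIV (inst \<sigma> ` q)"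
  unfolding complete_type_def
proof (intro conjI ballI)
  show "inst \<sigma> ` q \<subseteq> formulas M (I <+> UNIV)"
    using complete_type_formulas[OF q] by (auto intro: inst_formulas)
  fix \<phi> :: "('f, 'r, 'i + 'a) fm" assume \<phi>: "\<phi> \<in> formulas M (I <+> UNIV)"
  have "inst (inv \<sigma>) \<phi> \<in> formulas M (I <+> UNIV)" using \<phi> by (rule inst_formulas) simp
  then show "\<phi> \<in> inst \<sigma> ` q \<or> Neg \<phi> \<in> inst \<sigma> ` q"
    unfolding in_inst_image[OF \<sigma>] using complete_type_Neg[OF q] by auto
next
  show "consistent M (inst \<sigma> ` q)"
    unfolding consistent_def
  proof (intro allI impI)
    fix F assume F: "finite F" "F \<subseteq> inst \<sigma> ` q"
    then obtain F' where F': "finite F'" "F' \<subseteq> q" "F = inst \<sigma> ` F'"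
      by (meson finite_subset_image)
    then obtain c where c: "realizes M c F'" using complete_type_finite[OF q] by blast
    have "realizes M (\<sigma> \<circ> c) F"
      unfolding realizes_def
    proof
      fix \<phi> assume "\<phi> \<in> F"
      then obtain \<phi>' where "\<phi>' \<in> F'" "\<phi> = inst \<sigma> \<phi>'" using F'(3) by blast
      then show "holds M (\<sigma> \<circ> c) \<phi>"
        using c holds_aut[OF \<sigma> complete_type_formulas[OF q, of \<phi>'], of c] F'(2)
        unfolding realizes_def by auto
    qed
    then show "\<exists>c. realizes M c F" by blast
  qed
qed

lemma models_inst:
  assumes \<sigma>: "\<sigma> \<in> Aut M" and m: "models M q c I D"
  shows "models M (inst \<sigma> ` q) (\<sigma> \<circ> c) I (\<sigma> ` D)"
  unfolding models_def
proof
  fix \<phi> assume \<phi>: "\<phi> \<in> formulas M (I <+> \<sigma> ` D)"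
  let ?\<phi> = "inst (inv \<sigma>) \<phi>"
  have f: "?\<phi> \<in> formulas M (I <+> D)" using \<phi> by (rule inst_formulas) (use \<sigma> in auto)
  have "holds M (\<sigma> \<circ> c) \<phi> \<longleftrightarrow> holds M c ?\<phi>"
    using holds_aut[OF \<sigma> f, of c] by (simp add: inst_inv(2)[OF \<sigma>])
  then show "holds M (\<sigma> \<circ> c) \<phi> \<longleftrightarrow> \<phi> \<in> inst \<sigma> ` q"
    unfolding in_inst_image[OF \<sigma>] using modelsD[OF m f] by simp
qed

section \<open>Invariant types and Morley sequences\<close>

locale based = monster \<kappa> M for \<kappa> :: "'k rel" and M :: "('f, 'r, 'a) struct" +
  fixes A :: "'a set"
  assumes A: "small \<kappa> A"
begin

text \<open>For small \<open>P\<close>, strong homogeneity makes every tuple with the type over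
  \<open>A\<close> of \<open>P\<close> enumerated by itself the restriction to \<open>P\<close> of
  an element of this group.\<close>

definition G :: "('a \<Rightarrow> 'a) set" where
  "G = {\<sigma> \<in> Aut M. \<forall>x \<in> A. \<sigma> x = x}"

abbreviation L :: "('a \<Rightarrow> 'a) set" where "L \<equiv> AutfL \<kappa> M A"

lemma G_Aut: "\<sigma> \<in> G \<Longrightarrow> \<sigma> \<in> Aut M" unfolding G_def by simp

lemma G_fix: "\<sigma> \<in> G \<Longrightarrow> x \<in> A \<Longrightarrow> \<sigma> x = x" unfolding G_def by simp

lemma GI: "\<sigma> \<in> Aut M \<Longrightarrow> (\<And>x. x \<in> A \<Longrightarrow> \<sigma> x = x) \<Longrightarrow> \<sigma> \<in> G" unfolding G_def by simp

lemma G_id: "id \<in> G" by (simp add: GI Aut_id)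

lemma G_comp: "\<sigma> \<in> G \<Longrightarrow> \<tau> \<in> G \<Longrightarrow> \<sigma> \<circ> \<tau> \<in> G"
  by (rule GI) (simp_all add: G_fix G_Aut Aut_comp)

lemma G_inv: "\<sigma> \<in> G \<Longrightarrow> inv \<sigma> \<in> G"
  by (rule GI) (simp_all add: G_Aut Aut_inv, metis Aut_inv_f G_Aut G_fix)

lemma L_G: "\<sigma> \<in> L \<Longrightarrow> \<sigma> \<in> G"
proof (induction rule: AutfL.induct)
  case (generator \<sigma> N) then show ?case by (intro GI) auto
qed (simp_all only: G_id G_comp G_inv)

lemma L_fix: "\<sigma> \<in> Aut M \<Longrightarrow> elem_substructure M N \<Longrightarrow> small \<kappa> N \<Longrightarrow> A \<subseteq> N \<Longrightarrow>
    (\<And>x. x \<in> N \<Longrightarrow> \<sigma> x = x) \<Longrightarrow> \<sigma> \<in> L"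
  by (rule AutfL.generator) auto

lemma submodel_conj:
  assumes "g \<in> G" "elem_substructure M N" "small \<kappa> N" "A \<subseteq> N"
  shows "elem_substructure M (g ` N)" "small \<kappa> (g ` N)" "A \<subseteq> g ` N"
proof -
  show "A \<subseteq> g ` N" using assms(4) G_fix[OF assms(1)] by force
qed (use assms in \<open>auto intro: elem_substructure_image G_Aut small_image\<close>)

lemma inv_comp: "\<sigma> \<in> Aut M \<Longrightarrow> \<tau> \<in> Aut M \<Longrightarrow> inv (\<sigma> \<circ> \<tau>) = inv \<tau> \<circ> inv \<sigma>"
  by (rule o_inv_distrib) (auto dest: Aut_bij)

text \<open>Conjugation by \<open>g\<close> turns a generator fixing \<open>N\<close> into one
  fixing the image of \<open>N\<close>, again a small elementary submodel containing
  \<open>A\<close>. Normality is what keeps conjugates of Lascar invariant types Lascar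
  invariant.\<close>

lemma L_normal:
  assumes g: "g \<in> G"
  shows "\<sigma> \<in> L \<Longrightarrow> g \<circ> \<sigma> \<circ> inv g \<in> L"
proof (induction rule: AutfL.induct)
  case (generator \<sigma> N)
  show ?case
  proof (rule L_fix[of _ "g ` N"])
    show "g \<circ> \<sigma> \<circ> inv g \<in> Aut M" using G_Aut[OF g] generator(1) by (intro Aut_comp Aut_inv)
    show "(g \<circ> \<sigma> \<circ> inv g) x = x" if "x \<in> g ` N" for x
      using that generator Aut_inv_f[OF G_Aut[OF g]] by auto
  qed (use submodel_conj[OF g] generator in auto)
next
  case identity
  then show ?case using Aut_comp_inv(1)[OF G_Aut[OF g]] AutfL.identity by (simp add: comp_def id_def)
next
  case (composition \<sigma> \<tau>)
  have "g \<circ> (\<sigma> \<circ> \<tau>) \<circ> inv g = (g \<circ> \<sigma> \<circ> inv g) \<circ> (g \<circ> \<tau> \<circ> inv g)"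
    using Aut_inv_f[OF G_Aut[OF g]] by (auto simp: fun_eq_iff)
  then show ?case using AutfL.composition composition.IH by metis
next
  case (inverse \<sigma>)
  have b: "bij \<sigma>" "bij g" "bij (inv g)"
    using Aut_bij[OF G_Aut[OF L_G[OF inverse.hyps]]] Aut_bij[OF G_Aut[OF g]] bij_imp_bij_inv by auto
  then have "g \<circ> inv \<sigma> \<circ> inv g = inv (g \<circ> \<sigma> \<circ> inv g)"
    by (simp add: o_inv_distrib bij_comp inv_inv_eq comp_assoc)
  then show ?case using AutfL.inverse[OF inverse.IH] by metis
qed

section \<open>Global types invariant under Lascar strong automorphisms\<close>

definition Inv :: "'i set \<Rightarrow> ('f, 'r, 'i + 'a) fm set \<Rightarrow> bool" where
  "Inv I q \<longleftrightarrow> complete_type M I UNIV q \<and> AutfL_invariant \<kappa> M A q"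

lemma Inv_complete: "Inv I q \<Longrightarrow> complete_type M I UNIV q" unfolding Inv_def by simp

lemma Inv_image: "Inv I q \<Longrightarrow> \<sigma> \<in> L \<Longrightarrow> inst \<sigma> ` q = q"
  unfolding Inv_def AutfL_invariant_def by simp

lemma InvD: "Inv I q \<Longrightarrow> \<sigma> \<in> L \<Longrightarrow> inst \<sigma> \<phi> \<in> q \<longleftrightarrow> \<phi> \<in> q"
  using Inv_image[of I q \<sigma>] in_inst_image[OF G_Aut[OF L_G], of \<sigma> "inst \<sigma> \<phi>" q]
    inst_inv(1)[OF G_Aut[OF L_G], of \<sigma> \<phi>] by auto

text \<open>Preservation in one direction suffices because \<open>L\<close> is closed under
  inverses.\<close>

lemma InvI:
  assumes "complete_type M I UNIV q" "\<And>\<sigma> \<phi>. \<sigma> \<in> L \<Longrightarrow> \<phi> \<in> q \<Longrightarrow> inst \<sigma> \<phi> \<in> q"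
  shows "Inv I q"
  unfolding Inv_def AutfL_invariant_def
proof (intro conjI ballI set_eqI assms(1))
  fix \<sigma> \<phi> assume \<sigma>: "\<sigma> \<in> L"
  show "\<phi> \<in> inst \<sigma> ` q \<longleftrightarrow> \<phi> \<in> q"
    unfolding in_inst_image[OF G_Aut[OF L_G[OF \<sigma>]]]
    using assms(2)[OF \<sigma>, of "inst (inv \<sigma>) \<phi>"] assms(2)[OF AutfL.inverse[OF \<sigma>], of \<phi>]
      inst_inv(2)[OF G_Aut[OF L_G[OF \<sigma>]], of \<phi>] by auto
qed

lemma Inv_conj:
  assumes g: "g \<in> G" and q: "Inv I q"
  shows "Inv I (inst g ` q)"
proof (rule InvI)
  show "complete_type M I UNIV (inst g ` q)" using complete_inst[OF G_Aut[OF g] Inv_complete[OF q]] .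
  fix \<sigma> \<phi> assume \<sigma>: "\<sigma> \<in> L" and \<phi>: "\<phi> \<in> inst g ` q"
  have "inv g \<circ> \<sigma> \<circ> g \<in> L"
    using L_normal[OF G_inv[OF g] \<sigma>] inv_inv_eq[OF Aut_bij[OF G_Aut[OF g]]] by simp
  then have "inst (inv g \<circ> \<sigma> \<circ> g) (inst (inv g) \<phi>) \<in> q"
    using InvD[OF q] \<phi> unfolding in_inst_image[OF G_Aut[OF g]] by blast
  moreover have "(inv g \<circ> \<sigma> \<circ> g) \<circ> inv g = inv g \<circ> \<sigma>"
    using Aut_f_inv[OF G_Aut[OF g]] by (auto simp: fun_eq_iff)
  ultimately show "inst \<sigma> \<phi> \<in> inst g ` q"
    unfolding in_inst_image[OF G_Aut[OF g]] by (simp add: inst_comp)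
qed

lemma Inv_reindex:
  assumes q: "Inv J q" and f: "f ` I \<subseteq> J"
  shows "Inv I (reindex M f I q)"
proof (rule InvI[OF complete_reindex[OF Inv_complete[OF q] f]])
  fix \<sigma> \<phi> assume \<sigma>: "\<sigma> \<in> L" and \<phi>: "\<phi> \<in> reindex M f I q"
  have "inst \<sigma> \<phi> \<in> formulas M (I <+> UNIV)"
    using \<phi> unfolding reindex_def by (auto intro: inst_formulas)
  moreover have "map_fm (map_sum f id) (inst \<sigma> \<phi>) = inst \<sigma> (map_fm (map_sum f id) \<phi>)"
    unfolding inst_def by (simp add: fm.map_comp map_sum.comp)
  ultimately show "inst \<sigma> \<phi> \<in> reindex M f I q"
    using \<phi> InvD[OF q \<sigma>] unfolding reindex_def by simp
qed

section \<open>Morley sequences over a small model\<close>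

lemma realize_in_G:
  assumes q: "complete_type M I UNIV q" "models M q id P A" "I = P" and P: "small \<kappa> P" and D: "small \<kappa> D"
  obtains g where "g \<in> G" "models M q g P (A \<union> D)"
proof -
  obtain c where c: "models M q c P (A \<union> D)"
    using models_exists[OF q(1), of "A \<union> D"] P D A q(3) small_Un by metis
  have "tp M id P A = tp M c P A"
    using models_tp_eq[OF q(2)] models_mono[OF c subset_refl, of A] by simp
  then obtain \<sigma> where \<sigma>: "\<sigma> \<in> Aut M" "\<And>x. x \<in> A \<Longrightarrow> \<sigma> x = x" "\<And>i. i \<in> P \<Longrightarrow> \<sigma> (id i) = c i"
    using homogeneous[OF P A] by blast
  have "models M q \<sigma> P (A \<union> D)"
    using c models_cong[of P \<sigma> c M q "A \<union> D"] \<sigma>(3) by simp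
  then show ?thesis using that GI[OF \<sigma>(1,2)] by blast
qed

text \<open>Initial segments of Morley sequences of \<open>q\<close> over \<open>N\<close>. Finite
  lengths are enough, as each inconsistency below involves finitely many entries.\<close>

definition morley :: "('f, 'r, 'a + 'a) fm set \<Rightarrow> 'a set \<Rightarrow> 'a set \<Rightarrow> (nat \<Rightarrow> 'a \<Rightarrow> 'a) \<Rightarrow> nat \<Rightarrow> bool" where
  "morley q P N gs m \<longleftrightarrow> (\<forall>j<m. gs j \<in> G \<and> models M q (gs j) P (N \<union> (\<Union>i<j. gs i ` P)))"

text \<open>An automorphism \<open>\<sigma>\<close> fixing the model \<open>N\<close> is Lascar
  strong and so fixes \<open>q\<close>. If it matches the first \<open>m\<close> entries, then
  \<open>\<sigma> \<circ> gs m\<close> and \<open>hs m\<close> both realize \<open>q\<close> over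
  \<open>N\<close> and the entries \<open>hs i\<close> with \<open>i < m\<close>, and one further
  automorphism over these corrects the last entry.\<close>

lemma morley_unique:
  assumes N: "elem_substructure M N" "small \<kappa> N" "A \<subseteq> N" and q: "Inv P q" and P: "finite P"
  shows "morley q P N gs m \<Longrightarrow> morley q P N hs m \<Longrightarrow>
    \<exists>\<sigma>\<in>Aut M. (\<forall>x\<in>N. \<sigma> x = x) \<and> (\<forall>j<m. \<forall>p\<in>P. \<sigma> (gs j p) = hs j p)"
proof (induction m)
  case 0
  then show ?case by (intro bexI[OF _ Aut_id]) simp
next
  case (Suc m)
  have "morley q P N gs m" "morley q P N hs m" using Suc.prems unfolding morley_def by auto
  then obtain \<sigma> where \<sigma>: "\<sigma> \<in> Aut M" "\<forall>x\<in>N. \<sigma> x = x" "\<forall>j<m. \<forall>p\<in>P. \<sigma> (gs j p) = hs j p"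
    using Suc.IH by blast
  define D where "D = N \<union> (\<Union>i<m. gs i ` P)"
  define D' where "D' = N \<union> (\<Union>i<m. hs i ` P)"
  have "\<sigma> \<in> L" using L_fix[OF \<sigma>(1) N] \<sigma>(2) by blast
  then have sq: "inst \<sigma> ` q = q" by (rule Inv_image[OF q])
  have "\<sigma> ` D = \<sigma> ` N \<union> (\<Union>i<m. \<sigma> ` gs i ` P)" unfolding D_def by blast
  also have "\<sigma> ` N = N" using \<sigma>(2) by force
  also have "(\<Union>i<m. \<sigma> ` gs i ` P) = (\<Union>i<m. hs i ` P)"
  proof (rule SUP_cong)
    fix i assume "i \<in> {..<m}"
    then show "\<sigma> ` gs i ` P = hs i ` P" using \<sigma>(3) by (force simp: image_image)
  qed simp
  finally have sD: "\<sigma> ` D = D'" unfolding D'_def .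
  have "models M q (gs m) P D" using Suc.prems(1) unfolding morley_def D_def by auto
  from models_inst[OF \<sigma>(1) this] have "models M q (\<sigma> \<circ> gs m) P D'" using sq sD by simp
  moreover have "models M q (hs m) P D'" using Suc.prems(2) unfolding morley_def D'_def by auto
  ultimately have "tp M (\<sigma> \<circ> gs m) P D' = tp M (hs m) P D'" by (rule models_tp_eq)
  moreover have "small \<kappa> D'" unfolding D'_def using N(2) P by (intro small_Un) (simp_all add: small_finite)
  ultimately obtain \<tau> where \<tau>: "\<tau> \<in> Aut M" "\<And>x. x \<in> D' \<Longrightarrow> \<tau> x = x"
    "\<And>p. p \<in> P \<Longrightarrow> \<tau> ((\<sigma> \<circ> gs m) p) = hs m p"
    using homogeneous[of P D'] small_finite[OF P] by blast
  have "\<tau> (\<sigma> (gs j p)) = hs j p" if "j < Suc m" "p \<in> P" for j p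
  proof (cases "j = m")
    case True then show ?thesis using \<tau>(3) that by simp
  next
    case False
    then have "j < m" using that by simp
    then have "\<sigma> (gs j p) = hs j p" "hs j p \<in> D'" using \<sigma>(3) that unfolding D'_def by auto
    then show ?thesis using \<tau>(2) by simp
  qed
  moreover have "\<tau> (\<sigma> x) = x" if "x \<in> N" for x using \<sigma>(2) \<tau>(2) that unfolding D'_def by simp
  ultimately show ?case using Aut_comp[OF \<tau>(1) \<sigma>(1)] by (intro bexI[of _ "\<tau> \<circ> \<sigma>"]) auto
qed

lemma morley_exists:
  assumes N: "small \<kappa> N" "A \<subseteq> N" and q: "Inv P q" "models M q id P A" and P: "finite P"
  obtains gs where "\<And>m. morley q P N gs m"
proof -
  let ?Q = "\<lambda>(gs :: nat \<Rightarrow> 'a \<Rightarrow> 'a) j g. g \<in> G \<and> models M q g P (N \<union> (\<Union>i<j. gs i ` P))"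
  have "\<exists>gs. \<forall>j. ?Q gs j (gs j)"
  proof (rule dependent_wellorder_choice)
    fix r and f g :: "nat \<Rightarrow> 'a \<Rightarrow> 'a" and x :: nat assume "\<And>y. y < x \<Longrightarrow> f y = g y"
    then have "(\<Union>i<x. f i ` P) = (\<Union>i<x. g i ` P)" by auto
    then show "?Q f x r = ?Q g x r" by simp
  next
    fix j and gs :: "nat \<Rightarrow> 'a \<Rightarrow> 'a"
    have "small \<kappa> (N \<union> (\<Union>i<j. gs i ` P))" using N(1) P by (intro small_Un) (simp_all add: small_finite)
    then obtain g where "g \<in> G" "models M q g P (A \<union> (N \<union> (\<Union>i<j. gs i ` P)))"
      using realize_in_G[OF Inv_complete[OF q(1)] q(2) refl small_finite[OF P]] by blast
    then show "\<exists>r. ?Q gs j r" using models_mono[of M q g P _ P "N \<union> (\<Union>i<j. gs i ` P)"] by blast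
  qed
  then obtain gs where "\<forall>j. ?Q gs j (gs j)" ..
  then have "morley q P N gs m" for m unfolding morley_def by simp
  then show ?thesis by (rule that)
qed

lemma morley_subseq:
  assumes "morley q P N gs m" "\<And>i j. i < j \<Longrightarrow> j < n \<Longrightarrow> e i < (e j :: nat)" "\<And>j. j < n \<Longrightarrow> e j < m"
  shows "morley q P N (gs \<circ> e) n"
  unfolding morley_def
proof (intro allI impI)
  fix j assume j: "j < n"
  have "gs (e i) ` P \<subseteq> (\<Union>i<e j. gs i ` P)" if "i < j" for i using assms(2)[OF that j] by blast
  then have sub: "N \<union> (\<Union>i<j. (gs \<circ> e) i ` P) \<subseteq> N \<union> (\<Union>i<e j. gs i ` P)" by auto
  have "gs (e j) \<in> G" "models M q (gs (e j)) P (N \<union> (\<Union>i<e j. gs i ` P))"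
    using assms(1) assms(3)[OF j] unfolding morley_def by simp_all
  then show "(gs \<circ> e) j \<in> G \<and> models M q ((gs \<circ> e) j) P (N \<union> (\<Union>i<j. (gs \<circ> e) i ` P))"
    using models_mono[OF _ subset_refl sub] by simp
qed

end

section \<open>Arrays in NTP2 theories\<close>

lemma k_inconsistent_iff:
  "k_inconsistent M k \<Phi> \<longleftrightarrow>
    (\<forall>J. finite J \<longrightarrow> card J = k \<longrightarrow> \<not> (\<exists>y. \<forall>l\<in>J. holds M y (\<Phi> l)))"
  unfolding k_inconsistent_def by (simp add: consistent_finite realizes_def)

text \<open>Quantifying the variables of \<open>\<psi>\<close> existentially makes the lack of a
  common solution part of the type of the parameter array, so that it can be carried through
  compactness and realization of types. The label \<open>(l, p)\<close> is the copy of the parameter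
  \<open>p\<close> at index \<open>l\<close>.\<close>

lemma inconsistency_formula:
  fixes \<psi> :: "('f, 'r, 'i + 'a) fm" and H :: "nat set"
  assumes \<psi>: "\<psi> \<in> formulas M V" and H: "finite H"
  obtains \<nu> where "\<nu> \<in> formulas M (H \<times> params \<psi>)"
    "\<And>v. sat M UNIV v [] \<nu> \<longleftrightarrow> \<not> (\<exists>y. \<forall>l\<in>H. holds M y (inst (\<lambda>p. v (l, p)) \<psi>))"
proof -
  obtain ls where ls: "set ls = H" using finite_list[OF H] by metis
  have "finite {i. Inl i \<in> frees \<psi>}"
  proof -
    have "{i. Inl i \<in> frees \<psi>} = Inl -` frees \<psi>" by auto
    then show ?thesis by (simp add: finite_frees finite_vimageI)
  qed
  then obtain ws where ws: "set ws = {i. Inl i \<in> frees \<psi>}" using finite_list by metis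
  define at where "at l = map_fm (map_sum id (Pair l)) \<psi>" for l :: nat
  define \<Phi> where "\<Phi> = conjs (map at ls)"
  define \<Xi> where "\<Xi> = foldr exq (map Inl ws) \<Phi>"
  \<comment> \<open>All labels \<open>Inl i\<close> have been quantified away in
    \<open>\<Xi>\<close>, so the value \<open>undefined\<close> is never reached.\<close>
  define \<nu> where "\<nu> = map_fm (case_sum undefined id) (Neg \<Xi>)"
  have at_frees: "frees (at l) \<subseteq> Inl ` set ws \<union> Inr ` ({l} \<times> params \<psi>)" for l
  proof
    fix x assume "x \<in> frees (at l)"
    then obtain z where z: "z \<in> frees \<psi>" "x = map_sum id (Pair l) z"
      unfolding at_def fm.set_map by blast
    show "x \<in> Inl ` set ws \<union> Inr ` ({l} \<times> params \<psi>)"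
    proof (cases z)
      case (Inl i)
      then show ?thesis using z unfolding ws by simp
    next
      case (Inr b)
      then show ?thesis using z unfolding params_def by simp
    qed
  qed
  have at_wf: "wf_fm M 0 (at l)" for l
    using \<psi> unfolding at_def formulas_def by (simp add: wf_map_fm)
  have "\<Phi> \<in> formulas M (Inl ` set ws \<union> Inr ` (H \<times> params \<psi>))"
  proof -
    have "at l \<in> formulas M (Inl ` set ws \<union> Inr ` (H \<times> params \<psi>))" if "l \<in> H" for l
      using at_frees[of l] at_wf that unfolding formulas_def by auto
    then show ?thesis unfolding \<Phi>_def by (auto simp: ls)
  qed
  then have \<Phi>: "wf_fm M 0 \<Phi>" "frees \<Phi> \<subseteq> Inl ` set ws \<union> Inr ` (H \<times> params \<psi>)"
    unfolding formulas_def by auto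
  have \<Xi>: "wf_fm M 0 \<Xi>" "frees \<Xi> \<subseteq> Inr ` (H \<times> params \<psi>)"
    using exqs(1,2)[OF \<Phi>(1), of "map Inl ws"] \<Phi>(2) unfolding \<Xi>_def by auto
  have "\<nu> \<in> formulas M (H \<times> params \<psi>)"
    unfolding \<nu>_def
  proof (rule formulas_map'[of _ _ "Inr ` (H \<times> params \<psi>)"])
    show "Neg \<Xi> \<in> formulas M (Inr ` (H \<times> params \<psi>))" using \<Xi> unfolding formulas_def by simp
    show "case_sum undefined id ` frees (Neg \<Xi>) \<subseteq> H \<times> params \<psi>" using \<Xi>(2) by auto
  qed
  moreover have "sat M UNIV v [] \<nu> \<longleftrightarrow> \<not> (\<exists>y. \<forall>l\<in>H. holds M y (inst (\<lambda>p. v (l, p)) \<psi>))" for v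
  proof -
    have atv: "sat M UNIV u [] (at l) \<longleftrightarrow> holds M y (inst (\<lambda>p. v (l, p)) \<psi>)"
      if "\<And>i. i \<in> set ws \<Longrightarrow> u (Inl i) = y i" "\<And>z. u (Inr z) = v z" for u y l
      unfolding at_def sat_map holds_inst
    proof (rule sat_cong)
      fix z assume "z \<in> frees \<psi>"
      then show "(u \<circ> map_sum id (Pair l)) z = case_sum y (\<lambda>p. v (l, p)) z"
        using that unfolding ws by (cases z rule: sum.exhaust) simp_all
    qed
    let ?v = "v \<circ> case_sum undefined id"
    have "sat M UNIV ?v [] \<Xi> \<longleftrightarrow> (\<exists>y. \<forall>l\<in>H. holds M y (inst (\<lambda>p. v (l, p)) \<psi>))"
      unfolding \<Xi>_def exqs(3)[OF \<Phi>(1)]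
    proof
      assume "\<exists>u. (\<forall>x. x \<notin> set (map Inl ws) \<longrightarrow> u x = ?v x) \<and> sat M UNIV u [] \<Phi>"
      then obtain u where u: "\<forall>x. x \<notin> set (map Inl ws) \<longrightarrow> u x = ?v x" "sat M UNIV u [] \<Phi>" by blast
      have "u (Inr z) = v z" for z using u(1) by auto
      then have "\<forall>l\<in>H. holds M (u \<circ> Inl) (inst (\<lambda>p. v (l, p)) \<psi>)"
        using u(2) atv[of u "u \<circ> Inl"] unfolding \<Phi>_def by (simp add: ls)
      then show "\<exists>y. \<forall>l\<in>H. holds M y (inst (\<lambda>p. v (l, p)) \<psi>)" by blast
    next
      assume "\<exists>y. \<forall>l\<in>H. holds M y (inst (\<lambda>p. v (l, p)) \<psi>)"
      then obtain y where y: "\<forall>l\<in>H. holds M y (inst (\<lambda>p. v (l, p)) \<psi>)" ..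
      define u where "u x = (if x \<in> Inl ` set ws then y (projl x) else ?v x)" for x
      have u: "\<And>i. i \<in> set ws \<Longrightarrow> u (Inl i) = y i" "\<And>z. u (Inr z) = v z"
        unfolding u_def by auto
      have "sat M UNIV u [] (at l)" if "l \<in> H" for l
        using atv[of u y l, OF u] y that by blast
      then have "sat M UNIV u [] \<Phi>" unfolding \<Phi>_def by (simp add: ls)
      then show "\<exists>u. (\<forall>x. x \<notin> set (map Inl ws) \<longrightarrow> u x = ?v x) \<and> sat M UNIV u [] \<Phi>"
        by (intro exI[of _ u]) (auto simp: u_def)
    qed
    then show ?thesis unfolding \<nu>_def sat_map by simp
  qed
  ultimately show ?thesis using that by blast
qed

text \<open>\<open>TP2_formula\<close> is stated for labels that are numbers and for infinite paths.
  Only finitely many labels occur in \<open>\<psi>\<close>, so they can be numbered; and if every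
  finite initial part of every path had a solution, all infinite paths would be consistent, as
  \<open>consistent\<close> only tests finite subsets.\<close>

lemma NTP2_path:
  fixes \<psi> :: "('f, 'r, 'i + 'a) fm" and h :: "nat \<Rightarrow> nat \<Rightarrow> 'a \<Rightarrow> 'a"
  assumes ntp2: "NTP2 M" and \<psi>: "\<psi> \<in> formulas M V"
    and rows: "\<And>i. k_inconsistent M k (\<lambda>l. inst (h i l) \<psi>)"
  obtains \<eta> m where "\<not> (\<exists>y. \<forall>j<m. holds M y (inst (h j (\<eta> j)) \<psi>))"
proof (rule ccontr)
  assume "\<not> thesis"
  have path: "\<exists>y. \<forall>j<m. holds M y (inst (h j (\<eta> j)) \<psi>)" for \<eta> and m :: nat
  proof (rule ccontr)
    assume "\<not> (\<exists>y. \<forall>j<m. holds M y (inst (h j (\<eta> j)) \<psi>))"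
    then have thesis by (rule that)
    with \<open>\<not> thesis\<close> show False ..
  qed
  define W where "W = {i. Inl i \<in> frees \<psi>}"
  have "W = Inl -` frees \<psi>" unfolding W_def by auto
  then have "finite W" by (simp add: finite_frees finite_vimageI)
  then obtain e1 :: "'i \<Rightarrow> nat" where e1: "inj_on e1 W" using finite_imp_inj_to_nat_seg by metis
  obtain e2 :: "'a \<Rightarrow> nat" where e2: "inj_on e2 (params \<psi>)"
    using finite_imp_inj_to_nat_seg[OF finite_params] by metis
  define \<phi> where "\<phi> = map_fm (map_sum e1 e2) \<psi>"
  define a where "a i j n = h i j (inv_into (params \<psi>) e2 n)" for i j n
  have eq: "holds M x (inst (a i j) \<phi>) \<longleftrightarrow> holds M y (inst (h i j) \<psi>)"
    if "\<And>w. w \<in> W \<Longrightarrow> x (e1 w) = y w" for x y i j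
    unfolding holds_inst \<phi>_def sat_map
  proof (rule sat_cong)
    fix z assume "z \<in> frees \<psi>"
    then have "\<And>w. z = Inl w \<Longrightarrow> w \<in> W" "\<And>b. z = Inr b \<Longrightarrow> inv_into (params \<psi>) e2 (e2 b) = b"
      unfolding W_def using inv_into_f_f[OF e2] unfolding params_def by blast+
    then show "(case_sum x (a i j) \<circ> map_sum e1 e2) z = case_sum y (h i j) z"
      using that unfolding a_def by (cases z rule: sum.exhaust) simp_all
  qed
  have "\<phi> \<in> formulas M UNIV"
    unfolding \<phi>_def by (rule formulas_map[OF \<psi>]) simp
  moreover have "TP2_formula M \<phi>"
    unfolding TP2_formula_def
  proof (intro exI conjI allI)
    show "k_inconsistent M k (\<lambda>j. inst (a i j) \<phi>)" for i
      unfolding k_inconsistent_iff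
    proof (intro allI impI notI)
      fix J assume J: "finite J" "card J = k" and "\<exists>x. \<forall>l\<in>J. holds M x (inst (a i l) \<phi>)"
      then obtain x where x: "\<forall>l\<in>J. holds M x (inst (a i l) \<phi>)" by blast
      have "\<forall>l\<in>J. holds M (x \<circ> e1) (inst (h i l) \<psi>)" using x eq[of x "x \<circ> e1"] by simp
      then show False using rows[of i] J unfolding k_inconsistent_iff by blast
    qed
    fix \<eta> :: "nat \<Rightarrow> nat"
    show "consistent M (range (\<lambda>i. inst (a i (\<eta> i)) \<phi>))"
      unfolding consistent_def
    proof (intro allI impI)
      fix F assume F: "finite F" "F \<subseteq> range (\<lambda>i. inst (a i (\<eta> i)) \<phi>)"
      obtain C where C: "finite C" "F = (\<lambda>i. inst (a i (\<eta> i)) \<phi>) ` C"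
        using finite_subset_image[OF F] by blast
      \<comment> \<open>Inserting 0 provides a maximum also when \<open>C\<close> is empty.\<close>
      obtain y where y: "\<forall>j<Suc (Max (insert 0 C)). holds M y (inst (h j (\<eta> j)) \<psi>)" using path by blast
      define x where "x n = y (inv_into W e1 n)" for n
      have "holds M x (inst (a j (\<eta> j)) \<phi>)" if "j \<in> C" for j
      proof -
        have "j \<le> Max (insert 0 C)" using C(1) that by simp
        then have "j < Suc (Max (insert 0 C))" by simp
        then have "holds M y (inst (h j (\<eta> j)) \<psi>)" using y by blast
        moreover have "x (e1 w) = y w" if "w \<in> W" for w unfolding x_def using e1 that by simp
        ultimately show ?thesis using eq by blast
      qed
      then have "realizes M x F" unfolding C(2) realizes_def by blast
      then show "\<exists>c. realizes M c F" by (intro exI)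
    qed
  qed
  ultimately show False using ntp2 unfolding NTP2_def by blast
qed

section \<open>Types witnessing dividing, and inconsistency along their Morley sequences\<close>

context based
begin

text \<open>The set \<open>D\<close> will absorb the earlier rows of an array; \<open>k\<close> is
  fixed before \<open>D\<close> because the rows of a TP2 pattern share one bound of
  inconsistency.\<close>

definition witnesses_dividing :: "('f, 'r, 'i + 'a) fm \<Rightarrow> nat \<Rightarrow> ('f, 'r, 'a + 'a) fm set \<Rightarrow> 'a set \<Rightarrow> bool" where
  "witnesses_dividing \<psi> k q P \<longleftrightarrow> (\<forall>D. small \<kappa> D \<longrightarrow> A \<subseteq> D \<longrightarrow>
     (\<exists>h :: nat \<Rightarrow> 'a \<Rightarrow> 'a. (\<forall>l. h l \<in> G \<and> models M q (h l) P D) \<and>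
       k_inconsistent M k (\<lambda>l. inst (h l) \<psi>)))"

text \<open>Each row is chosen over \<open>N\<close> and all entries of all earlier rows, so
  whatever entries a path selects, it is a Morley sequence over \<open>N\<close>. NTP2 supplies one
  path with an inconsistent initial part, and its length serves for every other Morley sequence by
  \<open>morley_unique\<close>.\<close>

lemma morley_inconsistent:
  assumes ntp2: "NTP2 M" and \<psi>: "\<psi> \<in> formulas M V"
    and N: "elem_substructure M N" "small \<kappa> N" "A \<subseteq> N" and q: "Inv P q"
    and P: "finite P" "params \<psi> \<subseteq> P" and D: "witnesses_dividing \<psi> k q P"
  obtains m where "\<And>gs. morley q P N gs m \<Longrightarrow> \<not> (\<exists>y. \<forall>j<m. holds M y (inst (gs j) \<psi>))"
proof -
  let ?Q = "\<lambda>(R :: nat \<Rightarrow> nat \<Rightarrow> 'a \<Rightarrow> 'a) j h.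
    (\<forall>l. h l \<in> G \<and> models M q (h l) P (N \<union> (\<Union>l. \<Union>i<j. R i l ` P))) \<and>
    k_inconsistent M k (\<lambda>l. inst (h l) \<psi>)"
  have "\<exists>R. \<forall>j. ?Q R j (R j)"
  proof (rule dependent_wellorder_choice)
    fix r and f g :: "nat \<Rightarrow> nat \<Rightarrow> 'a \<Rightarrow> 'a" and x :: nat assume "\<And>y. y < x \<Longrightarrow> f y = g y"
    then have "(\<Union>l. \<Union>i<x. f i l ` P) = (\<Union>l. \<Union>i<x. g i l ` P)" by auto
    then show "?Q f x r = ?Q g x r" by simp
  next
    fix j and R :: "nat \<Rightarrow> nat \<Rightarrow> 'a \<Rightarrow> 'a"
    have "small \<kappa> (N \<union> (\<Union>l. \<Union>i<j. R i l ` P))"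
      using N(2) P(1) by (intro small_Un small_UN_nat) simp_all
    moreover have "A \<subseteq> N \<union> (\<Union>l. \<Union>i<j. R i l ` P)" using N(3) by blast
    ultimately show "\<exists>r. ?Q R j r" by (rule D[unfolded witnesses_dividing_def, rule_format])
  qed
  then obtain R where R: "\<forall>j. ?Q R j (R j)" ..
  have rows: "k_inconsistent M k (\<lambda>l. inst (R j l) \<psi>)" for j using R by simp
  obtain \<eta> m where no: "\<not> (\<exists>y. \<forall>j<m. holds M y (inst (R j (\<eta> j)) \<psi>))"
    using NTP2_path[OF ntp2 \<psi> rows] .
  have mor: "morley q P N (\<lambda>j. R j (\<eta> j)) m"
    unfolding morley_def
  proof (intro allI impI)
    fix j
    have m: "models M q (R j (\<eta> j)) P (N \<union> (\<Union>l. \<Union>i<j. R i l ` P))" and "R j (\<eta> j) \<in> G"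
      using R by simp_all
    moreover have sub: "N \<union> (\<Union>i<j. R i (\<eta> i) ` P) \<subseteq> N \<union> (\<Union>l. \<Union>i<j. R i l ` P)" by blast
    ultimately show "R j (\<eta> j) \<in> G \<and> models M q (R j (\<eta> j)) P (N \<union> (\<Union>i<j. R i (\<eta> i) ` P))"
      using models_mono[OF m subset_refl sub] by simp
  qed
  have "\<not> (\<exists>y. \<forall>j<m. holds M y (inst (gs j) \<psi>))" if gs: "morley q P N gs m" for gs
  proof
    assume "\<exists>y. \<forall>j<m. holds M y (inst (gs j) \<psi>)"
    then obtain y where y: "\<forall>j<m. holds M y (inst (gs j) \<psi>)" ..
    obtain \<sigma> where \<sigma>: "\<sigma> \<in> Aut M" "\<forall>j<m. \<forall>p\<in>P. \<sigma> (R j (\<eta> j) p) = gs j p"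
      using morley_unique[OF N q P(1) mor gs] by blast
    have "holds M (inv \<sigma> \<circ> y) (inst (R j (\<eta> j)) \<psi>)" if "j < m" for j
    proof -
      have "inst (gs j) \<psi> = inst (\<sigma> \<circ> R j (\<eta> j)) \<psi>"
        using \<sigma>(2) that P(2) by (intro inst_cong) auto
      then have e: "inst (gs j) \<psi> = inst \<sigma> (inst (R j (\<eta> j)) \<psi>)" by (simp add: inst_comp)
      have f: "inst (R j (\<eta> j)) \<psi> \<in> formulas M UNIV"
        unfolding inst_def by (rule formulas_map[OF \<psi>]) simp
      have "\<sigma> \<circ> (inv \<sigma> \<circ> y) = y" using \<sigma>(1) by (auto simp: fun_eq_iff)
      moreover have "holds M y (inst \<sigma> (inst (R j (\<eta> j)) \<psi>))" using y that e by metis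
      ultimately show ?thesis using holds_aut[OF \<sigma>(1) f, of "inv \<sigma> \<circ> y"] by metis
    qed
    then show False using no by blast
  qed
  then show ?thesis by (rule that)
qed

lemma models_in_G:
  assumes P: "small \<kappa> P" and q: "models M q id P A" "models M q c P D" "A \<subseteq> D"
  obtains g where "g \<in> G" "\<And>p. p \<in> P \<Longrightarrow> g p = c p"
proof -
  have "tp M id P A = tp M c P A"
    using models_tp_eq[OF q(1)] models_mono[OF q(2) subset_refl q(3)] by simp
  then obtain \<sigma> where "\<sigma> \<in> Aut M" "\<And>x. x \<in> A \<Longrightarrow> \<sigma> x = x" "\<And>i. i \<in> P \<Longrightarrow> \<sigma> (id i) = c i"
    using homogeneous[OF P A] by blast
  then show ?thesis using that[of \<sigma>] GI by simp
qed

lemma divides_in_G: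
  assumes "divides M A \<psi>"
  obtains k g where "\<And>l. g l \<in> G" "k_inconsistent M k (\<lambda>l. inst (g l) \<psi>)"
proof -
  obtain k f where f: "\<forall>i. tp M (f i) (params \<psi>) A = tp M id (params \<psi>) A"
    "k_inconsistent M k (\<lambda>i. inst (f i) \<psi>)" using assms unfolding divides_def by blast
  have "\<exists>g\<in>G. \<forall>p\<in>params \<psi>. g p = f i p" for i
  proof -
    have "tp M id (params \<psi>) A = tp M (f i) (params \<psi>) A" using f(1) by simp
    then obtain \<sigma> where "\<sigma> \<in> Aut M" "\<And>x. x \<in> A \<Longrightarrow> \<sigma> x = x" "\<And>p. p \<in> params \<psi> \<Longrightarrow> \<sigma> (id p) = f i p"
      using homogeneous[OF small_finite[OF finite_params] A] by blast
    then show ?thesis by (intro bexI[of _ \<sigma>] GI) auto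
  qed
  then obtain g where g: "\<And>i. g i \<in> G" "\<And>i. \<forall>p\<in>params \<psi>. g i p = f i p" by metis
  have "inst (g i) \<psi> = inst (f i) \<psi>" for i using g(2)[of i] by (intro inst_cong) blast
  then show ?thesis using that[of g k] g(1) f(2) by simp
qed

end

lemma complete_type_Imp:
  assumes p: "complete_type M I B p" and "\<phi> \<in> formulas M (I <+> B)" "\<psi> \<in> formulas M (I <+> B)"
  shows "Imp \<phi> \<psi> \<in> p \<longleftrightarrow> (\<phi> \<in> p \<longrightarrow> \<psi> \<in> p)"
proof
  show "Imp \<phi> \<psi> \<in> p \<Longrightarrow> \<phi> \<in> p \<longrightarrow> \<psi> \<in> p" using complete_type_mp[OF p] by blast
  assume i: "\<phi> \<in> p \<longrightarrow> \<psi> \<in> p"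
  show "Imp \<phi> \<psi> \<in> p"
  proof (cases "\<phi> \<in> p")
    case True
    then show ?thesis using i assms(2,3) by (intro complete_type_imp[OF p, of "{\<psi>}"]) (auto simp: realizes_def)
  next
    case False
    then have "Neg \<phi> \<in> p" using complete_type_Neg[OF p assms(2)] by simp
    then show ?thesis using assms(2,3) by (intro complete_type_imp[OF p, of "{Neg \<phi>}"]) (auto simp: realizes_def)
  qed
qed

section \<open>Types witnessing dividing over an extension base\<close>

locale extension_base = based \<kappa> M A
  for \<kappa> :: "'k rel" and M :: "('f, 'r, 'a) struct" and A :: "'a set" +
  assumes ntp2: "NTP2 M"
    and ext: "\<And>(a :: 'k \<Rightarrow> 'a) I. small \<kappa> I \<Longrightarrow>
      \<exists>q. global_invariant_extension \<kappa> M I (tp M a I A) A q"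
begin

text \<open>The assumption \<open>ext\<close> concerns families indexed by the type of
  \<open>\<kappa>\<close>. A small set of any type injects into \<open>Field \<kappa>\<close>, and
  the type obtained there is reindexed.\<close>

lemma Inv_exists:
  fixes a :: "'j \<Rightarrow> 'a"
  assumes I: "small \<kappa> I"
  obtains q where "Inv I q" "models M q a I A"
proof -
  have "|I| \<le>o \<kappa>" using I unfolding small_def by (rule ordLess_imp_ordLeq)
  moreover have "\<kappa> =o |Field \<kappa>|" using card_of_Field_ordIso[OF Cinf(1)] ordIso_symmetric by blast
  ultimately have "|I| \<le>o |Field \<kappa>|" using ordLeq_ordIso_trans by blast
  then obtain f :: "'j \<Rightarrow> 'k" where f: "inj_on f I"
    using card_of_ordLeq[of I "Field \<kappa>"] by blast
  define a' where "a' = a \<circ> inv_into I f"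
  obtain q where "global_invariant_extension \<kappa> M (f ` I) (tp M a' (f ` I) A) A q"
    using ext[OF small_image[OF I]] by blast
  then have q: "Inv (f ` I) q" "tp M a' (f ` I) A \<subseteq> q"
    unfolding global_invariant_extension_def Inv_def by auto
  have "models M q a' (f ` I) A" using tp_subset_models[OF Inv_complete[OF q(1)] q(2)] .
  then have "models M (reindex M f I q) (a' \<circ> f) I A" by (rule models_reindex) simp
  moreover have "models M (reindex M f I q) (a' \<circ> f) I A \<longleftrightarrow> models M (reindex M f I q) a I A"
    by (rule models_cong) (simp add: a'_def f)
  moreover have "Inv I (reindex M f I q)" using q(1) by (rule Inv_reindex) simp
  ultimately show ?thesis using that by blast
qed

text \<open>Passing to a subsequence on which finitely many formulas take constant values makes, by
  compactness, all entries of the dividing sequence have the same global type.\<close>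

lemma divides_witness_type:
  fixes \<psi> :: "('f, 'r, 'i + 'a) fm"
  assumes \<psi>: "\<psi> \<in> formulas M V" and div: "divides M A \<psi>" and P: "finite P" "params \<psi> \<subseteq> P"
  obtains q k where "Inv P q" "models M q id P A" "witnesses_dividing \<psi> k q P"
proof -
  obtain k g where g: "\<And>l. g l \<in> G" "k_inconsistent M k (\<lambda>l. inst (g l) \<psi>)"
    using divides_in_G[OF div] by metis
  define I where "I = (UNIV :: nat set) \<times> P"
  have sI: "small \<kappa> I" unfolding I_def using small_nat_Times[OF P(1)] .
  define a where "a = (\<lambda>(l, p). g l p)"
  obtain r where r: "Inv I r" "models M r a I A" using Inv_exists[OF sI] .
  have cr: "complete_type M I UNIV r" using Inv_complete[OF r(1)] .
  \<comment> \<open>\<open>sh h\<close> makes a formula speak about the subsequence with indices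
    \<open>h l\<close>, and \<open>at l\<close> below makes it speak about the \<open>l\<close>-th
    entry.\<close>
  define sh where "sh h \<phi> = map_fm (map_sum (map_prod h id) id) \<phi>"
    for h :: "nat \<Rightarrow> nat" and \<phi> :: "('f, 'r, (nat \<times> 'a) + 'a) fm"
  have sh_f: "\<phi> \<in> formulas M (I <+> B) \<Longrightarrow> sh h \<phi> \<in> formulas M (I <+> B)" for h \<phi> and B :: "'a set"
    unfolding sh_def by (erule reindex_formulas) (auto simp: I_def)
  define at where "at l \<phi> = map_fm (map_sum (Pair l) id) \<phi>"
    for l :: nat and \<phi> :: "('f, 'r, 'a + 'a) fm"
  have at_f: "\<theta> \<in> formulas M (P <+> B) \<Longrightarrow> at l \<theta> \<in> formulas M (I <+> B)" for l \<theta> and B :: "'a set"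
    unfolding at_def by (erule reindex_formulas) (auto simp: I_def)
  have sh_at: "sh h (at l \<theta>) = at (h l) \<theta>" for h l \<theta>
  proof -
    have "map_sum (map_prod h (id :: 'a \<Rightarrow> 'a)) id \<circ> map_sum (Pair l) id = map_sum (Pair (h l)) (id :: 'a \<Rightarrow> 'a)"
      by (auto simp: fun_eq_iff map_sum_def split: sum.splits)
    then show ?thesis unfolding sh_def at_def fm.map_comp by simp
  qed
  \<comment> \<open>The statements that \<open>r\<close> makes about all subsequences. Lascar
    invariance, the type of the entries over \<open>A\<close> and \<open>k\<close>-inconsistency are
    of this form, so a completion inherits them; \<open>\<Sigma>2\<close> adds that all entries have
    the same global type.\<close>
  define \<Sigma>1 where "\<Sigma>1 = {\<phi> \<in> formulas M (I <+> UNIV). \<forall>h. strict_mono h \<longrightarrow> sh h \<phi> \<in> r}"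
  define \<Sigma>2 where "\<Sigma>2 = {Imp (at l \<theta>) (at l' \<theta>) | l l' \<theta>. \<theta> \<in> formulas M (P <+> UNIV)}"
  have sub: "\<Sigma>1 \<union> \<Sigma>2 \<subseteq> formulas M (I <+> UNIV)"
    unfolding \<Sigma>1_def \<Sigma>2_def using at_f by auto
  have "consistent M (\<Sigma>1 \<union> \<Sigma>2)"
    unfolding consistent_def
  proof (intro allI impI)
    fix F assume F: "finite F" "F \<subseteq> \<Sigma>1 \<union> \<Sigma>2"
    have "\<forall>\<chi>\<in>F \<inter> \<Sigma>2. \<exists>\<theta>. \<theta> \<in> formulas M (P <+> UNIV) \<and> (\<exists>l l'. \<chi> = Imp (at l \<theta>) (at l' \<theta>))"
      unfolding \<Sigma>2_def by blast
    then obtain t where t: "\<forall>\<chi>\<in>F \<inter> \<Sigma>2. t \<chi> \<in> formulas M (P <+> UNIV) \<and>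
      (\<exists>l l'. \<chi> = Imp (at l (t \<chi>)) (at l' (t \<chi>)))" by metis
    define T where "T = t ` (F \<inter> \<Sigma>2)"
    have T: "finite T" unfolding T_def using F(1) by simp
    \<comment> \<open>Color \<open>l\<close> by the set of formulas in \<open>T\<close> that
      \<open>r\<close> asserts of its \<open>l\<close>-th entry. There are finitely many colors, so
      some infinite set of indices is monochromatic, and along it the implications from
      \<open>\<Sigma>2\<close> in \<open>F\<close> hold.\<close>
    have "finite ((\<lambda>l. {\<theta> \<in> T. at l \<theta> \<in> r}) ` UNIV)"
      by (rule finite_subset[of _ "Pow T"]) (use T in auto)
    then obtain l0 where l0: "infinite {l. {\<theta> \<in> T. at l \<theta> \<in> r} = {\<theta> \<in> T. at l0 \<theta> \<in> r}}"
      using pigeonhole_infinite[of "UNIV :: nat set" "\<lambda>l. {\<theta> \<in> T. at l \<theta> \<in> r}"] by auto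
    then obtain h :: "nat \<Rightarrow> nat" where h: "strict_mono h"
      "\<And>n. {\<theta> \<in> T. at (h n) \<theta> \<in> r} = {\<theta> \<in> T. at l0 \<theta> \<in> r}"
      using infinite_enumerate[OF l0] by auto
    have "sh h \<phi> \<in> r" if "\<phi> \<in> F" for \<phi>
    proof (cases "\<phi> \<in> \<Sigma>1")
      case True
      then show ?thesis using h(1) unfolding \<Sigma>1_def by blast
    next
      case False
      then have "\<phi> \<in> F \<inter> \<Sigma>2" using F(2) that by blast
      then obtain l l' where th: "t \<phi> \<in> T" "t \<phi> \<in> formulas M (P <+> UNIV)"
        "\<phi> = Imp (at l (t \<phi>)) (at l' (t \<phi>))" using t unfolding T_def by blast
      have "sh h \<phi> = Imp (at (h l) (t \<phi>)) (at (h l') (t \<phi>))"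
        by (subst th(3)) (simp add: sh_def flip: sh_at)
      moreover have "at (h l) (t \<phi>) \<in> r \<longleftrightarrow> at (h l') (t \<phi>) \<in> r"
        using h(2)[of l] h(2)[of l'] th(1) by blast
      ultimately show ?thesis using complete_type_Imp[OF cr at_f[OF th(2)] at_f[OF th(2)]] by simp
    qed
    then have "sh h ` F \<subseteq> r" by blast
    then obtain c where "realizes M c (sh h ` F)"
      using complete_type_finite[OF cr, of "sh h ` F"] F(1) by blast
    then have "realizes M (c \<circ> map_prod h id) F"
      unfolding realizes_def sh_def by (simp add: holds_reindex)
    then show "\<exists>c. realizes M c F" by (intro exI)
  qed
  then obtain r' where r': "\<Sigma>1 \<union> \<Sigma>2 \<subseteq> r'" "complete_type M I UNIV r'" using Lindenbaum[OF sub] by blast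
  have "Inv I r'"
  proof (rule InvI[OF r'(2)])
    fix \<sigma> \<phi> assume \<sigma>: "\<sigma> \<in> L" and \<phi>: "\<phi> \<in> r'"
    have f: "\<phi> \<in> formulas M (I <+> UNIV)" using complete_type_formulas[OF r'(2) \<phi>] .
    have f': "inst \<sigma> \<phi> \<in> formulas M (I <+> UNIV)" using f by (rule inst_formulas) simp
    \<comment> \<open>Shifting variables commutes with moving parameters, so this is the invariance
      of \<open>r\<close> applied to \<open>sh h \<phi>\<close>.\<close>
    have "sh h (Imp \<phi> (inst \<sigma> \<phi>)) \<in> r" for h
    proof -
      have "sh h (inst \<sigma> \<phi>) = inst \<sigma> (sh h \<phi>)"
        unfolding sh_def inst_def by (simp add: fm.map_comp map_sum.comp)
      then have "sh h (Imp \<phi> (inst \<sigma> \<phi>)) = Imp (sh h \<phi>) (inst \<sigma> (sh h \<phi>))"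
        unfolding sh_def by simp
      moreover have "inst \<sigma> (sh h \<phi>) \<in> formulas M (I <+> UNIV)"
        using sh_f[OF f] by (rule inst_formulas) simp
      ultimately show ?thesis
        using complete_type_Imp[OF cr sh_f[OF f]] InvD[OF r(1) \<sigma>] by simp
    qed
    then have "Imp \<phi> (inst \<sigma> \<phi>) \<in> \<Sigma>1" unfolding \<Sigma>1_def using f f' by simp
    then show "inst \<sigma> \<phi> \<in> r'" using r'(1) complete_type_mp[OF r'(2) _ \<phi>] by blast
  qed
  define q where "q = reindex M (Pair 0) P r'"
  have qI: "Inv P q" unfolding q_def using \<open>Inv I r'\<close> by (rule Inv_reindex) (auto simp: I_def)
  have q_at: "reindex M (Pair l) P r' = q" for l
  proof -
    have "at l \<theta> \<in> r' \<longleftrightarrow> at l' \<theta> \<in> r'" if "\<theta> \<in> formulas M (P <+> UNIV)" for \<theta> l l'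
    proof -
      have "Imp (at l \<theta>) (at l' \<theta>) \<in> r'" "Imp (at l' \<theta>) (at l \<theta>) \<in> r'"
        using that r'(1) unfolding \<Sigma>2_def by blast+
      then show ?thesis using complete_type_mp[OF r'(2)] by blast
    qed
    then show ?thesis unfolding q_def reindex_def at_def[symmetric] by blast
  qed
  have "tp M id P A \<subseteq> q"
  proof
    fix \<theta> :: "('f, 'r, 'a + 'a) fm" assume "\<theta> \<in> tp M id P A"
    then have \<theta>: "\<theta> \<in> formulas M (P <+> A)" "holds M id \<theta>" unfolding tp_def by auto
    have \<theta>': "\<theta> \<in> formulas M (P <+> UNIV)" using \<theta>(1) by (rule formulas_Plus_mono) auto
    have "at l \<theta> \<in> r" for l
    proof -
      have "holds M a (at l \<theta>) \<longleftrightarrow> holds M (a \<circ> Pair l) \<theta>" unfolding at_def by (rule holds_reindex)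
      also have "a \<circ> Pair l = g l \<circ> id" unfolding a_def by auto
      also have "holds M (g l \<circ> id) \<theta> \<longleftrightarrow> holds M id \<theta>"
        using tp_aut[OF G_Aut[OF g(1)], of A l id P] G_fix[OF g(1)] \<theta>(1) unfolding tp_eq_iff by blast
      finally show ?thesis using modelsD[OF r(2) at_f[OF \<theta>(1)]] \<theta>(2) by blast
    qed
    then have "at 0 \<theta> \<in> \<Sigma>1" unfolding \<Sigma>1_def using at_f[OF \<theta>'] by (simp add: sh_at)
    then show "\<theta> \<in> q" unfolding q_def reindex_def using \<theta>' r'(1) at_def by auto
  qed
  then have qA: "models M q id P A" using tp_subset_models[OF Inv_complete[OF qI]] by blast
  have "witnesses_dividing \<psi> k q P"
    unfolding witnesses_dividing_def
  proof (intro allI impI)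
    fix D assume D: "small \<kappa> D" "A \<subseteq> D"
    obtain c where c: "models M r' c I D" using models_exists[OF r'(2) sI D(1)] .
    have mod: "models M q (c \<circ> Pair l) P D" for l
      using models_reindex[OF c, of "Pair l" P] unfolding q_at I_def by auto
    have "\<exists>h\<in>G. \<forall>p\<in>P. h p = c (l, p)" for l
      using models_in_G[OF small_finite[OF P(1)] qA mod[of l] D(2)] by (metis comp_apply)
    then obtain h where h: "\<And>l. h l \<in> G" "\<And>l. \<forall>p\<in>P. h l p = c (l, p)" by metis
    have "models M q (h l) P D" for l
      using mod[of l] models_cong[of P "h l" "c \<circ> Pair l" M q D] h(2)[of l] by simp
    moreover have "k_inconsistent M k (\<lambda>l. inst (h l) \<psi>)"
      unfolding k_inconsistent_iff
    proof (intro allI impI)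
      fix J :: "nat set" assume J: "finite J" "card J = k"
      obtain \<nu> where \<nu>: "\<nu> \<in> formulas M (J \<times> params \<psi>)"
        "\<And>v. sat M UNIV v [] \<nu> \<longleftrightarrow> \<not> (\<exists>y. \<forall>l\<in>J. holds M y (inst (\<lambda>p. v (l, p)) \<psi>))"
        using inconsistency_formula[OF \<psi> J(1)] by metis
      define \<chi> :: "('f, 'r, (nat \<times> 'a) + 'a) fm" where "\<chi> = map_fm Inl \<nu>"
      have \<chi>f: "\<chi> \<in> formulas M (I <+> B)" for B :: "'a set"
        unfolding \<chi>_def by (rule formulas_map[OF \<nu>(1)]) (use P(2) in \<open>auto simp: I_def\<close>)
      have \<chi>h: "holds M b \<chi> \<longleftrightarrow> \<not> (\<exists>y. \<forall>l\<in>J. holds M y (inst (\<lambda>p. b (l, p)) \<psi>))" for b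
        unfolding \<chi>_def holds_map \<nu>(2) by simp
      \<comment> \<open>An increasing \<open>h\<close> sends \<open>J\<close> to another set of
        \<open>k\<close> indices, on which the original dividing sequence is inconsistent
        too.\<close>
      have "sh h \<chi> \<in> r" if "strict_mono h" for h
      proof -
        have "holds M a (sh h \<chi>) \<longleftrightarrow> holds M (a \<circ> map_prod h id) \<chi>"
          unfolding sh_def by (rule holds_reindex)
        moreover have "holds M (a \<circ> map_prod h id) \<chi>"
        proof -
          have "card (h ` J) = k" using J(2) that by (simp add: card_image strict_mono_imp_inj_on)
          then have "\<not> (\<exists>y. \<forall>l\<in>h ` J. holds M y (inst (g l) \<psi>))"
            using g(2) J(1) unfolding k_inconsistent_iff by blast
          then show ?thesis unfolding \<chi>h a_def by simp
        qed
        ultimately show ?thesis using modelsD[OF r(2) sh_f[OF \<chi>f]] by blast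
      qed
      then have "\<chi> \<in> r'" using \<chi>f r'(1) unfolding \<Sigma>1_def by blast
      then have "holds M c \<chi>" using modelsD[OF c \<chi>f] by blast
      moreover have "inst (\<lambda>p. c (l, p)) \<psi> = inst (h l) \<psi>" for l
        using h(2)[of l] P(2) by (intro inst_cong) auto
      ultimately show "\<not> (\<exists>y. \<forall>l\<in>J. holds M y (inst (h l) \<psi>))" unfolding \<chi>h by simp
    qed
    ultimately show "\<exists>h. (\<forall>l. h l \<in> G \<and> models M q (h l) P D) \<and> k_inconsistent M k (\<lambda>l. inst (h l) \<psi>)"
      using h(1) by blast
  qed
  then show ?thesis using that qI qA by blast
qed

end

section \<open>The broom lemma\<close>

lemma holds_inst_aut:
  assumes \<sigma>: "\<sigma> \<in> Aut M" and \<psi>: "\<psi> \<in> formulas M V"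
  shows "holds M (\<sigma> \<circ> c) (inst (\<sigma> \<circ> g) \<psi>) \<longleftrightarrow> holds M c (inst g \<psi>)"
proof -
  have "inst g \<psi> \<in> formulas M UNIV" unfolding inst_def by (rule formulas_map[OF \<psi>]) simp
  then show ?thesis using holds_aut[OF \<sigma>, of "inst g \<psi>" UNIV c] by (simp add: inst_comp)
qed

lemma holds_inst_aut':
  assumes \<sigma>: "\<sigma> \<in> Aut M" and \<psi>: "\<psi> \<in> formulas M V"
  shows "holds M c (inst (\<sigma> \<circ> g) \<psi>) \<longleftrightarrow> holds M (inv \<sigma> \<circ> c) (inst g \<psi>)"
proof -
  have "\<sigma> \<circ> (inv \<sigma> \<circ> c) = c" using \<sigma> by (auto simp: fun_eq_iff)
  then show ?thesis using holds_inst_aut[OF assms, of "inv \<sigma> \<circ> c" g] by metis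
qed

context based
begin

text \<open>A formula with solution set \<open>E\<close> quasi-divides over \<open>A\<close> if \<open>quasi_subset E {}\<close>.\<close>

definition quasi_subset :: "('i \<Rightarrow> 'a) set \<Rightarrow> ('i \<Rightarrow> 'a) set \<Rightarrow> bool" where
  "quasi_subset E X \<longleftrightarrow> (\<exists>T \<subseteq> G. finite T \<and> (\<forall>c. (\<forall>t\<in>T. t \<circ> c \<in> E) \<longrightarrow> c \<in> X))"

lemma quasi_subset_refl: "E \<subseteq> X \<Longrightarrow> quasi_subset E X"
  unfolding quasi_subset_def by (rule exI[of _ "{id}"]) (auto simp: G_id)

text \<open>The products of the two finite sets of automorphisms do the job.\<close>

lemma quasi_subset_trans:
  assumes "quasi_subset E F" "quasi_subset F X"
  shows "quasi_subset E X"
proof -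
  obtain T where T: "T \<subseteq> G" "finite T" "\<forall>c. (\<forall>t\<in>T. t \<circ> c \<in> E) \<longrightarrow> c \<in> F"
    using assms(1) unfolding quasi_subset_def by blast
  obtain T' where T': "T' \<subseteq> G" "finite T'" "\<forall>c. (\<forall>t\<in>T'. t \<circ> c \<in> F) \<longrightarrow> c \<in> X"
    using assms(2) unfolding quasi_subset_def by blast
  let ?T = "(\<lambda>(t, t'). t \<circ> t') ` (T \<times> T')"
  have "c \<in> X" if c: "\<forall>t\<in>?T. t \<circ> c \<in> E" for c
  proof -
    have "t' \<circ> c \<in> F" if "t' \<in> T'" for t'
    proof -
      have "t \<circ> (t' \<circ> c) \<in> E" if "t \<in> T" for t
      proof -
        have "t \<circ> t' \<in> ?T" using that \<open>t' \<in> T'\<close> by auto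
        then show ?thesis using c by (metis comp_assoc)
      qed
      then show ?thesis using T(3) by blast
    qed
    then show ?thesis using T'(3) by blast
  qed
  moreover have "?T \<subseteq> G" using T(1) T'(1) G_comp by auto
  moreover have "finite ?T" using T(2) T'(2) by simp
  ultimately show ?thesis unfolding quasi_subset_def by blast
qed

text \<open>The finite set found for the translated problem is conjugated by \<open>g\<close>. This
  lets a step of the broom induction be normalized so that its configuration starts at
  \<open>P\<close>.\<close>

lemma quasi_subset_conj:
  assumes g: "g \<in> G" and Q: "quasi_subset {c. g \<circ> c \<in> E} {c. g \<circ> c \<in> X}"
  shows "quasi_subset E X"
proof -
  obtain T where T: "T \<subseteq> G" "finite T" "\<forall>c. (\<forall>t\<in>T. g \<circ> (t \<circ> c) \<in> E) \<longrightarrow> g \<circ> c \<in> X"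
    using Q unfolding quasi_subset_def by auto
  let ?T = "(\<lambda>t. g \<circ> t \<circ> inv g) ` T"
  have "c \<in> X" if c: "\<forall>t\<in>?T. t \<circ> c \<in> E" for c
  proof -
    have "g \<circ> (t \<circ> (inv g \<circ> c)) \<in> E" if "t \<in> T" for t
    proof -
      have "(g \<circ> t \<circ> inv g) \<circ> c \<in> E" using c that by blast
      then show ?thesis by (simp add: comp_assoc)
    qed
    then have "g \<circ> (inv g \<circ> c) \<in> X" using T(3) by blast
    moreover have "g \<circ> (inv g \<circ> c) = c" using G_Aut[OF g] by (auto simp: fun_eq_iff)
    ultimately show ?thesis by metis
  qed
  moreover have "?T \<subseteq> G" using T(1) g by (auto intro!: G_comp G_inv)
  moreover have "finite ?T" using T(2) by simp
  ultimately show ?thesis unfolding quasi_subset_def by blast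
qed

section \<open>Chains of independent tuples\<close>

definition indep :: "('a \<Rightarrow> 'a) \<Rightarrow> 'a set \<Rightarrow> 'a set \<Rightarrow> bool" where
  "indep g P B \<longleftrightarrow> (\<exists>q. Inv P q \<and> models M q g P (A \<union> B))"

text \<open>The type of each tuple over \<open>A\<close>, \<open>B\<close> and the tuples before it
  extends to a Lascar invariant global type. Hence sets inside the base can be moved by Lascar
  strong maps while the tuples of the chain stay fixed, which is how \<open>chain_lift\<close> uses
  it.\<close>

fun chain :: "'a set \<Rightarrow> ('a \<Rightarrow> 'a) list \<Rightarrow> 'a set \<Rightarrow> bool" where
  "chain P [] B \<longleftrightarrow> True"
| "chain P (g # gs) B \<longleftrightarrow> g \<in> G \<and> indep g P B \<and> chain P gs (B \<union> g ` P)"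

lemma G_image_A: "g \<in> G \<Longrightarrow> g ` A = A"
  using G_fix by force

lemma indep_conj:
  assumes h: "h \<in> G" and i: "indep g P B"
  shows "indep (h \<circ> g) P (h ` B)"
proof -
  obtain q where q: "Inv P q" "models M q g P (A \<union> B)" using i unfolding indep_def by blast
  have "models M (inst h ` q) (h \<circ> g) P (A \<union> h ` B)"
    using models_inst[OF G_Aut[OF h] q(2)] G_image_A[OF h] by (simp add: image_Un)
  then show ?thesis unfolding indep_def using Inv_conj[OF h q(1)] by blast
qed

lemma indep_mono: "indep g P B \<Longrightarrow> C \<subseteq> B \<Longrightarrow> indep g P C"
  unfolding indep_def using models_mono[of M _ g P _ P "A \<union> C"] by blast

lemma indep_cong: "(\<And>p. p \<in> P \<Longrightarrow> g p = h p) \<Longrightarrow> indep g P B \<longleftrightarrow> indep h P B"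
  unfolding indep_def using models_cong[of P g h M _ "A \<union> B"] by simp

lemma chain_mono: "chain P gs B \<Longrightarrow> C \<subseteq> B \<Longrightarrow> chain P gs C"
proof (induction gs arbitrary: B C)
  case (Cons g gs)
  have "C \<union> g ` P \<subseteq> B \<union> g ` P" using Cons.prems(2) by blast
  then show ?case using Cons indep_mono by auto
qed simp

lemma chain_conj: "h \<in> G \<Longrightarrow> chain P gs B \<Longrightarrow> chain P (map ((\<circ>) h) gs) (h ` B)"
proof (induction gs arbitrary: B)
  case (Cons g gs)
  have "chain P (map ((\<circ>) h) gs) (h ` (B \<union> g ` P))"
    by (rule Cons.IH) (use Cons.prems in simp_all)
  moreover have "h ` (B \<union> g ` P) = h ` B \<union> (h \<circ> g) ` P" by (simp add: image_Un image_comp)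
  ultimately show ?case using Cons.prems indep_conj G_comp by (simp only: list.map chain.simps)
qed simp

lemma chain_append: "chain P (gs @ hs) B \<longleftrightarrow> chain P gs B \<and> chain P hs (B \<union> (\<Union>g\<in>set gs. g ` P))"
  by (induction gs arbitrary: B) (auto simp: Un_assoc)

lemma map_comp_map: "map ((\<circ>) h) (map ((\<circ>) s) gs) = map ((\<circ>) (h \<circ> s)) gs"
  by (induction gs) (simp_all only: list.map comp_assoc)

lemma map_id_comp: "map ((\<circ>) id) gs = gs"
  by (induction gs) (simp_all only: list.map id_comp)

text \<open>The first tuple is moved by \<open>\<sigma>\<close> so as to realize its global type
  over \<open>D\<close> as well; this drags the tail along, and the induction continues with the
  moved tail. The parameter \<open>s\<close> accumulates the automorphisms already applied, so that
  the result is one translate of the whole list.\<close>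

lemma chain_extend_aux:
  assumes P: "finite P" and D: "small \<kappa> D"
  shows "chain P (map ((\<circ>) s) gs) B \<Longrightarrow> small \<kappa> B \<Longrightarrow>
    \<exists>h\<in>G. (\<forall>x\<in>B. h x = x) \<and> chain P (map ((\<circ>) (h \<circ> s)) gs) (B \<union> D)"
proof (induction gs arbitrary: s B)
  case Nil
  then show ?case using G_id by (intro bexI[of _ id]) simp_all
next
  case (Cons f gs)
  define g where "g = s \<circ> f"
  have prem: "g \<in> G" "indep g P B" "chain P (map ((\<circ>) s) gs) (B \<union> g ` P)"
    using Cons.prems(1) unfolding g_def by (simp_all only: list.map chain.simps)
  obtain q where q: "Inv P q" "models M q g P (A \<union> B)" using prem(2) unfolding indep_def by blast
  have sB: "small \<kappa> (A \<union> B)" using A Cons.prems(2) by (rule small_Un)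
  obtain c where c: "models M q c P ((A \<union> B) \<union> D)"
    using models_exists[OF Inv_complete[OF q(1)] small_finite[OF P] small_Un[OF sB D]] .
  have "tp M g P (A \<union> B) = tp M c P (A \<union> B)"
    using models_tp_eq[OF q(2) models_mono[OF c subset_refl Un_upper1]] .
  then obtain \<sigma> where \<sigma>: "\<sigma> \<in> Aut M" "\<And>x. x \<in> A \<union> B \<Longrightarrow> \<sigma> x = x" "\<And>p. p \<in> P \<Longrightarrow> \<sigma> (g p) = c p"
    using homogeneous[OF small_finite[OF P] sB] by blast
  have \<sigma>G: "\<sigma> \<in> G" using \<sigma>(1,2) by (intro GI) auto
  have \<sigma>B: "\<sigma> ` B = B" using \<sigma>(2) by force
  have "models M q (\<sigma> \<circ> g) P (A \<union> (B \<union> D))"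
    using c models_cong[of P "\<sigma> \<circ> g" c M q "A \<union> (B \<union> D)"] \<sigma>(3) by (simp add: Un_assoc)
  then have i: "indep (\<sigma> \<circ> g) P (B \<union> D)" unfolding indep_def using q(1) by blast
  have "chain P (map ((\<circ>) \<sigma>) (map ((\<circ>) s) gs)) (\<sigma> ` (B \<union> g ` P))"
    using prem(3) by (rule chain_conj[OF \<sigma>G])
  also have "\<sigma> ` (B \<union> g ` P) = B \<union> (\<sigma> \<circ> g) ` P" using \<sigma>B by (simp add: image_Un image_comp)
  finally have "chain P (map ((\<circ>) (\<sigma> \<circ> s)) gs) (B \<union> (\<sigma> \<circ> g) ` P)" unfolding map_comp_map .
  moreover have "small \<kappa> (B \<union> (\<sigma> \<circ> g) ` P)"
    using Cons.prems(2) P by (intro small_Un) (simp_all add: small_finite)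
  ultimately have "\<exists>h\<in>G. (\<forall>x\<in>B \<union> (\<sigma> \<circ> g) ` P. h x = x) \<and>
      chain P (map ((\<circ>) (h \<circ> (\<sigma> \<circ> s))) gs) (B \<union> (\<sigma> \<circ> g) ` P \<union> D)"
    by (rule Cons.IH)
  then obtain h where h: "h \<in> G" "\<forall>x\<in>B \<union> (\<sigma> \<circ> g) ` P. h x = x"
    "chain P (map ((\<circ>) (h \<circ> (\<sigma> \<circ> s))) gs) (B \<union> (\<sigma> \<circ> g) ` P \<union> D)" by blast
  define k where "k = h \<circ> \<sigma>"
  have kG: "k \<in> G" unfolding k_def using h(1) \<sigma>G by (rule G_comp)
  have hg: "(k \<circ> g) p = (\<sigma> \<circ> g) p" if "p \<in> P" for p
    using h(2) that unfolding k_def by auto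
  have "indep (k \<circ> g) P (B \<union> D)" using i indep_cong[of P "k \<circ> g" "\<sigma> \<circ> g"] hg by metis
  moreover have "(k \<circ> g) ` P = (\<sigma> \<circ> g) ` P" using hg by (rule image_cong[OF refl])
  moreover have "k \<circ> g \<in> G" using kG prem(1) by (rule G_comp)
  moreover have "chain P (map ((\<circ>) (k \<circ> s)) gs) (B \<union> D \<union> (\<sigma> \<circ> g) ` P)"
    using h(3) unfolding k_def comp_assoc by (simp only: Un_ac)
  ultimately have "chain P (map ((\<circ>) (k \<circ> s)) (f # gs)) (B \<union> D)"
    unfolding g_def by (simp only: list.map chain.simps comp_assoc)
  moreover have "k x = x" if "x \<in> B" for x using h(2) \<sigma>(2) that unfolding k_def by simp
  ultimately show ?case using kG by blast
qed

lemma chain_extend: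
  assumes "finite P" "small \<kappa> D" "chain P gs B" "small \<kappa> B"
  shows "\<exists>h\<in>G. (\<forall>x\<in>B. h x = x) \<and> chain P (map ((\<circ>) h) gs) (B \<union> D)"
  using chain_extend_aux[OF assms(1,2), of id gs B] assms(3,4)
  by (simp only: map_id_comp comp_id)

text \<open>Since \<open>q\<close> is invariant under \<open>u\<close>, the tuple \<open>g\<close>
  satisfies the same formulas with parameters \<open>x\<close> as with parameters
  \<open>u x\<close>. Read from the other side, \<open>X\<close> and its image under
  \<open>u\<close> have the same type over \<open>g\<close>, and homogeneity supplies the
  automorphism.\<close>

lemma invariant_lift:
  fixes g :: "'i \<Rightarrow> 'a"
  assumes q: "Inv P q" "models M q g P D" and sm: "finite P" "small \<kappa> X"
    and u: "u \<in> L" and X: "X \<subseteq> D" "u ` X \<subseteq> D"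
  obtains \<tau> where "\<tau> \<in> Aut M" "\<And>p. p \<in> P \<Longrightarrow> \<tau> (g p) = g p" "\<And>x. x \<in> X \<Longrightarrow> \<tau> x = u x"
proof -
  have "tp M id X (g ` P) = tp M u X (g ` P)"
    unfolding tp_eq_iff
  proof
    fix \<phi> :: "('f, 'r, 'a + 'a) fm" assume \<phi>: "\<phi> \<in> formulas M (X <+> g ` P)"
    \<comment> \<open>An exchange of roles: the variables labelled by \<open>X\<close> become
      parameters, and the parameters in the image of \<open>g\<close> become variables.\<close>
    define m :: "'a + 'a \<Rightarrow> 'i + 'a" where "m = case_sum Inr (\<lambda>b. Inl (inv_into P g b))"
    define \<theta> where "\<theta> = map_fm m \<phi>"
    have \<theta>: "\<theta> \<in> formulas M (P <+> X)"
      unfolding \<theta>_def by (rule formulas_map[OF \<phi>]) (auto simp: m_def inv_into_into)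
    have val: "case_sum g f (m z) = case_sum f id z" if "z \<in> X <+> g ` P" for z f
      using that unfolding m_def by (auto simp: f_inv_into_f)
    have h: "holds M g (inst f \<theta>) \<longleftrightarrow> holds M f \<phi>" for f
      unfolding \<theta>_def holds_inst sat_map unfolding holds_def
    proof (rule sat_cong)
      fix z assume "z \<in> frees \<phi>"
      then have "z \<in> X <+> g ` P" using frees_formulas[OF \<phi>] by blast
      then show "(case_sum g f \<circ> m) z = case_sum f id z" using val[of z f] by simp
    qed
    have 1: "holds M g \<theta> \<longleftrightarrow> \<theta> \<in> q"
      by (rule modelsD[OF q(2)]) (rule formulas_Plus_mono[OF \<theta> subset_refl X(1)])
    have 2: "holds M g (inst u \<theta>) \<longleftrightarrow> inst u \<theta> \<in> q"
      by (rule modelsD[OF q(2)]) (rule inst_formulas[OF \<theta> X(2)])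
    have "holds M id \<phi> \<longleftrightarrow> holds M g \<theta>" using h[of id] by (simp only: inst_id')
    also have "\<dots> \<longleftrightarrow> holds M u \<phi>" using 1 2 InvD[OF q(1) u] h[of u] by simp
    finally show "holds M id \<phi> \<longleftrightarrow> holds M u \<phi>" .
  qed
  then obtain \<tau> where "\<tau> \<in> Aut M" "\<And>x. x \<in> g ` P \<Longrightarrow> \<tau> x = x" "\<And>x. x \<in> X \<Longrightarrow> \<tau> (id x) = u x"
    using homogeneous[OF sm(2), of "g ` P" id u] small_finite[of "g ` P"] sm(1) by blast
  then show ?thesis by (intro that[of \<tau>]) auto
qed

text \<open>\<open>invariant_lift\<close> is iterated. An automorphism that fixes the first tuple
  and agrees with \<open>u\<close> on \<open>X\<close> plays the part of \<open>u\<close> for the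
  rest of the chain, with the first tuple added to \<open>X\<close>. Agreement with \<open>u\<close>
  on the model \<open>N\<close>, where \<open>u\<close> is the identity, keeps it Lascar strong at
  every stage.\<close>

lemma chain_lift:
  assumes P: "finite P" and N: "elem_substructure M N" "small \<kappa> N" "A \<subseteq> N"
  shows "chain P gs D \<Longrightarrow> N \<subseteq> D \<Longrightarrow> u \<in> Aut M \<Longrightarrow> (\<forall>x\<in>N. u x = x) \<Longrightarrow> small \<kappa> X \<Longrightarrow> X \<subseteq> D \<Longrightarrow>
    u ` X \<subseteq> D \<Longrightarrow> \<exists>\<tau>\<in>Aut M. (\<forall>g\<in>set gs. \<forall>p\<in>P. \<tau> (g p) = g p) \<and> (\<forall>x\<in>X \<union> N. \<tau> x = u x)"
proof (induction gs arbitrary: D u X)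
  case Nil
  then show ?case by (intro bexI[of _ u]) auto
next
  case (Cons g gs)
  obtain q where q: "Inv P q" "models M q g P (A \<union> D)" using Cons.prems(1) unfolding chain.simps indep_def by blast
  have uL: "u \<in> L" using Cons.prems(4) by (intro L_fix[OF Cons.prems(3) N]) auto
  have uN: "u ` N = N" using Cons.prems(4) by force
  have "small \<kappa> (X \<union> N)" using Cons.prems(5) N(2) by (rule small_Un)
  moreover have "X \<union> N \<subseteq> A \<union> D" "u ` (X \<union> N) \<subseteq> A \<union> D"
    using Cons.prems uN by (auto simp: image_Un)
  ultimately obtain \<tau> where \<tau>: "\<tau> \<in> Aut M" "\<And>p. p \<in> P \<Longrightarrow> \<tau> (g p) = g p" "\<And>x. x \<in> X \<union> N \<Longrightarrow> \<tau> x = u x"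
    using invariant_lift[OF q P _ uL] by blast
  have "\<exists>\<tau>'\<in>Aut M. (\<forall>g\<in>set gs. \<forall>p\<in>P. \<tau>' (g p) = g p) \<and> (\<forall>x\<in>(X \<union> g ` P) \<union> N. \<tau>' x = \<tau> x)"
  proof (rule Cons.IH)
    show "chain P gs (D \<union> g ` P)" using Cons.prems(1) by simp
    show "N \<subseteq> D \<union> g ` P" "X \<union> g ` P \<subseteq> D \<union> g ` P" using Cons.prems by auto
    show "\<forall>x\<in>N. \<tau> x = x" using \<tau>(3) Cons.prems(4) by simp
    show "small \<kappa> (X \<union> g ` P)" using Cons.prems(5) P by (intro small_Un) (simp_all add: small_finite)
    show "\<tau> ` (X \<union> g ` P) \<subseteq> D \<union> g ` P" using \<tau>(2,3) Cons.prems(7) by auto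
  qed (rule \<tau>(1))
  then obtain \<tau>' where \<tau>': "\<tau>' \<in> Aut M" "\<forall>g\<in>set gs. \<forall>p\<in>P. \<tau>' (g p) = g p"
    "\<forall>x\<in>(X \<union> g ` P) \<union> N. \<tau>' x = \<tau> x" by blast
  show ?case
  proof (intro bexI[OF _ \<tau>'(1)] conjI ballI)
    fix f p assume "f \<in> set (g # gs)" "p \<in> P"
    then show "\<tau>' (f p) = f p" using \<tau>' \<tau>(2) by auto
  qed (use \<tau>'(3) \<tau>(3) in auto)
qed

end

section \<open>The broom configuration and its induction\<close>

context extension_base
begin

text \<open>A Morley sequence is found without regard to \<open>gs\<close>, and
  \<open>chain_extend\<close> then moves \<open>gs\<close> to a chain over it. Undoing this move,
  and sending the first entry of the sequence to \<open>P\<close>, places the sequence and its model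
  correctly with respect to the given \<open>gs\<close>.\<close>

lemma dividing_sequence:
  fixes \<psi> :: "('f, 'r, 'i + 'a) fm"
  assumes \<psi>: "\<psi> \<in> formulas M V" and div: "divides M A \<psi>" and P: "finite P" "params \<psi> \<subseteq> P"
    and gs: "chain P gs P"
  shows "\<exists>N m c u. elem_substructure M N \<and> small \<kappa> N \<and> A \<subseteq> N \<and>
    (\<forall>l::nat. c l \<in> G \<and> u l \<in> Aut M \<and> (\<forall>x\<in>N. u l x = x) \<and> (\<forall>p\<in>P. u l p = c l p) \<and>
      indep (c l) P (\<Union>i<l. c i ` P)) \<and>
    \<not> (\<exists>y. \<forall>l<m. holds M y (inst (c l) \<psi>)) \<and> chain P gs (P \<union> N \<union> (\<Union>l<m. c l ` P))"
proof -
  obtain q k where q: "Inv P q" "models M q id P A" "witnesses_dividing \<psi> k q P"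
    using divides_witness_type[OF \<psi> div P] by metis
  obtain N where N: "elem_substructure M N" "small \<kappa> N" "A \<subseteq> N" using small_submodel[OF A] .
  obtain m where m: "\<And>gs. morley q P N gs m \<Longrightarrow> \<not> (\<exists>y. \<forall>j<m. holds M y (inst (gs j) \<psi>))"
    using morley_inconsistent[OF ntp2 \<psi> N q(1) P q(3)] by metis
  obtain cs where cs: "\<And>m. morley q P N cs m"
    using morley_exists[OF N(2,3) q(1,2) P(1)] by metis
  have csG: "cs l \<in> G" and csm: "models M q (cs l) P (N \<union> (\<Union>i<l. cs i ` P))" for l
    using cs[of "Suc l"] unfolding morley_def by simp_all
  \<comment> \<open>All entries realize \<open>q\<close> over \<open>N\<close>, so each is the image
    of the first under an automorphism over \<open>N\<close>; conjugated by \<open>k\<close>, these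
    become the maps \<open>u l\<close>.\<close>
  have "\<exists>\<sigma>\<in>Aut M. (\<forall>x\<in>N. \<sigma> x = x) \<and> (\<forall>p\<in>P. \<sigma> (cs 0 p) = cs l p)" for l
  proof -
    have "models M q (cs l) P N" for l using models_mono[OF csm subset_refl] by blast
    then have "tp M (cs 0) P N = tp M (cs l) P N" using models_tp_eq by blast
    then show ?thesis using homogeneous[OF small_finite[OF P(1)] N(2)] by metis
  qed
  then obtain \<sigma> where \<sigma>: "\<And>l. \<sigma> l \<in> Aut M" "\<And>l x. x \<in> N \<Longrightarrow> \<sigma> l x = x"
    "\<And>l p. p \<in> P \<Longrightarrow> \<sigma> l (cs 0 p) = cs l p" by metis
  define \<rho> where "\<rho> = inv (cs 0)"
  have \<rho>: "\<rho> \<in> G" unfolding \<rho>_def using csG by (rule G_inv)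
  define D where "D = \<rho> ` N \<union> (\<Union>l<m. (\<rho> \<circ> cs l) ` P)"
  have "small \<kappa> D" unfolding D_def using N(2) P(1) by (intro small_Un small_image) (auto intro: small_finite)
  then obtain h where h: "h \<in> G" "\<forall>x\<in>P. h x = x" "chain P (map ((\<circ>) h) gs) (P \<union> D)"
    using chain_extend[OF P(1) _ gs small_finite[OF P(1)]] by meson
  \<comment> \<open>\<open>\<rho>\<close> takes \<open>cs 0\<close> back to the enumeration of
    \<open>P\<close>, and \<open>inv h\<close>, which fixes \<open>P\<close>, returns the moved
    chain to \<open>gs\<close>.\<close>
  define k where "k = inv h \<circ> \<rho>"
  have kG: "k \<in> G" unfolding k_def using h(1) \<rho> by (intro G_comp G_inv)
  have hP: "inv h p = p" if "p \<in> P" for p using h(2) that Aut_inv_f[OF G_Aut[OF h(1)], of p] by simp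
  have k0: "k (cs 0 p) = p" if "p \<in> P" for p
    unfolding k_def \<rho>_def using hP[OF that] Aut_inv_f[OF G_Aut[OF csG]] by simp
  have k0': "inv k p = cs 0 p" if "p \<in> P" for p
    using k0[OF that] Aut_inv_f[OF G_Aut[OF kG], of "cs 0 p"] by simp
  show ?thesis
  proof (rule exI[of _ "k ` N"], rule exI[of _ m], rule exI[of _ "\<lambda>l. k \<circ> cs l"],
      rule exI[of _ "\<lambda>l. k \<circ> \<sigma> l \<circ> inv k"], intro conjI allI ballI)
    show "elem_substructure M (k ` N)" "small \<kappa> (k ` N)" "A \<subseteq> k ` N"
      using submodel_conj[OF kG N] .
    show "k \<circ> cs l \<in> G" for l using kG csG by (rule G_comp)
    show "k \<circ> \<sigma> l \<circ> inv k \<in> Aut M" for l using G_Aut[OF kG] \<sigma>(1) by (intro Aut_comp Aut_inv)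
    show "(k \<circ> \<sigma> l \<circ> inv k) x = x" if "x \<in> k ` N" for l x
      using that \<sigma>(2) Aut_inv_f[OF G_Aut[OF kG]] by auto
    show "(k \<circ> \<sigma> l \<circ> inv k) p = (k \<circ> cs l) p" if "p \<in> P" for l p
      using k0'[OF that] \<sigma>(3)[OF that] by simp
    show "indep (k \<circ> cs l) P (\<Union>i<l. (k \<circ> cs i) ` P)" for l
    proof -
      have "indep (cs l) P (N \<union> (\<Union>i<l. cs i ` P))"
        unfolding indep_def using q(1) csm[of l] N(3) by (intro exI[of _ q]) (simp add: Un_absorb1 flip: Un_assoc)
      then have "indep (k \<circ> cs l) P (k ` (N \<union> (\<Union>i<l. cs i ` P)))" by (rule indep_conj[OF kG])
      then show ?thesis by (rule indep_mono) (auto simp: image_Un)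
    qed
    show "\<not> (\<exists>y. \<forall>l<m. holds M y (inst (k \<circ> cs l) \<psi>))"
      unfolding holds_inst_aut'[OF G_Aut[OF kG] \<psi>] using m[OF cs] by blast
    have "chain P (map ((\<circ>) (inv h)) (map ((\<circ>) h) gs)) (inv h ` (P \<union> D))"
      using h by (intro chain_conj G_inv)
    moreover have "map ((\<circ>) (inv h)) (map ((\<circ>) h) gs) = gs"
      unfolding map_comp_map Aut_comp_inv(2)[OF G_Aut[OF h(1)]] by (rule map_id_comp)
    moreover have "inv h ` (P \<union> D) = P \<union> k ` N \<union> (\<Union>l<m. (k \<circ> cs l) ` P)"
    proof -
      have "inv h ` P = P" using hP by force
      then show ?thesis unfolding D_def k_def by (auto simp: image_Un image_UN image_comp)
    qed
    ultimately show "chain P gs (P \<union> k ` N \<union> (\<Union>l<m. (k \<circ> cs l) ` P))" by simp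
  qed
qed

text \<open>Realizations \<open>c l\<close> of an invariant type witnessing dividing of \<open>\<psi>\<close> are moved onto each other
  by automorphisms fixing the far away tuples \<open>gs\<close> that support \<open>\<Psi>\<close>. This removes \<open>\<psi>\<close> at the cost
  of finitely many conjugates of the remaining formulas, which are removed one conjugate at a
  time, later conjugates joining \<open>gs\<close>.\<close>

theorem broom:
  assumes P: "finite P"
  shows "\<forall>\<psi>\<in>set \<psi>s. \<psi> \<in> formulas M UNIV \<and> divides M A \<psi> \<and> params \<psi> \<subseteq> P \<Longrightarrow> chain P gs P \<Longrightarrow>
    (\<And>\<tau> c. \<tau> \<in> G \<Longrightarrow> \<forall>g\<in>set gs. \<forall>p\<in>P. \<tau> (g p) = g p \<Longrightarrow> c \<in> \<Psi> \<Longrightarrow> \<tau> \<circ> c \<in> \<Psi>) \<Longrightarrow>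
    E \<subseteq> \<Psi> \<union> {c. \<exists>\<psi>\<in>set \<psi>s. holds M c \<psi>} \<Longrightarrow> quasi_subset E \<Psi>"
proof (induction \<psi>s arbitrary: gs \<Psi> E)
  case Nil
  then show ?case by (intro quasi_subset_refl) auto
next
  case (Cons \<psi> \<psi>s)
  note \<Psi> = Cons.prems(3)
  have \<psi>: "\<psi> \<in> formulas M UNIV" "divides M A \<psi>" "params \<psi> \<subseteq> P"
    and \<psi>s: "\<forall>\<psi>\<in>set \<psi>s. \<psi> \<in> formulas M UNIV \<and> divides M A \<psi> \<and> params \<psi> \<subseteq> P"
    using Cons.prems(1) by auto
  obtain N m c u where N: "elem_substructure M N" "small \<kappa> N" "A \<subseteq> N"
    and all: "\<forall>l::nat. c l \<in> G \<and> u l \<in> Aut M \<and> (\<forall>x\<in>N. u l x = x) \<and> (\<forall>p\<in>P. u l p = c l p) \<and>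
      indep (c l) P (\<Union>i<l. c i ` P)"
    and incon: "\<not> (\<exists>y. \<forall>l<m. holds M y (inst (c l) \<psi>))"
    and ch: "chain P gs (P \<union> N \<union> (\<Union>l<m. c l ` P))"
    using dividing_sequence[OF \<psi>(1,2) P \<psi>(3) Cons.prems(2)] by (elim exE conjE) (rule that)
  have cG: "c l \<in> G" and ind: "indep (c l) P (\<Union>i<l. c i ` P)" for l using all by blast+
  have u: "u l \<in> Aut M" "x \<in> N \<Longrightarrow> u l x = x" "p \<in> P \<Longrightarrow> u l p = c l p" for l x p
    using all by blast+
  \<comment> \<open>As \<open>gs\<close> is a chain over \<open>P\<close>, \<open>N\<close> and the
    entries \<open>c l\<close> with \<open>l < m\<close>, the map \<open>u l\<close> can be
    corrected so that it still sends \<open>P\<close> to the \<open>l\<close>-th entry but also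
    fixes \<open>gs\<close>. It then maps \<open>\<Psi>\<close> into itself.\<close>
  have "\<exists>\<tau>\<in>G. (\<forall>g\<in>set gs. \<forall>p\<in>P. \<tau> (g p) = g p) \<and> (\<forall>p\<in>P. \<tau> p = c l p)" if l: "l < m" for l
  proof -
    have "\<exists>\<tau>\<in>Aut M. (\<forall>g\<in>set gs. \<forall>p\<in>P. \<tau> (g p) = g p) \<and> (\<forall>x\<in>P \<union> N. \<tau> x = u l x)"
    proof (rule chain_lift[OF P N ch])
      show "u l ` P \<subseteq> P \<union> N \<union> (\<Union>l<m. c l ` P)" using u(3) l by auto
    qed (use u small_finite[OF P] in auto)
    then obtain \<tau> where \<tau>: "\<tau> \<in> Aut M" "\<forall>g\<in>set gs. \<forall>p\<in>P. \<tau> (g p) = g p" "\<forall>x\<in>P \<union> N. \<tau> x = u l x"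
      by blast
    have "\<tau> \<in> G" using \<tau>(1,3) u(2) N(3) by (intro GI) auto
    then show ?thesis using \<tau>(2,3) u(3) by (intro bexI[of _ \<tau>]) simp_all
  qed
  then obtain \<tau> where \<tau>: "\<And>l. l < m \<Longrightarrow> \<tau> l \<in> G" "\<And>l. l < m \<Longrightarrow> \<forall>g\<in>set gs. \<forall>p\<in>P. \<tau> l (g p) = g p"
    "\<And>l. l < m \<Longrightarrow> \<forall>p\<in>P. \<tau> l p = c l p" by metis
  define F where "F n = {d. \<exists>l. n \<le> l \<and> l < m \<and> (\<exists>\<chi>\<in>set \<psi>s. holds M d (inst (c l) \<chi>))}" for n
  \<comment> \<open>Intersecting \<open>m\<close> conjugates of \<open>E\<close> removes
    \<open>\<psi>\<close>: at each point some instance of \<open>\<psi>\<close> at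
    \<open>c l\<close> fails, and the \<open>l\<close>-th conjugate then places the point in
    \<open>\<Psi>\<close> or in the instance at \<open>c l\<close> of another formula.\<close>
  define E0 where "E0 = {d. \<forall>l<m. inv (\<tau> l) \<circ> d \<in> E}"
  have "quasi_subset E E0"
    unfolding quasi_subset_def E0_def
    by (rule exI[of _ "(\<lambda>l. inv (\<tau> l)) ` {..<m}"]) (use \<tau>(1) G_inv in auto)
  moreover have E0: "E0 \<subseteq> \<Psi> \<union> F 0"
  proof
    fix d assume d: "d \<in> E0"
    obtain l where l: "l < m" "\<not> holds M d (inst (c l) \<psi>)" using incon by blast
    have inst: "holds M d (inst (c l) \<chi>) \<longleftrightarrow> holds M (inv (\<tau> l) \<circ> d) \<chi>"
      if "\<chi> \<in> formulas M UNIV" "params \<chi> \<subseteq> P" for \<chi>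
    proof -
      have "inst (c l) \<chi> = inst (\<tau> l \<circ> id) \<chi>" using \<tau>(3)[OF l(1)] that(2) by (intro inst_cong) auto
      then show ?thesis using holds_inst_aut'[OF G_Aut[OF \<tau>(1)[OF l(1)]] that(1), of d id]
        by (simp only: inst_id')
    qed
    have "inv (\<tau> l) \<circ> d \<in> E" using d l(1) unfolding E0_def by blast
    then consider "inv (\<tau> l) \<circ> d \<in> \<Psi>" | "holds M (inv (\<tau> l) \<circ> d) \<psi>"
      | \<chi> where "\<chi> \<in> set \<psi>s" "holds M (inv (\<tau> l) \<circ> d) \<chi>" using Cons.prems(4) by auto
    then show "d \<in> \<Psi> \<union> F 0"
    proof cases
      case 1
      have "\<tau> l \<circ> (inv (\<tau> l) \<circ> d) \<in> \<Psi>" using \<Psi>[OF \<tau>(1)[OF l(1)] \<tau>(2)[OF l(1)] 1] .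
      moreover have "\<tau> l \<circ> (inv (\<tau> l) \<circ> d) = d"
        using Aut_f_inv[OF G_Aut[OF \<tau>(1)[OF l(1)]]] by (auto simp: fun_eq_iff)
      ultimately have "d \<in> \<Psi>" by metis
      then show ?thesis ..
    next
      case 2
      then show ?thesis using inst[OF \<psi>(1,3)] l(2) by blast
    next
      case 3
      then have "holds M d (inst (c l) \<chi>)" using inst[of \<chi>] \<psi>s by blast
      then show ?thesis unfolding F_def using 3(1) l(1) by blast
    qed
  qed
  moreover have "quasi_subset E' \<Psi>" if "n \<le> m" "E' \<subseteq> \<Psi> \<union> F n" for n E'
    using that
  \<comment> \<open>Downward from \<open>m\<close>, where \<open>F\<close> is empty. The step at
    \<open>n\<close> eliminates the instances at \<open>c n\<close> by the outer induction
    hypothesis for the shorter list \<open>\<psi>s\<close>, whatever its new \<open>\<Psi>\<close>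
    and \<open>gs\<close>.\<close>
  proof (induction n arbitrary: E' rule: inc_induct)
    case base
    then show ?case unfolding F_def by (intro quasi_subset_refl) auto
  next
    case (step n)
    define \<Psi>' where "\<Psi>' = \<Psi> \<union> F (Suc n)"
    \<comment> \<open>The tuples supporting \<open>\<Psi>'\<close>: \<open>gs\<close> for
      \<open>\<Psi>\<close>, and the later entries of the sequence for the instances still to be
      removed. The entries come first because \<open>gs\<close> is known to be a chain over
      them.\<close>
    define hs where "hs = map c [Suc n..<m] @ gs"
    have chain_c: "chain P (map c [j..<m]) B" if "j \<le> m" "B \<subseteq> (\<Union>i<j. c i ` P)" for j B
      using that
    proof (induction j arbitrary: B rule: inc_induct)
      case (step j)
      have "B \<union> c j ` P \<subseteq> (\<Union>i<Suc j. c i ` P)"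
        using step.prems unfolding lessThan_Suc by blast
      then have "chain P (map c [Suc j..<m]) (B \<union> c j ` P)" by (rule step.IH)
      moreover have "indep (c j) P B" using indep_mono[OF ind step.prems] .
      ultimately show ?case using cG step.hyps by (simp add: upt_conv_Cons)
    qed simp
    have "chain P hs (c n ` P)"
      unfolding hs_def chain_append
    proof
      show "chain P (map c [Suc n..<m]) (c n ` P)" using step.hyps by (intro chain_c) auto
      show "chain P gs (c n ` P \<union> (\<Union>g\<in>set (map c [Suc n..<m]). g ` P))"
        using step.hyps by (intro chain_mono[OF ch]) auto
    qed
    then have "chain P (map ((\<circ>) (inv (c n))) hs) (inv (c n) ` c n ` P)"
      by (rule chain_conj[OF G_inv[OF cG]])
    moreover have "inv (c n) ` c n ` P = P"
      using Aut_inv_f[OF G_Aut[OF cG]] by (simp add: image_image)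
    ultimately have ch': "chain P (map ((\<circ>) (inv (c n))) hs) P" by simp
    have \<Psi>': "\<tau> \<circ> d \<in> \<Psi>'" if t: "\<tau> \<in> G" "\<forall>g\<in>set hs. \<forall>p\<in>P. \<tau> (g p) = g p" "d \<in> \<Psi>'" for \<tau> d
    proof (cases "d \<in> \<Psi>")
      case True
      have "\<forall>g\<in>set gs. \<forall>p\<in>P. \<tau> (g p) = g p" using t(2) unfolding hs_def by simp
      then have "\<tau> \<circ> d \<in> \<Psi>" using \<Psi>[OF t(1) _ True] by blast
      then show ?thesis unfolding \<Psi>'_def ..
    next
      case False
      then obtain l \<chi> where l: "Suc n \<le> l" "l < m" "\<chi> \<in> set \<psi>s" "holds M d (inst (c l) \<chi>)"
        using t(3) unfolding \<Psi>'_def F_def by blast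
      have "c l \<in> set hs" using l unfolding hs_def by auto
      then have "inst (\<tau> \<circ> c l) \<chi> = inst (c l) \<chi>" using t(2) \<psi>s l(3) by (intro inst_cong) auto
      then have "holds M (\<tau> \<circ> d) (inst (c l) \<chi>)"
        using holds_inst_aut[OF G_Aut[OF t(1)], of \<chi> UNIV d "c l"] \<psi>s l(3,4) by metis
      then show ?thesis unfolding \<Psi>'_def F_def using l by blast
    qed
    \<comment> \<open>Translation by \<open>inv (c n)\<close> turns the instances at
      \<open>c n\<close> back into the formulas \<open>\<psi>s\<close> themselves and a chain over
      the image of \<open>P\<close> into one over \<open>P\<close>, as the outer induction
      hypothesis requires.\<close>
    have "quasi_subset {d. c n \<circ> d \<in> E'} {d. c n \<circ> d \<in> \<Psi>'}"
    proof (rule Cons.IH[OF \<psi>s ch'])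
      fix \<tau> d assume t: "\<tau> \<in> G" "\<forall>g\<in>set (map ((\<circ>) (inv (c n))) hs). \<forall>p\<in>P. \<tau> (g p) = g p"
        and d: "d \<in> {d. c n \<circ> d \<in> \<Psi>'}"
      let ?\<tau> = "c n \<circ> \<tau> \<circ> inv (c n)"
      have "?\<tau> \<circ> (c n \<circ> d) \<in> \<Psi>'"
      proof (rule \<Psi>')
        show "?\<tau> \<in> G" using cG t(1) by (intro G_comp G_inv)
        show "\<forall>g\<in>set hs. \<forall>p\<in>P. ?\<tau> (g p) = g p"
        proof (intro ballI)
          fix g p assume "g \<in> set hs" "p \<in> P"
          then have "\<tau> (inv (c n) (g p)) = inv (c n) (g p)" using t(2) by auto
          then show "?\<tau> (g p) = g p" using Aut_f_inv[OF G_Aut[OF cG]] by simp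
        qed
      qed (use d in simp)
      moreover have "?\<tau> \<circ> (c n \<circ> d) = c n \<circ> (\<tau> \<circ> d)"
        using Aut_inv_f[OF G_Aut[OF cG]] by (auto simp: fun_eq_iff)
      ultimately show "\<tau> \<circ> d \<in> {d. c n \<circ> d \<in> \<Psi>'}" by simp
    next
      show "{d. c n \<circ> d \<in> E'} \<subseteq> {d. c n \<circ> d \<in> \<Psi>'} \<union> {d. \<exists>\<psi>\<in>set \<psi>s. holds M d \<psi>}"
      proof
        fix d assume "d \<in> {d. c n \<circ> d \<in> E'}"
        then have "c n \<circ> d \<in> \<Psi> \<union> F n" using step.prems by blast
        then consider "c n \<circ> d \<in> \<Psi>'"
          | \<chi> where "\<chi> \<in> set \<psi>s" "holds M (c n \<circ> d) (inst (c n) \<chi>)"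
          unfolding \<Psi>'_def F_def using le_eq_less_or_eq Suc_le_eq by fastforce
        then show "d \<in> {d. c n \<circ> d \<in> \<Psi>'} \<union> {d. \<exists>\<psi>\<in>set \<psi>s. holds M d \<psi>}"
        proof cases
          case 2
          then have "holds M d \<chi>"
            using holds_inst_aut[OF G_Aut[OF cG], of \<chi> UNIV n d id] \<psi>s by (simp add: inst_id')
          then show ?thesis using 2(1) by blast
        qed simp
      qed
    qed
    then have "quasi_subset E' \<Psi>'" by (rule quasi_subset_conj[OF cG])
    moreover have "quasi_subset \<Psi>' \<Psi>" by (rule step.IH) (simp add: \<Psi>'_def)
    ultimately show ?case by (rule quasi_subset_trans)
  qed
  ultimately show ?case using quasi_subset_trans by blast
qed

end

section \<open>Strictly invariant types\<close>

context based
begin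

lemma divides_iff_G:
  "divides M A \<psi> \<longleftrightarrow> (\<exists>k g. (\<forall>l. g l \<in> G) \<and> k_inconsistent M k (\<lambda>l. inst (g l) \<psi>))"
proof
  assume "divides M A \<psi>"
  then show "\<exists>k g. (\<forall>l. g l \<in> G) \<and> k_inconsistent M k (\<lambda>l. inst (g l) \<psi>)"
    using divides_in_G by metis
next
  assume "\<exists>k g. (\<forall>l. g l \<in> G) \<and> k_inconsistent M k (\<lambda>l. inst (g l) \<psi>)"
  then obtain k g where g: "\<And>l. g l \<in> G" "k_inconsistent M k (\<lambda>l. inst (g l) \<psi>)" by blast
  have "tp M (g l) (params \<psi>) A = tp M id (params \<psi>) A" for l
    using tp_aut[OF G_Aut[OF g(1)], of A l id "params \<psi>"] G_fix[OF g(1)] by simp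
  then show "divides M A \<psi>" unfolding divides_def using g(2) by blast
qed

lemma divides_inst:
  assumes \<tau>: "\<tau> \<in> G" and "divides M A \<psi>"
  shows "divides M A (inst \<tau> \<psi>)"
proof -
  obtain k g where g: "\<And>l. g l \<in> G" "k_inconsistent M k (\<lambda>l. inst (g l) \<psi>)"
    using assms(2) unfolding divides_iff_G by blast
  have "inst (g l \<circ> inv \<tau>) (inst \<tau> \<psi>) = inst (g l) \<psi>" for l
    unfolding inst_comp comp_assoc Aut_comp_inv(2)[OF G_Aut[OF \<tau>]] by simp
  then have "k_inconsistent M k (\<lambda>l. inst (g l \<circ> inv \<tau>) (inst \<tau> \<psi>))" using g(2) by presburger
  moreover have "g l \<circ> inv \<tau> \<in> G" for l using g(1) \<tau> by (intro G_comp G_inv)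
  ultimately show ?thesis
    unfolding divides_iff_G by (intro exI[of _ k] exI[of _ "\<lambda>l. g l \<circ> inv \<tau>"]) simp
qed

lemma holds_inst_inv:
  assumes "\<tau> \<in> G" "\<phi> \<in> formulas M V"
  shows "holds M c (inst \<tau> \<phi>) \<longleftrightarrow> holds M (inv \<tau> \<circ> c) \<phi>"
  using holds_inst_aut'[OF G_Aut[OF assms(1)] assms(2), of c id] by (simp only: inst_id' comp_id)

text \<open>The set of variables is enlarged to all labels so that forking formulas belonging to
  different sets \<open>C\<close> can be collected in one set \<open>Bad\<close> later on.\<close>

lemma forks_inst:
  assumes \<tau>: "\<tau> \<in> G" and \<phi>: "\<phi> \<in> formulas M W" and f: "forks M I A \<phi>"
  shows "forks M UNIV A (inst \<tau> \<phi>)"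
proof -
  obtain S where S: "S \<subseteq> formulas M (I <+> UNIV)" "finite S" "\<forall>\<psi>\<in>S. divides M A \<psi>"
    "\<forall>c. holds M c \<phi> \<longrightarrow> (\<exists>\<psi>\<in>S. holds M c \<psi>)" using f unfolding forks_def by blast
  have "inst \<tau> ` S \<subseteq> formulas M (UNIV <+> UNIV)"
  proof
    fix \<chi> assume "\<chi> \<in> inst \<tau> ` S"
    then obtain \<psi> where "\<psi> \<in> S" "\<chi> = inst \<tau> \<psi>" by blast
    moreover have f: "\<psi> \<in> formulas M (UNIV <+> UNIV)"
      using S(1) \<open>\<psi> \<in> S\<close> formulas_Plus_mono[of \<psi> M I UNIV UNIV UNIV] by auto
    ultimately show "\<chi> \<in> formulas M (UNIV <+> UNIV)" using inst_formulas[OF f subset_UNIV] by metis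
  qed
  moreover have "\<exists>\<chi>\<in>inst \<tau> ` S. holds M c \<chi>" if c: "holds M c (inst \<tau> \<phi>)" for c
  proof -
    have "holds M (inv \<tau> \<circ> c) \<phi>" using c holds_inst_inv[OF \<tau> \<phi>] by simp
    then obtain \<psi> where \<psi>: "\<psi> \<in> S" "holds M (inv \<tau> \<circ> c) \<psi>" using S(4) by blast
    then have "holds M c (inst \<tau> \<psi>)" using holds_inst_inv[OF \<tau>, of \<psi>] S(1) by blast
    then show ?thesis using \<psi>(1) by blast
  qed
  moreover have "\<forall>\<chi>\<in>inst \<tau> ` S. divides M A \<chi>" using S(3) divides_inst[OF \<tau>] by blast
  ultimately show ?thesis unfolding forks_def using S(2) by (intro exI[of _ "inst \<tau> ` S"]) simp
qed

lemma divides_forks: "\<phi> \<in> formulas M (I <+> UNIV) \<Longrightarrow> divides M A \<phi> \<Longrightarrow> forks M I A \<phi>"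
  unfolding forks_def by (rule exI[of _ "{\<phi>}"]) simp

end

section \<open>Existence of strictly invariant types, Kim's lemma, and forking versus
  dividing\<close>

context extension_base
begin

text \<open>The condition on all small \<open>C\<close> at once becomes a set of formulas:
  \<open>q\<close> must contain the negation of \<open>\<chi>(b,x)\<close> for all \<open>b\<close>
  whenever \<open>\<chi>(y,a)\<close> forks over \<open>A\<close>. That these negations are
  compatible with invariance is where the broom lemma enters.\<close>

lemma strict_type_exists:
  fixes a :: "'j \<Rightarrow> 'a"
  assumes I: "small \<kappa> I"
  obtains q where "Inv I q" "models M q a I A"
    "\<And>C c. small \<kappa> C \<Longrightarrow> A \<subseteq> C \<Longrightarrow> models M q c I C \<Longrightarrow> \<not> type_forks M C A (tp M id C (A \<union> c ` I))"
proof -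
  \<comment> \<open>The variables \<open>y\<close> of \<open>\<chi>(y,x)\<close> are labelled by
    elements of the monster model. Here each such label is read as the element itself, which gives a
    formula in \<open>x\<close> with parameters.\<close>
  define pm :: "'a + ('j + 'a) \<Rightarrow> 'j + 'a" where "pm = case_sum Inr id"
  have pm: "holds M c (map_fm pm \<chi>) \<longleftrightarrow> holds M id (inst (case_sum c id) \<chi>)"
    for c and \<chi> :: "('f, 'r, 'a + ('j + 'a)) fm"
  proof -
    have "case_sum c id \<circ> pm = case_sum id (case_sum c id)"
      unfolding pm_def by (auto simp: fun_eq_iff split: sum.splits)
    then show ?thesis unfolding holds_map holds_inst by simp
  qed
  define Bad :: "('f, 'r, 'a + ('j + 'a)) fm set" where "Bad = {\<chi> \<in> formulas M (UNIV <+> (I <+> A)). forks M UNIV A (inst (case_sum a id) \<chi>)}"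
  define \<Sigma>2 where "\<Sigma>2 = (\<lambda>(\<theta> :: ('f, 'r, 'j + 'a) fm, \<sigma>). Imp \<theta> (inst \<sigma> \<theta>)) ` (formulas M (I <+> UNIV) \<times> L)"
  define \<Sigma>3 where "\<Sigma>3 = (\<lambda>\<chi>. Neg (map_fm pm \<chi>)) ` Bad"
  define \<Sigma> where "\<Sigma> = tp M a I A \<union> \<Sigma>2 \<union> \<Sigma>3"
  have sub: "\<Sigma> \<subseteq> formulas M (I <+> UNIV)"
  proof -
    have "tp M a I A \<subseteq> formulas M (I <+> UNIV)"
      unfolding tp_def using formulas_Plus_mono[of _ M I A I UNIV] by blast
    moreover have "\<Sigma>2 \<subseteq> formulas M (I <+> UNIV)"
      unfolding \<Sigma>2_def by (auto intro: inst_formulas[OF _ subset_UNIV])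
    moreover have "\<Sigma>3 \<subseteq> formulas M (I <+> UNIV)"
    proof -
      have "pm ` (UNIV <+> (I <+> A)) \<subseteq> I <+> UNIV" unfolding pm_def by (auto simp: Plus_def)
      then show ?thesis unfolding \<Sigma>3_def Bad_def using formulas_map[of _ M "UNIV <+> (I <+> A)" pm] by auto
    qed
    ultimately show ?thesis unfolding \<Sigma>_def by blast
  qed
  have "consistent M \<Sigma>"
    unfolding consistent_def
  proof (intro allI impI)
    fix F assume F: "finite F" "F \<subseteq> \<Sigma>"
    have "finite (F \<inter> \<Sigma>3)" "F \<inter> \<Sigma>3 \<subseteq> (\<lambda>\<chi>. Neg (map_fm pm \<chi>)) ` Bad" using F(1) unfolding \<Sigma>3_def by auto
    from finite_subset_image[OF this] obtain X where X: "X \<subseteq> Bad" "finite X" "F \<inter> \<Sigma>3 = (\<lambda>\<chi>. Neg (map_fm pm \<chi>)) ` X"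
      by (elim exE conjE) (rule that)
    define \<phi> where "\<phi> \<chi> = inst (case_sum a id) \<chi>" for \<chi> :: "('f, 'r, 'a + ('j + 'a)) fm"
    have \<phi>f: "\<phi> \<chi> \<in> formulas M UNIV" if "\<chi> \<in> X" for \<chi>
      using X(1) that unfolding \<phi>_def inst_def Bad_def by (auto intro: formulas_map)
    have "\<exists>S. S \<subseteq> formulas M (UNIV <+> UNIV) \<and> finite S \<and> (\<forall>\<psi>\<in>S. divides M A \<psi>) \<and>
        (\<forall>c. holds M c (\<phi> \<chi>) \<longrightarrow> (\<exists>\<psi>\<in>S. holds M c \<psi>))" if "\<chi> \<in> X" for \<chi>
      using X(1) that unfolding Bad_def forks_def \<phi>_def by blast
    then obtain S where S: "\<And>\<chi>. \<chi> \<in> X \<Longrightarrow> S \<chi> \<subseteq> formulas M (UNIV <+> UNIV)" "\<And>\<chi>. \<chi> \<in> X \<Longrightarrow> finite (S \<chi>)"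
      "\<And>\<chi> \<psi>. \<chi> \<in> X \<Longrightarrow> \<psi> \<in> S \<chi> \<Longrightarrow> divides M A \<psi>"
      "\<And>\<chi> c. \<chi> \<in> X \<Longrightarrow> holds M c (\<phi> \<chi>) \<Longrightarrow> \<exists>\<psi>\<in>S \<chi>. holds M c \<psi>" by metis
    have "finite (\<Union>(S ` X))" using X(2) S(2) by blast
    then obtain \<psi>s where \<psi>s: "set \<psi>s = \<Union>(S ` X)" using finite_list by metis
    define P where "P = (\<Union>\<psi>\<in>set \<psi>s. params \<psi>)"
    \<comment> \<open>The broom lemma is applied to the union of the solution sets, so that a single
      conjugate avoids all forking formulas from \<open>X\<close> simultaneously.\<close>
    define E where "E = {y. \<exists>\<chi>\<in>X. holds M y (\<phi> \<chi>)}"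
    have "quasi_subset E {}"
    proof (rule broom)
      show "finite P" unfolding P_def by (simp add: finite_params)
      have "\<psi> \<in> formulas M UNIV" if "\<psi> \<in> set \<psi>s" for \<psi>
        using that S(1) formulas_mono[of \<psi> M "UNIV <+> UNIV" UNIV] unfolding \<psi>s by blast
      then show "\<forall>\<psi>\<in>set \<psi>s. \<psi> \<in> formulas M UNIV \<and> divides M A \<psi> \<and> params \<psi> \<subseteq> P"
        using S(3) unfolding P_def by (auto simp: \<psi>s)
      show "chain P [] P" by simp
      show "E \<subseteq> {} \<union> {c. \<exists>\<psi>\<in>set \<psi>s. holds M c \<psi>}" unfolding E_def \<psi>s using S(4) by blast
    qed simp
    then obtain T where T: "T \<subseteq> G" "finite T" "\<And>c. \<not> (\<forall>t\<in>T. t \<circ> c \<in> E)" unfolding quasi_subset_def by blast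
    \<comment> \<open>The conjugates of \<open>a\<close> by the inverses of \<open>T\<close> are put
      into one tuple, whose invariant type is then realized over the parameters of
      \<open>F\<close>.\<close>
    define b where "b = (\<lambda>(t, i). inv t (a i) :: 'a)"
    obtain r where r: "Inv (T \<times> I) r" "models M r b (T \<times> I) A"
      using Inv_exists[OF small_finite_Times[OF T(2) I]] .
    define D where "D = A \<union> (\<Union>\<chi>\<in>F. params \<chi>)"
    have D: "small \<kappa> D" unfolding D_def using A F(1) by (intro small_Un) (simp_all add: small_finite finite_params)
    obtain d where d: "models M r d (T \<times> I) D"
      using models_exists[OF Inv_complete[OF r(1)] small_finite_Times[OF T(2) I] D] .
    have AD: "A \<subseteq> D" unfolding D_def by blast
    have "tp M b (T \<times> I) A = tp M d (T \<times> I) A"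
      using models_tp_eq[OF r(2) models_mono[OF d subset_refl AD]] .
    then obtain \<tau> where \<tau>: "\<tau> \<in> Aut M" "\<And>x. x \<in> A \<Longrightarrow> \<tau> x = x"
      "\<And>i. i \<in> T \<times> I \<Longrightarrow> \<tau> (b i) = d i"
      using homogeneous[OF small_finite_Times[OF T(2) I] A] by blast
    have \<tau>G: "\<tau> \<in> G" using \<tau>(1,2) by (rule GI)
    \<comment> \<open>\<open>\<tau>\<close> carries the conjugate of \<open>a\<close> by
      \<open>inv t\<close> to the \<open>t\<close>-th part of \<open>d\<close>. Hence evaluating
      \<open>\<chi>\<close> at that part amounts to evaluating \<open>\<phi> \<chi>\<close> at the
      assignment \<open>t \<circ> inv \<tau>\<close>, and the choice of \<open>T\<close> forbids
      that all these assignments lie in \<open>E\<close>.\<close>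
    have inst_d: "holds M id (inst (case_sum (\<lambda>i. d (t, i)) id) \<chi>) \<longleftrightarrow> holds M (t \<circ> inv \<tau>) (\<phi> \<chi>)"
      if t: "t \<in> T" and \<chi>: "\<chi> \<in> X" for t \<chi>
    proof -
      have tG: "t \<in> G" using T(1) t by blast
      have p\<chi>: "params \<chi> \<subseteq> I <+> A" using X(1) \<chi> unfolding Bad_def by (auto dest: params_formulas)
      have "inst (case_sum (\<lambda>i. d (t, i)) id) \<chi> = inst ((\<tau> \<circ> inv t) \<circ> case_sum a id) \<chi>"
      proof (rule inst_cong)
        fix z assume "z \<in> params \<chi>"
        then have "z \<in> I <+> A" using p\<chi> by blast
        then show "case_sum (\<lambda>i. d (t, i)) id z = ((\<tau> \<circ> inv t) \<circ> case_sum a id) z"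
          using \<tau>(3)[of "(t, _)"] t \<tau>(2) G_fix[OF G_inv[OF tG]] unfolding b_def by auto
      qed
      then have "inst (case_sum (\<lambda>i. d (t, i)) id) \<chi> = inst (\<tau> \<circ> inv t) (\<phi> \<chi>)"
        unfolding \<phi>_def by (simp add: inst_comp)
      moreover have "holds M id (inst (\<tau> \<circ> inv t) (\<phi> \<chi>)) \<longleftrightarrow> holds M (inv (\<tau> \<circ> inv t) \<circ> id) (\<phi> \<chi>)"
        using holds_inst_inv[OF G_comp[OF \<tau>G G_inv[OF tG]] \<phi>f[OF \<chi>]] .
      moreover have "inv (\<tau> \<circ> inv t) \<circ> id = t \<circ> inv \<tau>"
        using inv_comp[OF \<tau>(1) G_Aut[OF G_inv[OF tG]]] inv_inv_eq[OF Aut_bij[OF G_Aut[OF tG]]] by simp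
      ultimately show ?thesis by simp
    qed
    obtain t where t: "t \<in> T" "t \<circ> inv \<tau> \<notin> E" using T(3)[of "inv \<tau>"] by blast
    define c where "c = d \<circ> Pair t"
    define rt where "rt = reindex M (Pair t) I r"
    have rt: "Inv I rt" unfolding rt_def using r(1) by (rule Inv_reindex) (use t(1) in auto)
    have crt: "models M rt c I D" unfolding c_def rt_def using d by (rule models_reindex) (use t(1) in auto)
    have brt: "models M rt (b \<circ> Pair t) I A" unfolding rt_def using r(2) by (rule models_reindex) (use t(1) in auto)
    have "realizes M c F"
      unfolding realizes_def
    proof
      fix \<chi> assume \<chi>: "\<chi> \<in> F"
      then consider "\<chi> \<in> tp M a I A" | "\<chi> \<in> \<Sigma>2" | "\<chi> \<in> F \<inter> \<Sigma>3" using F(2) unfolding \<Sigma>_def by blast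
      then show "holds M c \<chi>"
      proof cases
        case 1
        then have f: "\<chi> \<in> formulas M (I <+> A)" and h: "holds M a \<chi>" unfolding tp_def by auto
        have tA: "inv t \<in> G" using t(1) T(1) by (blast intro: G_inv)
        have "b \<circ> Pair t = inv t \<circ> a" unfolding b_def by auto
        moreover have "tp M (inv t \<circ> a) I A = tp M a I A"
          using tp_aut[OF G_Aut[OF tA]] G_fix[OF tA] by blast
        ultimately have "holds M (b \<circ> Pair t) \<chi>" using f h unfolding tp_eq_iff by auto
        then show ?thesis
          using modelsD[OF brt f] modelsD[OF models_mono[OF crt subset_refl AD] f] by blast
      next
        case 2
        then obtain \<theta> \<sigma> where \<theta>: "\<theta> \<in> formulas M (I <+> UNIV)" "\<sigma> \<in> L" "\<chi> = Imp \<theta> (inst \<sigma> \<theta>)"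
          unfolding \<Sigma>2_def by auto
        have "params \<chi> \<subseteq> D" using \<chi> unfolding D_def by blast
        moreover have "params \<chi> = params \<theta> \<union> params (inst \<sigma> \<theta>)"
          unfolding \<theta>(3) params_def Imp_def by auto
        ultimately have "\<theta> \<in> formulas M (I <+> D)" "inst \<sigma> \<theta> \<in> formulas M (I <+> D)"
          using formulas_params[OF \<theta>(1)] formulas_params[OF inst_formulas[OF \<theta>(1)], of \<sigma> UNIV D] by auto
        then show ?thesis
          using modelsD[OF crt] InvD[OF rt \<theta>(2)] unfolding \<theta>(3) by simp
      next
        case 3
        then obtain \<xi> where \<xi>: "\<xi> \<in> X" "\<chi> = Neg (map_fm pm \<xi>)" unfolding X(3) by blast
        have "c = (\<lambda>i. d (t, i))" unfolding c_def by auto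
        then have "\<not> holds M c (map_fm pm \<xi>)"
          using pm[of c \<xi>] inst_d[OF t(1) \<xi>(1)] t(2) \<xi>(1) unfolding E_def by auto
        then show ?thesis unfolding \<xi>(2) by simp
      qed
    qed
    then show "\<exists>c. realizes M c F" by blast
  qed
  then obtain q where q: "\<Sigma> \<subseteq> q" "complete_type M I UNIV q" using Lindenbaum[OF sub] by blast
  have inv: "Inv I q"
  proof (rule InvI[OF q(2)])
    fix \<sigma> \<phi> assume "\<sigma> \<in> L" "\<phi> \<in> q"
    then have "Imp \<phi> (inst \<sigma> \<phi>) \<in> \<Sigma>2" unfolding \<Sigma>2_def using complete_type_formulas[OF q(2)] by force
    then show "inst \<sigma> \<phi> \<in> q" using q(1) complete_type_mp[OF q(2) _ \<open>\<phi> \<in> q\<close>] unfolding \<Sigma>_def by blast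
  qed
  have qa: "models M q a I A"
    using tp_subset_models[OF q(2)] q(1) unfolding \<Sigma>_def by blast
  have "\<not> type_forks M C A (tp M id C (A \<union> c ` I))"
    if C: "small \<kappa> C" "A \<subseteq> C" and c: "models M q c I C" for C c
  proof
    assume "type_forks M C A (tp M id C (A \<union> c ` I))"
    then obtain \<phi> where \<phi>: "\<phi> \<in> formulas M (C <+> (A \<union> c ` I))" "holds M id \<phi>" "forks M C A \<phi>"
      unfolding type_forks_def tp_def by blast
    \<comment> \<open>The entries of \<open>c\<close> among the parameters of \<open>\<phi>\<close>
      are abstracted to variables, so that \<open>a\<close> can be put in their place; an
      automorphism over \<open>A\<close> from \<open>c\<close> to \<open>a\<close> will show that
      the resulting formula is in \<open>Bad\<close>.\<close>
    define lf :: "'a \<Rightarrow> 'j + 'a" where "lf b = (if b \<in> A then Inr b else Inl (inv_into I c b))" for b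
    define \<chi> where "\<chi> = inst lf \<phi>"
    have lf: "lf b \<in> I <+> A" "case_sum c id (lf b) = b" if "b \<in> A \<union> c ` I" for b
      using that unfolding lf_def by (auto simp: inv_into_into f_inv_into_f)
    have \<chi>: "\<chi> \<in> formulas M (C <+> (I <+> A))"
      unfolding \<chi>_def inst_def by (rule formulas_map[OF \<phi>(1)]) (use lf(1) in auto)
    have "tp M c I A = tp M a I A"
      using models_tp_eq[OF models_mono[OF c subset_refl C(2)] qa] .
    then obtain \<tau> where \<tau>: "\<tau> \<in> Aut M" "\<And>x. x \<in> A \<Longrightarrow> \<tau> x = x" "\<And>i. i \<in> I \<Longrightarrow> \<tau> (c i) = a i"
      using homogeneous[OF I A] by blast
    have inst_c: "inst (case_sum c id) \<chi> = \<phi>"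
      unfolding \<chi>_def inst_comp using params_formulas[OF \<phi>(1)] lf(2) by (intro inst_id) auto
    have "inst (case_sum a id) \<chi> = inst (\<tau> \<circ> case_sum c id) \<chi>"
      using params_formulas[OF \<chi>] \<tau>(2,3) by (intro inst_cong) auto
    also have "\<dots> = inst \<tau> \<phi>" using inst_c by (simp flip: inst_comp)
    finally have "forks M UNIV A (inst (case_sum a id) \<chi>)"
      using forks_inst[OF GI[OF \<tau>(1,2)] \<phi>(1,3)] by simp
    moreover have "\<chi> \<in> formulas M (UNIV <+> (I <+> A))" using \<chi> by (rule formulas_Plus_mono) auto
    ultimately have "Neg (map_fm pm \<chi>) \<in> q" using q(1) unfolding \<Sigma>_def \<Sigma>3_def Bad_def by blast
    moreover have "map_fm pm \<chi> \<in> formulas M (I <+> C)"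
      by (rule formulas_map[OF \<chi>]) (use C(2) in \<open>auto simp: pm_def\<close>)
    ultimately have "holds M c (Neg (map_fm pm \<chi>))" using modelsD[OF c, of "Neg (map_fm pm \<chi>)"] by simp
    then show False using pm[of c \<chi>] inst_c \<phi>(2) by simp
  qed
  then show ?thesis using that inv qa by metis
qed

text \<open>Kim's lemma for strictly invariant types: since \<open>tp(D/Ac)\<close> does not divide, a sequence
  witnessing that \<open>\<psi>\<close> divides can be found among the realizations of \<open>tp(c/D)\<close>.\<close>

lemma strict_witnesses_dividing:
  fixes \<psi> :: "('f, 'r, 'i + 'a) fm"
  assumes \<psi>: "\<psi> \<in> formulas M V" and div: "divides M A \<psi>" and P: "finite P" "params \<psi> \<subseteq> P"
    and q: "Inv P q" "models M q id P A"
    and strict: "\<And>C c. small \<kappa> C \<Longrightarrow> A \<subseteq> C \<Longrightarrow> models M q c P C \<Longrightarrow>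
      \<not> type_forks M C A (tp M id C (A \<union> c ` P))"
  obtains k where "witnesses_dividing \<psi> k q P"
proof -
  obtain k g where g: "\<And>l. g l \<in> G" "k_inconsistent M k (\<lambda>l. inst (g l) \<psi>)"
    using div unfolding divides_iff_G by blast
  have ex: "\<exists>\<nu>. \<nu> \<in> formulas M (H \<times> params \<psi>) \<and>
      (\<forall>v. sat M UNIV v [] \<nu> \<longleftrightarrow> \<not> (\<exists>y. \<forall>l\<in>H. holds M y (inst (\<lambda>p. v (l, p)) \<psi>)))"
    if "finite H" for H :: "nat set"
    using inconsistency_formula[OF \<psi> that] by metis
  have "\<forall>H :: nat set. \<exists>\<nu>. finite H \<longrightarrow> \<nu> \<in> formulas M (H \<times> params \<psi>) \<and>
      (\<forall>v. sat M UNIV v [] \<nu> \<longleftrightarrow> \<not> (\<exists>y. \<forall>l\<in>H. holds M y (inst (\<lambda>p. v (l, p)) \<psi>)))"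
  proof (rule allI)
    fix H :: "nat set"
    show "\<exists>\<nu>. finite H \<longrightarrow> \<nu> \<in> formulas M (H \<times> params \<psi>) \<and>
      (\<forall>v. sat M UNIV v [] \<nu> \<longleftrightarrow> \<not> (\<exists>y. \<forall>l\<in>H. holds M y (inst (\<lambda>p. v (l, p)) \<psi>)))"
    proof (cases "finite H")
      case True
      then show ?thesis using ex[OF True] by simp
    qed simp
  qed
  from choice[OF this] obtain \<nu> :: "nat set \<Rightarrow> ('f, 'r, nat \<times> 'a) fm"
    where \<nu>_all: "\<forall>H. finite H \<longrightarrow> \<nu> H \<in> formulas M (H \<times> params \<psi>) \<and>
      (\<forall>v. sat M UNIV v [] (\<nu> H) \<longleftrightarrow> \<not> (\<exists>y. \<forall>l\<in>H. holds M y (inst (\<lambda>p. v (l, p)) \<psi>)))" ..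
  have \<nu>: "finite H \<Longrightarrow> \<nu> H \<in> formulas M (H \<times> params \<psi>)"
    "finite H \<Longrightarrow> sat M UNIV v [] (\<nu> H) \<longleftrightarrow> \<not> (\<exists>y. \<forall>l\<in>H. holds M y (inst (\<lambda>p. v (l, p)) \<psi>))" for H v
    using \<nu>_all by simp_all
  have "\<exists>h. (\<forall>l. h l \<in> G \<and> models M q (h l) P D) \<and> k_inconsistent M k (\<lambda>l. inst (h l) \<psi>)"
    if D: "small \<kappa> D" "A \<subseteq> D" for D
  proof -
    obtain c where c: "c \<in> G" "models M q c P D"
      using realize_in_G[OF Inv_complete[OF q(1)] q(2) refl small_finite[OF P(1)] D(1)] D(2)
      by (metis Un_absorb1)
    \<comment> \<open>The unknowns are a copy of \<open>D\<close> and an array of tuples.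
      \<open>\<Gamma>0\<close> makes the copy realize the type of \<open>D\<close> over
      \<open>A\<close>, \<open>\<Gamma>1\<close> makes each tuple stand to the copy as
      \<open>c\<close> stands to \<open>D\<close>, and \<open>\<Gamma>2\<close> asserts
      \<open>k\<close>-inconsistency.\<close>
    define J where "J = D <+> ((UNIV :: nat set) \<times> P)"
    have sJ: "small \<kappa> J" unfolding J_def using D(1) small_nat_Times[OF P(1)] by (rule small_Plus)
    define m0 :: "'a + 'a \<Rightarrow> ('a + nat \<times> 'a) + 'a" where "m0 = map_sum Inl id"
    define m1 :: "nat \<Rightarrow> 'a + 'a \<Rightarrow> ('a + nat \<times> 'a) + 'a"
      where "m1 l = case_sum (\<lambda>p. Inl (Inr (l, p))) (\<lambda>d. Inl (Inl d))" for l
    define m2 :: "nat \<times> 'a \<Rightarrow> ('a + nat \<times> 'a) + 'a" where "m2 z = Inl (Inr z)" for z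
    define \<Gamma>0 where "\<Gamma>0 = map_fm m0 ` tp M id D A"
    define \<Gamma>1 where "\<Gamma>1 = (\<lambda>(l, \<theta>). map_fm (m1 l) \<theta>) ` (UNIV \<times> {\<theta> \<in> formulas M (P <+> D). holds M c \<theta>})"
    define \<Gamma>2 where "\<Gamma>2 = (\<lambda>H. map_fm m2 (\<nu> H)) ` {H. finite H \<and> card H = k}"
    have v0: "holds M w (map_fm m0 \<theta>) \<longleftrightarrow> holds M (w \<circ> Inl) \<theta>" for w \<theta>
      unfolding m0_def by (rule holds_reindex)
    have v1: "holds M w (map_fm (m1 l) \<theta>) \<longleftrightarrow>
      sat M UNIV (case_sum (\<lambda>p. w (Inr (l, p))) (w \<circ> Inl)) [] \<theta>" for w l \<theta>
    proof -
      have "case_sum w id \<circ> m1 l = case_sum (\<lambda>p. w (Inr (l, p))) (w \<circ> Inl)"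
        unfolding m1_def by (auto simp: fun_eq_iff split: sum.splits)
      then show ?thesis unfolding holds_map by simp
    qed
    have v2: "holds M w (map_fm m2 (\<nu> H)) \<longleftrightarrow>
      \<not> (\<exists>y. \<forall>l\<in>H. holds M y (inst (\<lambda>p. w (Inr (l, p))) \<psi>))" if "finite H" for w H
      unfolding holds_map \<nu>(2)[OF that] m2_def by simp
    have "\<Gamma>0 \<subseteq> formulas M (J <+> A)"
      unfolding \<Gamma>0_def tp_def m0_def J_def by (auto intro!: formulas_map)
    moreover have "\<Gamma>1 \<subseteq> formulas M (J <+> A)"
      unfolding \<Gamma>1_def m1_def J_def by (auto intro!: formulas_map)
    moreover have "\<Gamma>2 \<subseteq> formulas M (J <+> A)"
    proof -
      have "map_fm m2 (\<nu> H) \<in> formulas M (J <+> A)" if "finite H" for H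
        by (rule formulas_map[OF \<nu>(1)[OF that]]) (use P(2) in \<open>auto simp: m2_def J_def\<close>)
      then show ?thesis unfolding \<Gamma>2_def by auto
    qed
    ultimately have sub: "\<Gamma>0 \<union> \<Gamma>1 \<union> \<Gamma>2 \<subseteq> formulas M (J <+> A)" by blast
    have "consistent M (\<Gamma>0 \<union> \<Gamma>1 \<union> \<Gamma>2)"
      unfolding consistent_def
    proof (intro allI impI)
      fix F assume F: "finite F" "F \<subseteq> \<Gamma>0 \<union> \<Gamma>1 \<union> \<Gamma>2"
      have "finite (F \<inter> \<Gamma>0)" "F \<inter> \<Gamma>0 \<subseteq> map_fm m0 ` tp M id D A" using F(1) unfolding \<Gamma>0_def by auto
      from finite_subset_image[OF this] obtain F0 where F0: "F0 \<subseteq> tp M id D A" "finite F0" "F \<inter> \<Gamma>0 = map_fm m0 ` F0"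
        by (elim exE conjE) (rule that)
      have "finite (F \<inter> \<Gamma>1)" "F \<inter> \<Gamma>1 \<subseteq> (\<lambda>(l, \<theta>). map_fm (m1 l) \<theta>) ` (UNIV \<times> {\<theta> \<in> formulas M (P <+> D). holds M c \<theta>})"
        using F(1) unfolding \<Gamma>1_def by auto
      from finite_subset_image[OF this] obtain F1 where F1: "F1 \<subseteq> UNIV \<times> {\<theta> \<in> formulas M (P <+> D). holds M c \<theta>}" "finite F1"
        "F \<inter> \<Gamma>1 = (\<lambda>(l, \<theta>). map_fm (m1 l) \<theta>) ` F1"
        by (elim exE conjE) (rule that)
      have "finite (F \<inter> \<Gamma>2)" "F \<inter> \<Gamma>2 \<subseteq> (\<lambda>H. map_fm m2 (\<nu> H)) ` {H. finite H \<and> card H = k}"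
        using F(1) unfolding \<Gamma>2_def by auto
      from finite_subset_image[OF this] obtain F2 where F2: "F2 \<subseteq> {H. finite H \<and> card H = k}" "finite F2"
        "F \<inter> \<Gamma>2 = (\<lambda>H. map_fm m2 (\<nu> H)) ` F2"
        by (elim exE conjE) (rule that)
      \<comment> \<open>Exchanging variables and parameters turns the finitely many requirements
        into one formula about \<open>D\<close> over \<open>A\<close> and \<open>c\<close>. It
        belongs to a type that does not fork over \<open>A\<close>, so it does not divide.\<close>
      define sw :: "'a + 'a \<Rightarrow> 'a + 'a" where "sw = case_sum (\<lambda>p. Inr (c p)) Inl"
      have "finite (F0 \<union> map_fm sw ` snd ` F1)" using F0(2) F1(2) by blast
      then obtain \<theta>s where \<theta>s: "set \<theta>s = F0 \<union> map_fm sw ` snd ` F1" using finite_list by metis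
      define \<Theta> where "\<Theta> = conjs \<theta>s"
      have \<Theta>f: "\<Theta> \<in> formulas M (D <+> (A \<union> c ` P))"
      proof -
        have "F0 \<subseteq> formulas M (D <+> (A \<union> c ` P))"
          using F0(1) formulas_Plus_mono[of _ M D A D "A \<union> c ` P"] unfolding tp_def by blast
        moreover have "map_fm sw \<theta> \<in> formulas M (D <+> (A \<union> c ` P))" if "\<theta> \<in> snd ` F1" for \<theta>
        proof (rule formulas_map[of _ _ "P <+> D"])
          show "\<theta> \<in> formulas M (P <+> D)" using F1(1) that by auto
        qed (auto simp: sw_def)
        ultimately show ?thesis unfolding \<Theta>_def by (auto simp: \<theta>s)
      qed
      have "holds M id \<Theta>"
      proof -
        have "holds M id (map_fm sw \<theta>)" if "\<theta> \<in> snd ` F1" for \<theta>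
        proof -
          have "holds M c \<theta>" using F1(1) that by auto
          moreover have "case_sum id id \<circ> sw = case_sum c id"
            unfolding sw_def by (auto simp: fun_eq_iff split: sum.splits)
          ultimately show ?thesis unfolding holds_map by (simp add: holds_def)
        qed
        then show ?thesis using F0(1) unfolding \<Theta>_def tp_def by (auto simp: \<theta>s)
      qed
      then have "\<not> forks M D A \<Theta>"
        using strict[OF D c(2)] \<Theta>f unfolding type_forks_def tp_def by blast
      then have ndiv: "\<not> divides M A \<Theta>"
        using divides_forks[of \<Theta> D] formulas_Plus_mono[OF \<Theta>f, of D UNIV] by blast
      have "finite (fst ` F1 \<union> \<Union>F2)" using F1(2) F2(1,2) by auto
      then obtain n where n: "fst ` F1 \<union> \<Union>F2 \<subseteq> {..<n}" using finite_nat_bounded by blast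
      \<comment> \<open>This map sends \<open>c p\<close> to \<open>g l p\<close>, so the conjugates
        of \<open>\<Theta>\<close> refer to the given dividing sequence of
        \<open>\<psi>\<close>.\<close>
      define f where "f l = g l \<circ> inv c" for l
      have "f l \<in> G" for l unfolding f_def using g(1) c(1) by (intro G_comp G_inv)
      \<comment> \<open>All array indices occurring in \<open>F\<close> are below \<open>n\<close>.
        The additional one guarantees an index even for \<open>n = 0\<close>, which the formulas
        from \<open>\<Gamma>0\<close> need.\<close>
      then have "\<not> k_inconsistent M (Suc n) (\<lambda>l. inst (f l) \<Theta>)" using ndiv unfolding divides_iff_G by blast
      then obtain K y where K: "finite K" "card K = Suc n" "\<forall>l\<in>K. holds M y (inst (f l) \<Theta>)"
        unfolding k_inconsistent_iff by blast
      obtain e where e: "bij_betw e {0..<Suc n} K" using ex_bij_betw_nat_finite[OF K(1)] K(2) by metis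
      have eK: "e l \<in> K" if "l \<le> n" for l using bij_betwE[OF e] that by simp
      have \<Theta>y: "sat M UNIV (case_sum y (f (e l))) [] \<theta>" if "l \<le> n" "\<theta> \<in> set \<theta>s" for l \<theta>
        using K(3) eK[OF that(1)] that(2) unfolding holds_inst \<Theta>_def by simp
      define w where "w = case_sum y (\<lambda>(l, p). g (e l) p)"
      have wl: "w \<circ> Inl = y" "(\<lambda>p. w (Inr (l, p))) = g (e l)" for l unfolding w_def by auto
      have "realizes M w F"
        unfolding realizes_def
      proof
        fix \<chi> assume "\<chi> \<in> F"
        then consider "\<chi> \<in> F \<inter> \<Gamma>0" | "\<chi> \<in> F \<inter> \<Gamma>1" | "\<chi> \<in> F \<inter> \<Gamma>2" using F(2) by blast
        then show "holds M w \<chi>"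
        proof cases
          case 1
          then obtain \<theta> where \<theta>: "\<theta> \<in> F0" "\<chi> = map_fm m0 \<theta>" unfolding F0(3) by blast
          have "sat M UNIV (case_sum y (f (e 0))) [] \<theta>" using \<Theta>y[of 0 \<theta>] \<theta>(1) by (simp add: \<theta>s)
          moreover have "inst (f (e 0)) \<theta> = \<theta>"
          proof (rule inst_id)
            fix b assume "b \<in> params \<theta>"
            then have "b \<in> A" using F0(1) \<theta>(1) unfolding tp_def by (auto dest: params_formulas)
            then show "f (e 0) b = b" using \<open>\<And>l. f l \<in> G\<close> G_fix by blast
          qed
          ultimately have "holds M y \<theta>" using holds_inst[of M y "f (e 0)" \<theta>] by simp
          then show ?thesis unfolding \<theta>(2) v0 wl .
        next
          case 2
          then obtain l \<theta> where \<theta>: "(l, \<theta>) \<in> F1" "\<chi> = map_fm (m1 l) \<theta>" unfolding F1(3) by auto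
          have "map_fm sw \<theta> \<in> set \<theta>s" using \<theta>(1) unfolding \<theta>s by force
          moreover have "l \<le> n" using n \<theta>(1) by force
          ultimately have "sat M UNIV (case_sum y (f (e l)) \<circ> sw) [] \<theta>"
            using \<Theta>y[of l "map_fm sw \<theta>"] by (simp add: sat_map)
          moreover have "case_sum y (f (e l)) \<circ> sw = case_sum (g (e l)) y"
            unfolding sw_def f_def using Aut_inv_f[OF G_Aut[OF c(1)]]
            by (auto simp: fun_eq_iff split: sum.splits)
          ultimately show ?thesis unfolding \<theta>(2) v1 wl by simp
        next
          case 3
          then obtain H where H: "H \<in> F2" "\<chi> = map_fm m2 (\<nu> H)" unfolding F2(3) by blast
          then have fH: "finite H" "card H = k" using F2(1) by auto
          have "H \<subseteq> {0..<Suc n}" using n H(1) by force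
          then have "inj_on e H" using e inj_on_subset unfolding bij_betw_def by blast
          then have "card (e ` H) = k" using fH(2) card_image by metis
          then have "\<not> (\<exists>y. \<forall>l\<in>e ` H. holds M y (inst (g l) \<psi>))"
            using g(2) fH(1) unfolding k_inconsistent_iff by blast
          then show ?thesis unfolding H(2) v2[OF fH(1)] wl by simp
        qed
      qed
      then show "\<exists>c. realizes M c F" by blast
    qed
    then obtain w where w: "realizes M w (\<Gamma>0 \<union> \<Gamma>1 \<union> \<Gamma>2)" using realize_small[OF sub _ sJ A] by blast
    define y where "y = w \<circ> Inl"
    define h' where "h' l p = w (Inr (l, p))" for l p
    have yD: "holds M y \<theta>" if "\<theta> \<in> tp M id D A" for \<theta>
      using w that v0[of w \<theta>] unfolding realizes_def \<Gamma>0_def y_def by blast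
    have "tp M id D A = tp M y D A"
      unfolding tp_eq_iff
    proof
      fix \<theta> :: "('f, 'r, 'a + 'a) fm" assume "\<theta> \<in> formulas M (D <+> A)"
      then show "holds M id \<theta> \<longleftrightarrow> holds M y \<theta>" using yD[of \<theta>] yD[of "Neg \<theta>"] unfolding tp_def by auto
    qed
    then obtain \<rho> where \<rho>: "\<rho> \<in> Aut M" "\<And>x. x \<in> A \<Longrightarrow> \<rho> x = x" "\<And>d. d \<in> D \<Longrightarrow> \<rho> (id d) = y d"
      using homogeneous[OF D(1) A] by blast
    \<comment> \<open>The copy of \<open>D\<close> is moved back onto \<open>D\<close>, after which
      the tuples of the array realize the type of \<open>c\<close> over \<open>D\<close>
      itself.\<close>
    define \<rho>' where "\<rho>' = inv \<rho>"
    have \<rho>': "\<rho>' \<in> Aut M" unfolding \<rho>'_def using \<rho>(1) by (rule Aut_inv)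
    have \<rho>y: "\<rho>' (y d) = d" if "d \<in> D" for d
      using \<rho>(3)[OF that] Aut_inv_f[OF \<rho>(1), of d] unfolding \<rho>'_def by simp
    have mh: "models M q (\<rho>' \<circ> h' l) P D" for l
    proof -
      have imp: "holds M (\<rho>' \<circ> h' l) \<theta>" if \<theta>: "\<theta> \<in> formulas M (P <+> D)" "holds M c \<theta>" for \<theta>
      proof -
        have "map_fm (m1 l) \<theta> \<in> \<Gamma>1" unfolding \<Gamma>1_def using \<theta> by force
        then have "sat M UNIV (case_sum (h' l) y) [] \<theta>"
          using w v1[of w l \<theta>] unfolding realizes_def h'_def y_def by blast
        then have "sat M UNIV (\<rho>' \<circ> case_sum (h' l) y) [] \<theta>"
          using sat_aut_UNIV[OF \<rho>', of \<theta>] \<theta>(1) unfolding formulas_def by blast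
        moreover have "sat M UNIV (\<rho>' \<circ> case_sum (h' l) y) [] \<theta> \<longleftrightarrow> holds M (\<rho>' \<circ> h' l) \<theta>"
          unfolding holds_def
        proof (rule sat_cong)
          fix z assume "z \<in> frees \<theta>"
          then have "z \<in> P <+> D" using frees_formulas[OF \<theta>(1)] by blast
          then show "(\<rho>' \<circ> case_sum (h' l) y) z = case_sum (\<rho>' \<circ> h' l) id z" using \<rho>y by auto
        qed
        ultimately show ?thesis by blast
      qed
      have "tp M c P D = tp M (\<rho>' \<circ> h' l) P D"
        unfolding tp_eq_iff
      proof
        fix \<theta> :: "('f, 'r, 'a + 'a) fm" assume "\<theta> \<in> formulas M (P <+> D)"
        then show "holds M c \<theta> \<longleftrightarrow> holds M (\<rho>' \<circ> h' l) \<theta>" using imp[of \<theta>] imp[of "Neg \<theta>"] by auto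
      qed
      then show ?thesis using c(2) by (rule tp_eq_models)
    qed
    have "\<exists>h\<in>G. \<forall>p\<in>P. h p = (\<rho>' \<circ> h' l) p" for l
      using models_in_G[OF small_finite[OF P(1)] q(2) mh[of l] D(2)] by metis
    then obtain h where h: "\<And>l. h l \<in> G" "\<And>l. \<forall>p\<in>P. h l p = (\<rho>' \<circ> h' l) p" by metis
    have "models M q (h l) P D" for l
      using mh[of l] models_cong[of P "h l" "\<rho>' \<circ> h' l" M q D] h(2)[of l] by blast
    moreover have "k_inconsistent M k (\<lambda>l. inst (h l) \<psi>)"
      unfolding k_inconsistent_iff
    proof (intro allI impI notI)
      fix H :: "nat set" assume H: "finite H" "card H = k" and "\<exists>y. \<forall>l\<in>H. holds M y (inst (h l) \<psi>)"
      then obtain z where z: "\<forall>l\<in>H. holds M z (inst (h l) \<psi>)" by blast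
      have "holds M (inv \<rho>' \<circ> z) (inst (h' l) \<psi>)" if "l \<in> H" for l
      proof -
        have "inst (h l) \<psi> = inst (\<rho>' \<circ> h' l) \<psi>" using h(2)[of l] P(2) by (intro inst_cong) blast
        then show ?thesis using z that holds_inst_aut'[OF \<rho>' \<psi>, of z "h' l"] by metis
      qed
      moreover have "\<not> (\<exists>y. \<forall>l\<in>H. holds M y (inst (h' l) \<psi>))"
        using w v2[OF H(1), of w] H unfolding realizes_def \<Gamma>2_def h'_def by blast
      ultimately show False by blast
    qed
    ultimately show ?thesis using h(1) by blast
  qed
  then have "witnesses_dividing \<psi> k q P" unfolding witnesses_dividing_def by blast
  then show ?thesis by (rule that)
qed

text \<open>A strictly invariant type of the whole parameter set \<open>P\<close> makes one Morley
  sequence serve every formula of the disjunction, although the bounds \<open>m \<psi>\<close> may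
  differ. If enough instances of \<open>\<phi>\<close> have a common solution, some
  \<open>\<psi>\<close> holds there at \<open>m \<psi>\<close> indices, and a subsequence of a
  Morley sequence is again one.\<close>

lemma forks_divides:
  fixes \<phi> :: "('f, 'r, 'i + 'a) fm"
  assumes \<phi>: "\<phi> \<in> formulas M V" and forks: "forks M I A \<phi>"
  shows "divides M A \<phi>"
proof (rule ccontr)
  assume ndiv: "\<not> divides M A \<phi>"
  obtain S where S: "S \<subseteq> formulas M (I <+> UNIV)" "finite S" "\<forall>\<psi>\<in>S. divides M A \<psi>"
    "\<forall>c. holds M c \<phi> \<longrightarrow> (\<exists>\<psi>\<in>S. holds M c \<psi>)" using forks unfolding forks_def by blast
  define P where "P = params \<phi> \<union> (\<Union>\<psi>\<in>S. params \<psi>)"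
  have P: "finite P" unfolding P_def using S(2) by (simp add: finite_params)
  obtain q where q: "Inv P q" "models M q id P A" and strict:
    "\<And>C c. small \<kappa> C \<Longrightarrow> A \<subseteq> C \<Longrightarrow> models M q c P C \<Longrightarrow> \<not> type_forks M C A (tp M id C (A \<union> c ` P))"
    using strict_type_exists[OF small_finite[OF P]] by metis
  obtain N where N: "elem_substructure M N" "small \<kappa> N" "A \<subseteq> N" using small_submodel[OF A] .
  have "\<exists>m. \<forall>gs. morley q P N gs m \<longrightarrow> \<not> (\<exists>y. \<forall>j<m. holds M y (inst (gs j) \<psi>))" if \<psi>: "\<psi> \<in> S" for \<psi>
  proof -
    have f: "\<psi> \<in> formulas M (I <+> UNIV)" and d: "divides M A \<psi>" and p: "params \<psi> \<subseteq> P"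
      using S(1,3) \<psi> unfolding P_def by auto
    obtain k where "witnesses_dividing \<psi> k q P" using strict_witnesses_dividing[OF f d P p q strict] by metis
    then show ?thesis using morley_inconsistent[OF ntp2 f N q(1) P p] by metis
  qed
  then obtain m where m: "\<And>\<psi> gs. \<psi> \<in> S \<Longrightarrow> morley q P N gs (m \<psi>) \<Longrightarrow>
      \<not> (\<exists>y. \<forall>j<m \<psi>. holds M y (inst (gs j) \<psi>))" by metis
  obtain gs where gs: "\<And>n. morley q P N gs n" using morley_exists[OF N(2,3) q P] by metis
  have gG: "gs l \<in> G" for l using gs[of "Suc l"] unfolding morley_def by simp
  \<comment> \<open>One more than the sum of the bounds, for the pigeonhole principle; the successor
    also settles the case of empty \<open>S\<close>.\<close>
  define K where "K = Suc (\<Sum>\<psi>\<in>S. m \<psi>)"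
  have "\<not> k_inconsistent M K (\<lambda>l. inst (gs l) \<phi>)" using ndiv gG unfolding divides_iff_G by blast
  then obtain J y where J: "finite J" "card J = K" "\<forall>l\<in>J. holds M y (inst (gs l) \<phi>)"
    unfolding k_inconsistent_iff by blast
  define H where "H \<psi> = {l \<in> J. holds M y (inst (gs l) \<psi>)}" for \<psi>
  have "J \<subseteq> (\<Union>\<psi>\<in>S. H \<psi>)"
  proof
    fix l assume l: "l \<in> J"
    have "holds M (inv (gs l) \<circ> y) \<phi>" using J(3) l holds_inst_inv[OF gG \<phi>] by blast
    then obtain \<psi> where \<psi>: "\<psi> \<in> S" "holds M (inv (gs l) \<circ> y) \<psi>" using S(4) by blast
    then have "holds M y (inst (gs l) \<psi>)" using holds_inst_inv[OF gG, of \<psi>] S(1) by blast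
    then show "l \<in> (\<Union>\<psi>\<in>S. H \<psi>)" unfolding H_def using l \<psi>(1) by blast
  qed
  have Hf: "finite (H \<psi>)" for \<psi> unfolding H_def using J(1) by simp
  have "\<exists>\<psi>\<in>S. m \<psi> \<le> card (H \<psi>)"
  proof (rule ccontr)
    assume "\<not> (\<exists>\<psi>\<in>S. m \<psi> \<le> card (H \<psi>))"
    then have le: "card (H \<psi>) \<le> m \<psi>" if "\<psi> \<in> S" for \<psi> using that by force
    have "card J \<le> card (\<Union>\<psi>\<in>S. H \<psi>)" using \<open>J \<subseteq> _\<close> S(2) Hf by (intro card_mono) auto
    also have "\<dots> \<le> (\<Sum>\<psi>\<in>S. card (H \<psi>))" using S(2) by (rule card_UN_le)
    also have "\<dots> \<le> (\<Sum>\<psi>\<in>S. m \<psi>)" using le by (rule sum_mono)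
    finally show False using J(2) unfolding K_def by simp
  qed
  then obtain \<psi> where \<psi>: "\<psi> \<in> S" "m \<psi> \<le> card (H \<psi>)" by blast
  \<comment> \<open>An increasing enumeration, because a subsequence of a Morley sequence has to
    keep its order.\<close>
  define e where "e j = sorted_list_of_set (H \<psi>) ! j" for j
  have len: "length (sorted_list_of_set (H \<psi>)) = card (H \<psi>)" by simp
  have eH: "e j \<in> H \<psi>" if "j < m \<psi>" for j
    using that \<psi>(2) Hf nth_mem[of j "sorted_list_of_set (H \<psi>)"] unfolding e_def by simp
  have mono: "e i < e j" if "i < j" "j < m \<psi>" for i j
    using that \<psi>(2) strict_sorted_list_of_set[of "H \<psi>"] sorted_wrt_nth_less[of "(<)" "sorted_list_of_set (H \<psi>)" i j]
    unfolding e_def by simp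
  have "morley q P N (gs \<circ> e) (m \<psi>)"
  proof (rule morley_subseq)
    show "morley q P N gs (Suc (Max (insert 0 (H \<psi>))))" by (rule gs)
    show "e j < Suc (Max (insert 0 (H \<psi>)))" if "j < m \<psi>" for j
      using eH[OF that] Hf[of \<psi>] by (simp add: less_Suc_eq_le)
  qed (rule mono)
  from m[OF \<psi>(1) this] show False using eH unfolding H_def by auto
qed

end

theorem theorem3p23:
  fixes \<kappa> :: "'k rel"
    and M :: "('f, 'r, 'a) struct"
    and A :: "'a set"
  assumes "monster_model \<kappa> M"
    and "NTP2 M"
    and "small \<kappa> A"
    and "left_extension_base \<kappa> M A"
  shows "forking_eq_dividing M A \<and> strict_invariance_extension_base \<kappa> M A"
proof -
  interpret extension_base \<kappa> M A
    using assms by unfold_locales (simp_all add: left_extension_base_def)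
  have "forking_eq_dividing M A"
    unfolding forking_eq_dividing_def using forks_divides divides_forks by blast
  moreover have "strictly_invariant \<kappa> M I (tp M a I A) A" if I: "small \<kappa> I" for a :: "'k \<Rightarrow> 'a" and I
  proof -
    obtain q where q: "Inv I q" "models M q a I A" and strict:
      "\<And>C c. small \<kappa> C \<Longrightarrow> A \<subseteq> C \<Longrightarrow> models M q c I C \<Longrightarrow> \<not> type_forks M C A (tp M id C (A \<union> c ` I))"
      using strict_type_exists[OF I] by metis
    have "global_invariant_extension \<kappa> M I (tp M a I A) A q"
      using q(1) models_tp_subset[OF q(2)] unfolding global_invariant_extension_def Inv_def by blast
    then show ?thesis
      unfolding strictly_invariant_def using strict models_restrict[OF Inv_complete[OF q(1)]] by blast
  qed
  ultimately show ?thesis unfolding strict_invariance_extension_base_def by blast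
qed

end
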